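(* Consider a road network with $n$ groups of drivers as described in the context. Let the flux functions $F_{ij}$ and the cost functions $\varphi_k,\psi_k$ satisfy the following assumptions. (A1) For every viable arc $\gamma_{ij}$, the flux function $\rho\mapsto F_{ij}(\rho)=\rho\,v_{ij}(\rho)$ is continuous, concave and non-negative on some interval $[0,\bar\rho_{ij}]$, with $F_{ij}(0)=F_{ij}(\bar\rho_{ij})=0$; and $\rho_{ij}^*\in\,]0,\bar\rho_{ij}[$ denotes the unique value such that $F_{ij}(\rho_{ij}^* )=F_{ij}^{max}\doteq\max_{\rho\in[0,\bar\rho_{ij}]}F_{ij}(\rho)$ and $F_{ij}'(\rho)>0$ for a.e. $\rho\in[0,\rho_{ij}^*]$. (A2) For every $k\in\{1,\ldots,n\}$ the functions $\varphi_k,\psi_k:\mathbb{R}\to\mathbb{R}$ are continuously differentiable and satisfy $\varphi_k'(t)<0$ and $\psi_k'(t)>0$ for all $t$, and $\lim_{|t|\to\infty}(\varphi_k(t)+\psi_k(t))=+\infty$. Then, for any $n$-tuple $(G_1,\ldots,G_n)$ of nonnegative numbers, there exists an admissible set of departure distributions $\{U_{k,p}\}$ and a set of prioritizing functions $\{\mathcal{B}_{k,p}\}$ which yield a globally optimal solution of the traffic flow problem, i.e. which attain the minimum of the total cost $$J=\sum_{k,p}\int_0^{G_{k,p}}\Big(\varphi_k(\tau^d_{k,p}(\beta))+\psi_k(\tau^a_{k,p}(\beta))\Big)\,d\beta$$ among all admissible sets of departure distributions and all corresponding prioritizing functions.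
   Context: **Network.** The network has nodes $A_1,\ldots,A_m$; $\gamma_{ij}$ is the arc from $A_i$ to $A_j$, of length $L_{ij}>0$. On $\gamma_{ij}$ the speed of cars as a function of the density $\rho$ is a continuous nonincreasing function $v_{ij}$, and traffic follows $\rho_t+[\rho\,v_{ij}(\rho)]_x=0$. The arc is viable if $v_{ij}(0)>0$ (if there is no road, $v_{ij}\equiv0$). A viable path is a concatenation of viable arcs $(\gamma_{i(0),i(1)},\gamma_{i(1),i(2)},\ldots,\gamma_{i(\nu-1),i(\nu)})$ containing no closed loop. Let $\mathcal{V}=\{\Gamma_1,\ldots,\Gamma_N\}$ be the (finite) set of all viable paths. Drivers of group $k\in\{1,\ldots,n\}$ (of total size $G_k$) depart from node $A_{d(k)}$ and arrive at node $A_{a(k)}$. $\mathcal{V}_k\subset\mathcal{V}$ is the set of viable paths from $A_{d(k)}$ to $A_{a(k)}$, and it is assumed that $\mathcal{V}_k\neq\emptyset$ for every $k$. A driver of group $k$ departing at time $\tau^d$ and reaching destination at time $\tau^a$ bears the cost $\varphi_k(\tau^d)+\psi_k(\tau^a)$. **Departure distributions.** A departure distribution function $t\mapsto U_{k,p}(t)$ is a bounded, nondecreasing, left-continuous function on $\mathbb{R}$ with $U_{k,p}(-\infty)=0$; $U_{k,p}(t)$ is the number of drivers of group $k$ traveling along $\Gamma_p$ who have departed before time $t$ ($U_{k,p}\equiv0$ if $\Gamma_p\notin\mathcal{V}_k$). A set $\{U_{k,p}\}$ is admissible if $\sum_pU_{k,p}(+\infty)=G_k$ for all $k$. Put $G_{k,p}=U_{k,p}(+\infty)$;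 the corresponding subgroup of drivers is $\mathcal{G}_{k,p}$. **Prioritizing functions.** For an arc $\gamma_{ij}$ let $\mathcal{G}_{ij}$ be the union of the subgroups $\mathcal{G}_{k,p}$ with $d(k)=i$ and $\gamma_{ij}\in\Gamma_p$ (drivers starting at $A_i$ with first arc $\gamma_{ij}$), and let $G_{ij}=\sum_{d(k)=i,\,\gamma_{ij}\in\Gamma_p}G_{k,p}$ and $U^{depart}_{ij}(t)=\sum_{d(k)=i,\,\gamma_{ij}\in\Gamma_p}U_{k,p}(t)$. A set of prioritizing functions for departures on $\gamma_{ij}$ is a family of nondecreasing maps $\mathcal{B}_{k,p}:[0,G_{ij}]\to[0,G_{k,p}]$, one for each $\mathcal{G}_{k,p}\subseteq\mathcal{G}_{ij}$, such that $\sum_{\mathcal{G}_{k,p}\subseteq\mathcal{G}_{ij}}\mathcal{B}_{k,p}(\beta)=\beta$ for all $\beta\in[0,G_{ij}]$ and $\mathcal{B}_{k,p}(U^{depart}_{ij}(t))=U_{k,p}(t)$ for a.e. $t$. (Among the first $\beta$ drivers departing on $\gamma_{ij}$, $\mathcal{B}_{k,p}(\beta)$ belong to $\mathcal{G}_{k,p}$.) One such set is chosen for each arc. **Traffic flow.** Let $g_{ij}:[0,F_{ij}^{max}]\to[0,\rho_{ij}^*]$ be the inverse of $F_{ij}$ restricted to $[0,\rho^*_{ij}]$, and $g_{ij}^*(p)=\max_{u\in[0,F_{ij}^{max}]}(pu-g_{ij}(u))$. For $\gamma_{ij}\in\Gamma_p$, let $U^-_{kp,ij}(t)$ (resp. $U^+_{kp,ij}(t)$)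 be the number of $(k,p)$-drivers that have entered $\gamma_{ij}$, possibly joining a queue at its entrance (resp. have exited from $\gamma_{ij}$), within time $t$. These are determined from $\{U_{k,p}\}$ and $\{\mathcal{B}_{k,p}\}$ by the following relations (separate queues at the entrance of each arc, first-come first-serve): - if $\gamma_{ij}$ is the first arc of $\Gamma_p\in\mathcal{V}_k$, then $U^-_{kp,ij}=U_{k,p}$; if $\gamma_{\ell i}$ precedes $\gamma_{ij}$ in $\Gamma_p$, then $U^-_{kp,ij}=U^+_{kp,\ell i}$; - $U^-_{ij}=\sum_{k,p}U^-_{kp,ij}=U_{ij}^{depart}+U_{ij}^{transit}$, where $U_{ij}^{transit}$ is the sum over the $(k,p)$ for which $\gamma_{ij}\in\Gamma_p$ is not the first arc; - $U^+_{ij}(t)=\min_\tau\{U^-_{ij}(\tau)+L_{ij}\,g_{ij}^*(\frac{t-\tau}{L_{ij}})\}$; - let $\tau^{enter}(t)$ be a time $\tau$ with $\lim_{s\to\tau-}U^-_{ij}(s)\le U^+_{ij}(t)\le\lim_{s\to\tau+}U^-_{ij}(s)$ (the values below do not depend on the choice). For subgroups in transit, $U^+_{kp,ij}(t)=U^-_{kp,ij}(\tau^{enter}(t))$. For subgroups starting at $A_i$, $U^+_{kp,ij}(t)=\mathcal{B}_{k,p}(\beta)$ with $\beta=U^+_{ij}(t)-U^{transit}_{ij}(\tau^{enter}(t))$. **Departure and arrival times.** Let $U^{arrive}_{k,p}(t)=U^+_{kp,ij}(t)$ with $\gamma_{ij}$ the last arc of $\Gamma_p$. For a.e. $\beta\in[0,G_{k,p}]$,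 the departure and arrival times of the $\beta$-th driver of $\mathcal{G}_{k,p}$ are $$\tau^d_{k,p}(\beta)=\inf\{t:\ U_{k,p}(t)\ge\beta\},\qquad \tau^a_{k,p}(\beta)=\inf\{t:\ U^{arrive}_{k,p}(t)\ge\beta\}.$$ *)

theory Defs
  imports "HOL-Analysis.Analysis"
begin

type_synonym arc = "nat \<times> nat"

text \<open>A path is the list of nodes it visits; these lists serve as the path indices \<open>p\<close>.\<close>

type_synonym path = "nat list"

record traffic_network =
  num_nodes :: nat                          \<comment> \<open>\<open>m\<close>\<close>
  num_groups :: nat                         \<comment> \<open>\<open>n\<close>\<close>
  len :: "arc \<Rightarrow> real"                      \<comment> \<open>\<open>L_ij\<close>\<close>
  speed :: "arc \<Rightarrow> real \<Rightarrow> real"            \<comment> \<open>\<open>v_ij\<close>\<close>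
  jam :: "arc \<Rightarrow> real"                      \<comment> \<open>\<open>\<rho>bar_ij\<close>\<close>
  origin :: "nat \<Rightarrow> nat"                    \<comment> \<open>\<open>d(k)\<close>\<close>
  dest :: "nat \<Rightarrow> nat"                      \<comment> \<open>\<open>a(k)\<close>\<close>
  dep_cost :: "nat \<Rightarrow> real \<Rightarrow> real"         \<comment> \<open>\<open>\<phi>_k\<close>\<close>
  arr_cost :: "nat \<Rightarrow> real \<Rightarrow> real"         \<comment> \<open>\<open>\<psi>_k\<close>\<close>

definition nodes :: "traffic_network \<Rightarrow> nat set" where
  "nodes N = {1..num_nodes N}"

definition groups :: "traffic_network \<Rightarrow> nat set" where
  "groups N = {1..num_groups N}"

definition viable_arc :: "traffic_network \<Rightarrow> arc \<Rightarrow> bool" where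
  "viable_arc N e \<longleftrightarrow> fst e \<in> nodes N \<and> snd e \<in> nodes N \<and> speed N e 0 > 0"

definition path_arcs :: "path \<Rightarrow> arc list" where
  "path_arcs p = zip p (tl p)"

definition viable_paths :: "traffic_network \<Rightarrow> path set" where
  "viable_paths N =
     {p. 2 \<le> length p \<and> distinct p \<and> (\<forall>e\<in>set (path_arcs p). viable_arc N e)}"

definition group_paths :: "traffic_network \<Rightarrow> nat \<Rightarrow> path set" where
  "group_paths N k = {p \<in> viable_paths N. hd p = origin N k \<and> last p = dest N k}"

definition well_formed :: "traffic_network \<Rightarrow> bool" where
  "well_formed N \<longleftrightarrow>
     (\<forall>e. viable_arc N e \<longrightarrow>
        0 < len N e \<and>
        continuous_on {0..jam N e} (speed N e) \<and>
        antimono_on {0..jam N e} (speed N e)) \<and>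
     (\<forall>k\<in>groups N. origin N k \<in> nodes N \<and> dest N k \<in> nodes N \<and> group_paths N k \<noteq> {})"

lemma finite_viable_paths: "finite (viable_paths N)"
proof (rule finite_subset)
  show "viable_paths N \<subseteq> {p. set p \<subseteq> nodes N \<and> distinct p}"
  proof
    fix p assume p: "p \<in> viable_paths N"
    have "x \<in> nodes N" if "x \<in> set p" for x
    proof -
      from that obtain q where q: "q < length p" "p ! q = x"
        by (auto simp: in_set_conv_nth)
      show ?thesis
      proof (cases "Suc q < length p")
        case True
        then have "(p ! q, p ! Suc q) \<in> set (path_arcs p)"
          unfolding path_arcs_def set_zip by (force simp: nth_tl)
        with p q show ?thesis
          unfolding viable_paths_def viable_arc_def by force
      next
        case False
        with p q have "Suc (q - 1) = q" "Suc (q - 1) < length p"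
          by (auto simp: viable_paths_def)
        then have "(p ! (q - 1), p ! q) \<in> set (path_arcs p)"
          unfolding path_arcs_def set_zip
          by (auto simp: nth_tl intro!: exI[of _ "q - 1"])
        with p q show ?thesis
          unfolding viable_paths_def viable_arc_def by force
      qed
    qed
    with p show "p \<in> {p. set p \<subseteq> nodes N \<and> distinct p}"
      by (auto simp: viable_paths_def)
  qed
  show "finite {p. set p \<subseteq> nodes N \<and> distinct p}"
    by (rule finite_subset_distinct) (simp add: nodes_def)
qed

definition flux :: "traffic_network \<Rightarrow> arc \<Rightarrow> real \<Rightarrow> real" where
  "flux N e \<rho> = \<rho> * speed N e \<rho>"

definition flux_max :: "traffic_network \<Rightarrow> arc \<Rightarrow> real" where
  "flux_max N e = (SUP \<rho>\<in>{0..jam N e}. flux N e \<rho>)"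

definition is_crit_density :: "traffic_network \<Rightarrow> arc \<Rightarrow> real \<Rightarrow> bool" where
  "is_crit_density N e r \<longleftrightarrow>
     0 < r \<and> r < jam N e \<and> flux N e r = flux_max N e \<and>
     (AE \<rho> in lborel. \<rho> \<in> {0..r} \<longrightarrow> (\<exists>D>0. (flux N e has_real_derivative D) (at \<rho>)))"

text \<open>The density \<open>\<rho>*_ij\<close>.\<close>

definition crit_density :: "traffic_network \<Rightarrow> arc \<Rightarrow> real" where
  "crit_density N e = (THE r. is_crit_density N e r)"

definition flux_assumption :: "traffic_network \<Rightarrow> bool" where
  "flux_assumption N \<longleftrightarrow>
     (\<forall>e. viable_arc N e \<longrightarrow>
        continuous_on {0..jam N e} (flux N e) \<and>
        concave_on {0..jam N e} (flux N e) \<and>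
        (\<forall>\<rho>\<in>{0..jam N e}. 0 \<le> flux N e \<rho>) \<and>
        flux N e 0 = 0 \<and> flux N e (jam N e) = 0 \<and>
        (\<exists>!r. is_crit_density N e r))"

definition cost_assumption :: "traffic_network \<Rightarrow> bool" where
  "cost_assumption N \<longleftrightarrow>
     (\<forall>k\<in>groups N.
        dep_cost N k C1_differentiable_on UNIV \<and>
        arr_cost N k C1_differentiable_on UNIV \<and>
        (\<forall>t. deriv (dep_cost N k) t < 0 \<and> deriv (arr_cost N k) t > 0) \<and>
        filterlim (\<lambda>t. dep_cost N k t + arr_cost N k t) at_top at_infinity)"

definition flux_inv :: "traffic_network \<Rightarrow> arc \<Rightarrow> real \<Rightarrow> real" where
  "flux_inv N e = inv_into {0..crit_density N e} (flux N e)"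

text \<open>The function \<open>g*_ij\<close>; the supremum is a maximum because \<open>flux_inv\<close> is continuous.\<close>

definition flux_inv_conj :: "traffic_network \<Rightarrow> arc \<Rightarrow> real \<Rightarrow> real" where
  "flux_inv_conj N e q = (SUP u\<in>{0..flux_max N e}. q * u - flux_inv N e u)"

definition departure_distribution :: "(real \<Rightarrow> real) \<Rightarrow> bool" where
  "departure_distribution f \<longleftrightarrow>
     bounded (range f) \<and> mono f \<and> (\<forall>t. continuous (at_left t) f) \<and> (f \<longlongrightarrow> 0) at_bot"

text \<open>The size \<open>G_kp = U_kp(+\<infinity>)\<close>.\<close>

definition subgroup_size :: "(nat \<Rightarrow> path \<Rightarrow> real \<Rightarrow> real) \<Rightarrow> nat \<Rightarrow> path \<Rightarrow> real" where
  "subgroup_size U k p = Lim at_top (U k p)"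

definition admissible ::
  "traffic_network \<Rightarrow> (nat \<Rightarrow> real) \<Rightarrow> (nat \<Rightarrow> path \<Rightarrow> real \<Rightarrow> real) \<Rightarrow> bool" where
  "admissible N G U \<longleftrightarrow>
     (\<forall>k\<in>groups N.
        (\<forall>p\<in>viable_paths N. departure_distribution (U k p)) \<and>
        (\<forall>p\<in>viable_paths N - group_paths N k. \<forall>t. U k p t = 0) \<and>
        (\<Sum>p\<in>viable_paths N. subgroup_size U k p) = G k)"

text \<open>Only the pairs \<open>(k,p)\<close> with \<open>\<Gamma>_p \<in> \<V>_k\<close> are kept: for all others \<open>G_kp = 0\<close>.\<close>

definition subgroups :: "traffic_network \<Rightarrow> (nat \<times> path) set" where
  "subgroups N = (SIGMA k:groups N. group_paths N k)"

definition users :: "traffic_network \<Rightarrow> arc \<Rightarrow> (nat \<times> path) set" where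
  "users N e = {(k, p) \<in> subgroups N. e \<in> set (path_arcs p)}"

definition departing :: "traffic_network \<Rightarrow> arc \<Rightarrow> (nat \<times> path) set" where
  "departing N e = {(k, p) \<in> users N e. origin N k = fst e}"

definition in_transit :: "traffic_network \<Rightarrow> arc \<Rightarrow> (nat \<times> path) set" where
  "in_transit N e = {(k, p) \<in> users N e. e \<noteq> hd (path_arcs p)}"

definition arc_size ::
  "traffic_network \<Rightarrow> (nat \<Rightarrow> path \<Rightarrow> real \<Rightarrow> real) \<Rightarrow> arc \<Rightarrow> real" where
  "arc_size N U e = (\<Sum>(k, p)\<in>departing N e. subgroup_size U k p)"

definition arc_depart ::
  "traffic_network \<Rightarrow> (nat \<Rightarrow> path \<Rightarrow> real \<Rightarrow> real) \<Rightarrow> arc \<Rightarrow> real \<Rightarrow> real" where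
  "arc_depart N U e t = (\<Sum>(k, p)\<in>departing N e. U k p t)"

text \<open>Every pair \<open>(k,p)\<close> in \<open>subgroups N\<close> departs on exactly one arc (the first arc of \<open>p\<close>), so
  \<open>B k p\<close> needs no arc index.\<close>

definition prioritizing ::
  "traffic_network \<Rightarrow> (nat \<Rightarrow> path \<Rightarrow> real \<Rightarrow> real) \<Rightarrow> (nat \<Rightarrow> path \<Rightarrow> real \<Rightarrow> real) \<Rightarrow> bool" where
  "prioritizing N U B \<longleftrightarrow>
     (\<forall>e. viable_arc N e \<longrightarrow>
        (\<forall>(k, p)\<in>departing N e.
           B k p \<in> {0..arc_size N U e} \<rightarrow> {0..subgroup_size U k p} \<and>
           mono_on {0..arc_size N U e} (B k p) \<and>
           (AE t in lborel. B k p (arc_depart N U e t) = U k p t)) \<and>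
        (\<forall>\<beta>\<in>{0..arc_size N U e}. (\<Sum>(k, p)\<in>departing N e. B k p \<beta>) = \<beta>))"

text \<open>In what follows \<open>Um k p e\<close> and \<open>Up k p e\<close> stand for \<open>U^-_kp,ij\<close> and \<open>U^+_kp,ij\<close> with
  \<open>e = (i,j)\<close>.\<close>

definition total_entered ::
  "traffic_network \<Rightarrow> (nat \<Rightarrow> path \<Rightarrow> arc \<Rightarrow> real \<Rightarrow> real) \<Rightarrow> arc \<Rightarrow> real \<Rightarrow> real" where
  "total_entered N Um e t = (\<Sum>(k, p)\<in>users N e. Um k p e t)"

definition transit_entered ::
  "traffic_network \<Rightarrow> (nat \<Rightarrow> path \<Rightarrow> arc \<Rightarrow> real \<Rightarrow> real) \<Rightarrow> arc \<Rightarrow> real \<Rightarrow> real" where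
  "transit_entered N Um e t = (\<Sum>(k, p)\<in>in_transit N e. Um k p e t)"

text \<open>The total \<open>U^+_ij\<close>; for a traffic flow as defined below the infimum is a minimum, since
  \<open>total_entered\<close> is then nondecreasing and left-continuous.\<close>

definition total_exited ::
  "traffic_network \<Rightarrow> (nat \<Rightarrow> path \<Rightarrow> arc \<Rightarrow> real \<Rightarrow> real) \<Rightarrow> arc \<Rightarrow> real \<Rightarrow> real" where
  "total_exited N Um e t =
     (INF \<tau>. total_entered N Um e \<tau> + len N e * flux_inv_conj N e ((t - \<tau>) / len N e))"

definition is_enter_time ::
  "traffic_network \<Rightarrow> (nat \<Rightarrow> path \<Rightarrow> arc \<Rightarrow> real \<Rightarrow> real) \<Rightarrow> arc \<Rightarrow> real \<Rightarrow> real \<Rightarrow> bool" where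
  "is_enter_time N Um e t \<tau> \<longleftrightarrow>
     Lim (at_left \<tau>) (total_entered N Um e) \<le> total_exited N Um e t \<and>
     total_exited N Um e t \<le> Lim (at_right \<tau>) (total_entered N Um e)"

text \<open>What it means for \<open>f t\<close> to be the number of drivers, out of a population of size \<open>c\<close>, that
  have done something within time \<open>t\<close>.\<close>

definition cumulative_count :: "real \<Rightarrow> (real \<Rightarrow> real) \<Rightarrow> bool" where
  "cumulative_count c f \<longleftrightarrow> mono f \<and> (f \<longlongrightarrow> 0) at_bot \<and> (\<forall>t. f t \<le> c)"

text \<open>The flow is a relation because the defining equations are implicit when the arcs used by
  different paths form a cycle.  Since \<open>B k p\<close> is only meaningful on \<open>[0, G_ij]\<close>, its argument is
  required to lie there.\<close>

definition traffic_flow ::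
  "traffic_network \<Rightarrow> (nat \<Rightarrow> path \<Rightarrow> real \<Rightarrow> real) \<Rightarrow> (nat \<Rightarrow> path \<Rightarrow> real \<Rightarrow> real) \<Rightarrow>
   (nat \<Rightarrow> path \<Rightarrow> arc \<Rightarrow> real \<Rightarrow> real) \<Rightarrow> (nat \<Rightarrow> path \<Rightarrow> arc \<Rightarrow> real \<Rightarrow> real) \<Rightarrow> bool" where
  "traffic_flow N U B Um Up \<longleftrightarrow>
     (\<forall>(k, p)\<in>subgroups N.
        (\<forall>e\<in>set (path_arcs p).
           cumulative_count (subgroup_size U k p) (Um k p e) \<and>
           cumulative_count (subgroup_size U k p) (Up k p e)) \<and>
        Um k p (hd (path_arcs p)) = U k p \<and>
        (\<forall>q. Suc q < length (path_arcs p) \<longrightarrow>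
           Um k p (path_arcs p ! Suc q) = Up k p (path_arcs p ! q))) \<and>
     (\<exists>\<tau>enter. \<forall>e t. viable_arc N e \<longrightarrow>
        is_enter_time N Um e t (\<tau>enter e t) \<and>
        (\<forall>(k, p)\<in>in_transit N e. Up k p e t = Um k p e (\<tau>enter e t)) \<and>
        (\<forall>(k, p)\<in>departing N e.
           (let \<beta> = total_exited N Um e t - transit_entered N Um e (\<tau>enter e t)
            in \<beta> \<in> {0..arc_size N U e} \<and> Up k p e t = B k p \<beta>)))"

definition departure_time :: "(nat \<Rightarrow> path \<Rightarrow> real \<Rightarrow> real) \<Rightarrow> nat \<Rightarrow> path \<Rightarrow> real \<Rightarrow> real" where
  "departure_time U k p \<beta> = Inf {t. U k p t \<ge> \<beta>}"

definition arrival_time ::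
  "(nat \<Rightarrow> path \<Rightarrow> arc \<Rightarrow> real \<Rightarrow> real) \<Rightarrow> nat \<Rightarrow> path \<Rightarrow> real \<Rightarrow> real" where
  "arrival_time Up k p \<beta> = Inf {t. Up k p (last (path_arcs p)) t \<ge> \<beta>}"

text \<open>The Bochner integral is 0 for non-integrable functions, so an integral that can take the
  value \<open>+\<infinity>\<close> is needed.  The negative part of the integrands below is bounded.\<close>

definition extended_integral :: "real set \<Rightarrow> (real \<Rightarrow> real) \<Rightarrow> ereal" where
  "extended_integral S f =
     enn2ereal (\<integral>\<^sup>+x\<in>S. ennreal (f x) \<partial>lborel) - enn2ereal (\<integral>\<^sup>+x\<in>S. ennreal (- f x) \<partial>lborel)"

definition total_cost ::
  "traffic_network \<Rightarrow> (nat \<Rightarrow> path \<Rightarrow> real \<Rightarrow> real) \<Rightarrow>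
   (nat \<Rightarrow> path \<Rightarrow> arc \<Rightarrow> real \<Rightarrow> real) \<Rightarrow> ereal" where
  "total_cost N U Up =
     (\<Sum>(k, p)\<in>subgroups N.
        extended_integral {0..subgroup_size U k p}
          (\<lambda>\<beta>. dep_cost N k (departure_time U k p \<beta>) + arr_cost N k (arrival_time Up k p \<beta>)))"

definition solution ::
  "traffic_network \<Rightarrow> (nat \<Rightarrow> real) \<Rightarrow>
   (nat \<Rightarrow> path \<Rightarrow> real \<Rightarrow> real) \<Rightarrow> (nat \<Rightarrow> path \<Rightarrow> real \<Rightarrow> real) \<Rightarrow>
   (nat \<Rightarrow> path \<Rightarrow> arc \<Rightarrow> real \<Rightarrow> real) \<Rightarrow> (nat \<Rightarrow> path \<Rightarrow> arc \<Rightarrow> real \<Rightarrow> real) \<Rightarrow> bool" where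
  "solution N G U B Um Up \<longleftrightarrow>
     admissible N G U \<and> prioritizing N U B \<and> traffic_flow N U B Um Up"

end

(*
The flow determined by departures and priorities is only a relation, but it is closed under limits.
The cost of a driver of group k departing at time t is at least phi_k(t) + psi_k(t), so bounded total
cost makes the departure distributions tight. All outflows U^+ are Lipschitz with a common constant,
and so are the prioritizing functions, which are monotone and add up to the identity. Helly's theorem
therefore extracts from a minimizing sequence a limit of departures, priorities and flows; by
tightness no mass is lost. The limit is again a solution, because U^-_ij -> U^+_ij is continuous under
convergence outside a countable set and the enter times can be chosen in a window common to the whole
sequence. Arrival times are lower semicontinuous and departure times converge almost everywhere, so by
Fatou's lemma the limit attains the infimum of the cost.

Solutions exist at all because the travel time on an arc is at least L_ij / v_ij(0) > 0: if all groups
depart along a common ramp, so that linear prioritizing functions work, then the flow up to time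
t + delta is determined by the flow up to time t, and iteration stabilizes on every half-line.
*)

theory Submission
  imports Defs "HOL-Probability.Helly_Selection"
begin

section \<open>Outflow of a delay kernel\<close>

text \<open>What the proof uses of the traffic model on an arc is condensed in
  \<open>delay_kernel\<close>: L g*(s / L) is the supremum of the affine functions s u - L g(u), so
  it is monotone and Lipschitz, vanishes up to the free-flow travel time and eventually grows at
  full capacity.

  The obstacle in passing to limits is that departures may jump, while enter times and the arguments
  of the priorities are given only implicitly. Jumps are confined to departures: after one arc every
  count is Lipschitz. Hence transit counts may be evaluated at converging enter times, and
  departures are evaluated off a countable set, with monotonicity bridging the gaps.

  The signs of the cost derivatives fit this convergence. Since phi decreases and psi increases,
  lower semicontinuity needs upper bounds on departure times and lower bounds on arrival times, and
  both follow from strict inequalities between counts, which survive pointwise convergence. A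
  constant per driver is added to make the integrands nonnegative; as group sizes are fixed, all
  total costs change by the same finite amount.\<close>

definition outflow :: "(real \<Rightarrow> real) \<Rightarrow> (real \<Rightarrow> real) \<Rightarrow> real \<Rightarrow> real" where
  "outflow h E t = (INF \<tau>. E \<tau> + h (t - \<tau>))"

text \<open>\<open>outflow\<close> is the infimal convolution of inflow and kernel, the Lax formula
  for cumulative exits. In the instance \<open>kernel_locale\<close>, \<delta> is the free-flow
  travel time, F the capacity and c = L rho* the number of cars on an arc filled at critical
  density. The lower bound says that after time (M + c) / F even M waiting drivers have
  left.\<close>

locale delay_kernel =
  fixes h :: "real \<Rightarrow> real" and \<delta> F c :: real
  assumes delay_pos: "0 < \<delta>"
    and rate_pos: "0 < F"
    and kernel_zero: "s \<le> \<delta> \<Longrightarrow> h s = 0"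
    and kernel_mono: "s \<le> s' \<Longrightarrow> h s \<le> h s'"
    and kernel_lipschitz: "s \<le> s' \<Longrightarrow> h s' \<le> h s + F * (s' - s)"
    and kernel_lower: "F * s - c \<le> h s"
begin

lemma kernel_nonneg: "0 \<le> h s"
  using kernel_zero[of "min s \<delta>"] kernel_mono[of "min s \<delta>" s] by auto

lemma outflow_bdd: "(\<And>t. 0 \<le> E t) \<Longrightarrow> bdd_below (range (\<lambda>\<tau>. E \<tau> + h (t - \<tau>)))"
  by (rule bdd_belowI[of _ 0]) (auto intro!: add_nonneg_nonneg kernel_nonneg)

lemma outflow_le: "(\<And>t. 0 \<le> E t) \<Longrightarrow> outflow h E t \<le> E \<tau> + h (t - \<tau>)"
  unfolding outflow_def by (rule cINF_lower[OF outflow_bdd]) auto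

lemma outflow_greatest: "(\<And>\<tau>. y \<le> E \<tau> + h (t - \<tau>)) \<Longrightarrow> y \<le> outflow h E t"
  unfolding outflow_def by (rule cINF_greatest) auto

lemma outflow_nonneg: "(\<And>t. 0 \<le> E t) \<Longrightarrow> 0 \<le> outflow h E t"
  by (rule outflow_greatest) (auto intro!: add_nonneg_nonneg kernel_nonneg)

lemma outflow_mono:
  assumes "\<And>t. 0 \<le> E t" "t \<le> t'"
  shows "outflow h E t \<le> outflow h E t'"
proof (rule outflow_greatest)
  fix \<tau>
  have "outflow h E t \<le> E \<tau> + h (t - \<tau>)" using assms(1) by (rule outflow_le)
  also have "\<dots> \<le> E \<tau> + h (t' - \<tau>)" using assms(2) by (simp add: kernel_mono)
  finally show "outflow h E t \<le> E \<tau> + h (t' - \<tau>)" .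
qed

lemma outflow_lipschitz:
  assumes "\<And>t. 0 \<le> E t" "t \<le> t'"
  shows "outflow h E t' \<le> outflow h E t + F * (t' - t)"
proof -
  have "outflow h E t' - F * (t' - t) \<le> outflow h E t"
  proof (rule outflow_greatest)
    fix \<tau>
    have "outflow h E t' \<le> E \<tau> + h (t' - \<tau>)" using assms(1) by (rule outflow_le)
    also have "h (t' - \<tau>) \<le> h (t - \<tau>) + F * (t' - t)"
      using kernel_lipschitz[of "t - \<tau>" "t' - \<tau>"] assms(2) by simp
    finally show "outflow h E t' - F * (t' - t) \<le> E \<tau> + h (t - \<tau>)" by simp
  qed
  then show ?thesis by simp
qed

lemma outflow_le_delayed:
  assumes "\<And>t. 0 \<le> E t"
  shows "outflow h E t \<le> E (t - \<delta>)"
  using outflow_le[of E t "t - \<delta>", OF assms] kernel_zero[of \<delta>] by simp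

lemma outflow_le_inflow:
  assumes "\<And>t. 0 \<le> E t" "mono E"
  shows "outflow h E t \<le> E t"
  using outflow_le_delayed[of E t, OF assms(1)] monoD[OF assms(2), of "t - \<delta>" t] delay_pos by simp

text \<open>Values of \<tau> before \<sigma> are harmless because there the kernel alone is at least
  M, later ones because E is monotone. So whoever entered by \<sigma> has left once t - \<sigma>
  \<ge> (M + c) / F.\<close>

lemma outflow_ge:
  assumes "mono E" "\<And>t. 0 \<le> E t" "\<And>t. E t \<le> M" "M \<le> F * (t - \<sigma>) - c"
  shows "E \<sigma> \<le> outflow h E t"
proof (rule outflow_greatest)
  fix \<tau>
  show "E \<sigma> \<le> E \<tau> + h (t - \<tau>)"
  proof (cases "\<sigma> \<le> \<tau>")
    case True
    then show ?thesis using monoD[OF assms(1) True] kernel_nonneg[of "t - \<tau>"] by simp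
  next
    case False
    have "E \<sigma> \<le> M" by (rule assms)
    also have "M \<le> h (t - \<sigma>)" using assms(4) kernel_lower[of "t - \<sigma>"] by simp
    also have "\<dots> \<le> h (t - \<tau>)" using False by (intro kernel_mono) simp
    finally show ?thesis using assms(2)[of \<tau>] by simp
  qed
qed

text \<open>Causality: values of \<tau> beyond t - \<delta> cannot lower the infimum, since at t -
  \<delta> the kernel already vanishes and E is no larger. The existence proof rests on
  this.\<close>

lemma outflow_cong:
  assumes "mono E" "mono E'" "\<And>t. 0 \<le> E t" "\<And>t. 0 \<le> E' t"
    and eq: "\<And>s. s \<le> t - \<delta> \<Longrightarrow> E s = E' s"
  shows "outflow h E t = outflow h E' t"
proof -
  have *: "outflow h E t \<le> outflow h E' t"
    if "mono E" "mono E'" "\<And>t. 0 \<le> E t" "\<And>s. s \<le> t - \<delta> \<Longrightarrow> E s = E' s" for E E' :: "real \<Rightarrow> real"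
  proof (rule outflow_greatest)
    fix \<tau>
    show "outflow h E t \<le> E' \<tau> + h (t - \<tau>)"
    proof (cases "\<tau> \<le> t - \<delta>")
      case True
      then show ?thesis using outflow_le[of E t \<tau>, OF that(3)] that(4) by simp
    next
      case False
      have "outflow h E t \<le> E (t - \<delta>)" by (rule outflow_le_delayed) fact
      also have "\<dots> = E' (t - \<delta>)" using that(4) by simp
      also have "\<dots> \<le> E' \<tau>" using False by (intro monoD[OF that(2)]) simp
      finally show ?thesis using kernel_nonneg[of "t - \<tau>"] by simp
    qed
  qed
  show ?thesis
    using *[of E E'] *[of E' E] assms by (intro antisym) auto
qed

text \<open>The upper bound tests one near-minimal \<tau>, nudged to the left to avoid C. The lower
  bound must be uniform in \<tau>; monotonicity of E n and the Lipschitz kernel reduce it to a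
  finite grid of points outside C.\<close>

lemma outflow_limit:
  fixes E :: "nat \<Rightarrow> real \<Rightarrow> real"
  assumes mono: "\<And>n. mono (E n)" and nonneg: "\<And>n t. 0 \<le> E n t"
    and mono': "mono E'" and nonneg': "\<And>t. 0 \<le> E' t" and le': "\<And>t. E' t \<le> M"
    and C: "countable C" and conv: "\<And>t. t \<notin> C \<Longrightarrow> (\<lambda>n. E n t) \<longlonglongrightarrow> E' t"
  shows "(\<lambda>n. outflow h (E n) t) \<longlonglongrightarrow> outflow h E' t"
proof (rule order_tendstoI)
  fix y assume y: "outflow h E' t < y"
  then obtain \<tau> where \<tau>: "E' \<tau> + h (t - \<tau>) < y"
    unfolding outflow_def using cINF_less_iff[OF _ outflow_bdd[OF nonneg']] by auto
  \<comment> \<open>Moving \<tau> to the left by less than d raises the kernel by less than F d,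
    which is the whole slack.\<close>
  define d where "d = (y - (E' \<tau> + h (t - \<tau>))) / F"
  have d: "0 < d" using \<tau> rate_pos by (simp add: d_def)
  obtain s where s: "s \<in> {\<tau> - d<..<\<tau>}" "s \<notin> C"
    using open_minus_countable[OF C, of "{\<tau> - d<..<\<tau>}"] d by auto
  have "h (t - s) \<le> h (t - \<tau>) + F * (\<tau> - s)"
    using kernel_lipschitz[of "t - \<tau>" "t - s"] s by simp
  moreover have "F * (\<tau> - s) < F * d" using s rate_pos by simp
  moreover have "F * d = y - (E' \<tau> + h (t - \<tau>))" using rate_pos by (simp add: d_def)
  moreover have "E' s \<le> E' \<tau>" using s by (intro monoD[OF mono']) simp
  ultimately have "E' s + h (t - s) < y" by simp
  moreover have "(\<lambda>n. E n s + h (t - s)) \<longlonglongrightarrow> E' s + h (t - s)"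
    by (intro tendsto_intros conv s)
  ultimately have "\<forall>\<^sub>F n in sequentially. E n s + h (t - s) < y"
    by (rule order_tendstoD(2)[rotated])
  then show "\<forall>\<^sub>F n in sequentially. outflow h (E n) t < y"
    by eventually_elim (rule le_less_trans[OF outflow_le[OF nonneg]])
next
  fix y assume y: "y < outflow h E' t"
  \<comment> \<open>A quarter of the gap: crossing two cells of width \<eta> costs 2 \<epsilon> in
    the kernel, replacing E' by E n costs another \<epsilon>, and the last one keeps the final
    inequality strict.\<close>
  define \<epsilon> where "\<epsilon> = (outflow h E' t - y) / 4"
  have \<epsilon>: "0 < \<epsilon>" using y by (simp add: \<epsilon>_def)
  define \<eta> where "\<eta> = \<epsilon> / F"
  have \<eta>: "0 < \<eta>" "F * \<eta> = \<epsilon>" using \<epsilon> rate_pos by (simp_all add: \<eta>_def)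
  have "\<exists>s. s \<in> {of_int i * \<eta><..<(of_int i + 1) * \<eta>} \<and> s \<notin> C" for i :: int
    using open_minus_countable[OF C, of "{of_int i * \<eta><..<(of_int i + 1) * \<eta>}"] \<eta>
    by (auto simp: algebra_simps)
  then obtain s where s: "\<And>i::int. s i \<in> {of_int i * \<eta><..<(of_int i + 1) * \<eta>}" "\<And>i. s i \<notin> C"
    by metis
  \<comment> \<open>F R - c = M, so for \<tau> at least R before t the kernel alone is at least M.
    The remaining \<tau> are compared with a grid point indexed by I: one to the left of \<tau> or,
    for late \<tau>, one between t and \<tau>.\<close>
  define R where "R = (M + c) / F"
  define I where "I = {\<lfloor>(t - R) / \<eta>\<rfloor> - 3..\<lfloor>t / \<eta>\<rfloor> + 1}"
  have "\<forall>\<^sub>F n in sequentially. \<forall>i\<in>I. E' (s i) - \<epsilon> < E n (s i)"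
    unfolding I_def
    by (intro eventually_ball_finite ballI order_tendstoD(1)[OF conv[OF s(2)]]) (use \<epsilon> in auto)
  then show "\<forall>\<^sub>F n in sequentially. y < outflow h (E n) t"
  proof eventually_elim
    case (elim n)
    have "outflow h E' t - 3 * \<epsilon> \<le> outflow h (E n) t"
    proof (rule outflow_greatest)
      fix \<tau>
      consider "\<lfloor>\<tau> / \<eta>\<rfloor> - 1 \<in> I" | "\<lfloor>\<tau> / \<eta>\<rfloor> - 1 > \<lfloor>t / \<eta>\<rfloor> + 1" | "\<lfloor>\<tau> / \<eta>\<rfloor> - 1 < \<lfloor>(t - R) / \<eta>\<rfloor> - 3"
        unfolding I_def by force
      then show "outflow h E' t - 3 * \<epsilon> \<le> E n \<tau> + h (t - \<tau>)"
      proof cases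
        case 1
        define i where "i = \<lfloor>\<tau> / \<eta>\<rfloor> - 1"
        have i: "(of_int i + 1) * \<eta> \<le> \<tau>" "\<tau> < (of_int i + 2) * \<eta>"
          using floor_divide_lower[OF \<eta>(1), of \<tau>] floor_divide_upper[OF \<eta>(1), of \<tau>]
          by (simp_all add: i_def algebra_simps)
        have si: "s i \<le> \<tau>" "\<tau> - s i \<le> 2 * \<eta>"
          using s(1)[of i] i by (auto simp: algebra_simps)
        have "h (t - s i) \<le> h (t - \<tau>) + F * (\<tau> - s i)"
          using kernel_lipschitz[of "t - \<tau>" "t - s i"] si by simp
        moreover have "F * (\<tau> - s i) \<le> 2 * \<epsilon>"
          using mult_left_mono[OF si(2) less_imp_le[OF rate_pos]] \<eta>(2) by linarith
        moreover have "E n (s i) \<le> E n \<tau>" by (intro monoD[OF mono] si)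
        moreover have "E' (s i) - \<epsilon> < E n (s i)" using elim 1 by (auto simp: i_def)
        moreover have "outflow h E' t \<le> E' (s i) + h (t - s i)" by (rule outflow_le) (rule nonneg')
        ultimately show ?thesis by linarith
      next
        case 2
        define i where "i = \<lfloor>t / \<eta>\<rfloor> + 1"
        have "t < (of_int \<lfloor>t / \<eta>\<rfloor> + 1) * \<eta>" "of_int \<lfloor>\<tau> / \<eta>\<rfloor> * \<eta> \<le> \<tau>"
          using floor_divide_lower[OF \<eta>(1), of \<tau>] floor_divide_upper[OF \<eta>(1), of t] by auto
        moreover have "(of_int i + 1) * \<eta> \<le> of_int \<lfloor>\<tau> / \<eta>\<rfloor> * \<eta>"
          using 2 \<eta> by (intro mult_right_mono) (auto simp: i_def)
        ultimately have i: "t \<le> s i" "s i \<le> \<tau>" using s(1)[of i] by (auto simp: i_def)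
        have "i \<in> I"
        proof -
          have "(t - R) / \<eta> \<le> t / \<eta>" if "0 \<le> R" using \<eta> that by (intro divide_right_mono) auto
          show ?thesis
          proof (cases "\<lfloor>(t - R) / \<eta>\<rfloor> - 3 \<le> \<lfloor>t / \<eta>\<rfloor> + 1")
            case True then show ?thesis by (simp add: I_def i_def)
          next
            case False
            have "M \<ge> 0" using nonneg'[of 0] le'[of 0] by simp
            moreover have "0 \<le> c" using kernel_lower[of 0] kernel_zero[of 0] delay_pos by simp
            ultimately have "0 \<le> R" using rate_pos by (simp add: R_def)
            then have "\<lfloor>(t - R) / \<eta>\<rfloor> \<le> \<lfloor>t / \<eta>\<rfloor>" using \<eta> by (intro floor_mono divide_right_mono) auto
            then show ?thesis using False by simp
          qed
        qed
        have "outflow h E' t \<le> E' (s i) + h (t - s i)" by (rule outflow_le) (rule nonneg')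
        also have "h (t - s i) = 0" using i delay_pos by (intro kernel_zero) simp
        finally have "outflow h E' t \<le> E' (s i)" by simp
        moreover have "E' (s i) - \<epsilon> < E n (s i)" using elim \<open>i \<in> I\<close> by auto
        moreover have "E n (s i) \<le> E n \<tau>" by (intro monoD[OF mono] i)
        ultimately show ?thesis using \<epsilon> kernel_nonneg[of "t - \<tau>"] by linarith
      next
        case 3
        then have "\<lfloor>\<tau> / \<eta>\<rfloor> < \<lfloor>(t - R) / \<eta>\<rfloor>" by simp
        then have "\<tau> / \<eta> < (t - R) / \<eta>" by linarith
        then have "R \<le> t - \<tau>" using \<eta> by (simp add: divide_less_cancel)
        then have "F * R - c \<le> h (t - \<tau>)"
          using kernel_lower[of "t - \<tau>"] mult_left_mono[of R "t - \<tau>" F, OF _ less_imp_le[OF rate_pos]]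
            by linarith
        then have "M \<le> h (t - \<tau>)" using rate_pos by (simp add: R_def)
        moreover have "outflow h E' t \<le> M"
          using outflow_le_delayed[of E' t, OF nonneg'] le'[of "t - \<delta>"] by simp
        ultimately show ?thesis using \<epsilon> nonneg[of n \<tau>] by linarith
      qed
    qed
    then show ?case using \<epsilon> unfolding \<epsilon>_def by (simp add: field_simps)
  qed
qed

end

section \<open>Arcs of a simple path\<close>

lemma path_arcs_length: "length (path_arcs p) = length p - 1"
  by (simp add: path_arcs_def)

lemma path_arcs_nth: "q < length (path_arcs p) \<Longrightarrow> path_arcs p ! q = (p ! q, p ! Suc q)"
  by (simp add: path_arcs_def nth_tl)

lemma fst_inj_path_arcs:
  assumes "distinct p" "e \<in> set (path_arcs p)" "e' \<in> set (path_arcs p)" "fst e = fst e'"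
  shows "e = e'"
proof -
  obtain q where q: "q < length (path_arcs p)" "e = path_arcs p ! q"
    using assms(2) by (metis in_set_conv_nth)
  obtain q' where q': "q' < length (path_arcs p)" "e' = path_arcs p ! q'"
    using assms(3) by (metis in_set_conv_nth)
  have "p ! q = p ! q'" using q q' assms(4) by (simp add: path_arcs_nth)
  then have "q = q'" using assms(1) q q' by (simp add: nth_eq_iff_index_eq path_arcs_length)
  then show ?thesis using q q' by simp
qed

lemma distinct_path_arcs: "distinct p \<Longrightarrow> distinct (path_arcs p)"
  by (simp add: path_arcs_def distinct_zipI1)

section \<open>The network\<close>

locale network =
  fixes N :: traffic_network and G :: "nat \<Rightarrow> real"
  assumes wf: "well_formed N"
    and flux_assm: "flux_assumption N"
    and cost_assm: "cost_assumption N"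
    and group_size_nonneg: "\<forall>k\<in>groups N. 0 \<le> G k"
begin

definition kernel :: "arc \<Rightarrow> real \<Rightarrow> real" where
  "kernel e s = len N e * flux_inv_conj N e (s / len N e)"

definition delay :: "arc \<Rightarrow> real" where
  "delay e = len N e / speed N e 0"

lemma total_exited_eq: "total_exited N Um e t = outflow (kernel e) (total_entered N Um e) t"
  by (simp add: total_exited_def outflow_def kernel_def)

lemma finite_groups [simp]: "finite (groups N)"
  by (simp add: groups_def)

lemma finite_group_paths [simp]: "finite (group_paths N k)"
  by (rule finite_subset[OF _ finite_viable_paths[of N]]) (auto simp: group_paths_def)

lemma finite_subgroups [simp]: "finite (subgroups N)"
  by (simp add: subgroups_def)

lemma finite_users [simp]: "finite (users N e)"
  by (rule finite_subset[OF _ finite_subgroups]) (auto simp: users_def)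

lemma finite_departing [simp]: "finite (departing N e)"
  by (rule finite_subset[OF _ finite_subgroups]) (auto simp: users_def departing_def)

lemma finite_in_transit [simp]: "finite (in_transit N e)"
  by (rule finite_subset[OF _ finite_subgroups]) (auto simp: users_def in_transit_def)

lemma subgroupD:
  assumes "(k, p) \<in> subgroups N"
  shows "k \<in> groups N" "p \<in> group_paths N k" "p \<in> viable_paths N" "distinct p" "2 \<le> length p"
    "path_arcs p \<noteq> []" "e \<in> set (path_arcs p) \<Longrightarrow> viable_arc N e"
    "fst (hd (path_arcs p)) = origin N k"
proof -
  show *: "k \<in> groups N" "p \<in> group_paths N k" "p \<in> viable_paths N" "distinct p" "2 \<le> length p"
    "e \<in> set (path_arcs p) \<Longrightarrow> viable_arc N e"
    using assms by (auto simp: subgroups_def group_paths_def viable_paths_def)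
  then show ne: "path_arcs p \<noteq> []" using path_arcs_length[of p] by auto
  have "hd (path_arcs p) = path_arcs p ! 0" using ne by (simp add: hd_conv_nth)
  also have "\<dots> = (p ! 0, p ! Suc 0)" using ne by (simp add: path_arcs_nth)
  finally have "fst (hd (path_arcs p)) = p ! 0" by simp
  also have "p ! 0 = hd p" using *(5) by (subst hd_conv_nth) auto
  also have "hd p = origin N k" using *(2) by (simp add: group_paths_def)
  finally show "fst (hd (path_arcs p)) = origin N k" .
qed

lemma users_iff: "(k, p) \<in> users N e \<longleftrightarrow> (k, p) \<in> subgroups N \<and> e \<in> set (path_arcs p)"
  by (auto simp: users_def)

text \<open>\<open>departing\<close> only asks that e start at the origin; on a path without
  repeated nodes this singles out the first arc, so departing and transit users of an arc are
  complementary.\<close>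

lemma departing_iff: "(k, p) \<in> departing N e \<longleftrightarrow> (k, p) \<in> subgroups N \<and> e = hd (path_arcs p)"
proof
  assume "(k, p) \<in> departing N e"
  then show "(k, p) \<in> subgroups N \<and> e = hd (path_arcs p)"
    using fst_inj_path_arcs[of p e "hd (path_arcs p)"] subgroupD
    by (auto simp: departing_def users_def)
next
  assume "(k, p) \<in> subgroups N \<and> e = hd (path_arcs p)"
  then show "(k, p) \<in> departing N e"
    using subgroupD[of k p] by (auto simp: departing_def users_def)
qed

lemma in_transit_iff:
  "(k, p) \<in> in_transit N e \<longleftrightarrow>
    (k, p) \<in> subgroups N \<and> e \<in> set (path_arcs p) \<and> e \<noteq> hd (path_arcs p)"
  by (auto simp: in_transit_def users_def)

lemma users_split:
  "users N e = departing N e \<union> in_transit N e" "departing N e \<inter> in_transit N e = {}"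
  using subgroupD(6) by (auto simp: users_iff departing_iff in_transit_iff)

lemma sum_users: "(\<Sum>x\<in>users N e. f x) = (\<Sum>x\<in>departing N e. f x) + (\<Sum>x\<in>in_transit N e. f x)"
  unfolding users_split(1) by (rule sum.union_disjoint) (auto simp: users_split(2))

lemma viable_users: "(k, p) \<in> users N e \<Longrightarrow> viable_arc N e"
  unfolding users_iff using subgroupD(7) by blast

lemma departing_users: "(k, p) \<in> departing N e \<Longrightarrow> (k, p) \<in> users N e"
  by (auto simp: departing_def)

lemma transit_users: "(k, p) \<in> in_transit N e \<Longrightarrow> (k, p) \<in> users N e"
  by (auto simp: in_transit_def)

lemma departing_subgroups: "(k, p) \<in> departing N e \<Longrightarrow> (k, p) \<in> subgroups N"
  by (auto simp: departing_iff)

lemma user_or: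
  assumes "(k, p) \<in> users N e"
  obtains "(k, p) \<in> departing N e" | "(k, p) \<in> in_transit N e"
  using assms users_split(1)[of e] by auto

lemma user_prev:
  assumes tr: "(k, p) \<in> in_transit N e"
  obtains q where "Suc q < length (path_arcs p)" "e = path_arcs p ! Suc q"
    "(k, p) \<in> users N (path_arcs p ! q)" "(k, p) \<in> subgroups N"
proof -
  have kp: "(k, p) \<in> subgroups N" using tr by (simp add: in_transit_iff)
  obtain q where q: "q < length (path_arcs p)" "e = path_arcs p ! q"
    using tr by (auto simp: in_transit_iff in_set_conv_nth)
  have "q \<noteq> 0"
    using tr q hd_conv_nth[OF subgroupD(6)[OF kp]] by (cases q) (auto simp: in_transit_iff)
  then obtain q' where q': "q = Suc q'" by (cases q) auto
  have "(k, p) \<in> users N (path_arcs p ! q')" using kp q by (simp add: users_iff q')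
  then show ?thesis using that[of q'] q kp by (simp add: q')
qed

lemma departing_hd: "(k, p) \<in> subgroups N \<Longrightarrow> (k, p) \<in> departing N (hd (path_arcs p))"
  by (simp add: departing_iff)

lemma Suc_in_transit:
  assumes kp: "(k, p) \<in> subgroups N" and q: "Suc q < length (path_arcs p)"
  shows "(k, p) \<in> in_transit N (path_arcs p ! Suc q)"
proof -
  have "path_arcs p ! Suc q \<noteq> path_arcs p ! 0"
    using nth_eq_iff_index_eq[OF distinct_path_arcs[OF subgroupD(4)[OF kp]], of "Suc q" 0]
      q by (cases "path_arcs p") auto
  then show ?thesis using kp q hd_conv_nth[OF subgroupD(6)[OF kp]] by (auto simp: in_transit_iff)
qed

section \<open>Flux on a viable arc, its inverse and the kernel\<close>

lemma finite_viable_arcs: "finite {e. viable_arc N e}"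
  by (rule finite_subset[of _ "nodes N \<times> nodes N"]) (auto simp: viable_arc_def nodes_def)

lemma viable_arc_wf:
  assumes "viable_arc N e"
  shows "0 < len N e" "continuous_on {0..jam N e} (speed N e)"
    "antimono_on {0..jam N e} (speed N e)"
  using wf assms unfolding well_formed_def by blast+

lemma viable_arc_flux:
  assumes "viable_arc N e"
  shows "continuous_on {0..jam N e} (flux N e)" "concave_on {0..jam N e} (flux N e)"
    "flux N e 0 = 0" "\<exists>!r. is_crit_density N e r"
  using flux_assm assms unfolding flux_assumption_def by blast+

lemma crit_density: "viable_arc N e \<Longrightarrow> is_crit_density N e (crit_density N e)"
  unfolding crit_density_def by (rule theI'[OF viable_arc_flux(4)])

lemma crit_density_pos:
  "viable_arc N e \<Longrightarrow> 0 < crit_density N e" "viable_arc N e \<Longrightarrow> crit_density N e < jam N e"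
  using crit_density by (auto simp: is_crit_density_def)

lemma flux_crit: "viable_arc N e \<Longrightarrow> flux N e (crit_density N e) = flux_max N e"
  using crit_density by (auto simp: is_crit_density_def)

lemma flux_le_max:
  assumes "viable_arc N e" "\<rho> \<in> {0..jam N e}"
  shows "flux N e \<rho> \<le> flux_max N e"
proof -
  have "compact (flux N e ` {0..jam N e})"
    using viable_arc_flux(1)[OF assms(1)] by (intro compact_continuous_image) auto
  then have "bdd_above (flux N e ` {0..jam N e})"
    by (intro bounded_imp_bdd_above compact_imp_bounded)
  then show ?thesis unfolding flux_max_def using assms(2) by (intro cSUP_upper)
qed

lemma flux_max_pos:
  assumes "viable_arc N e"
  shows "0 < flux_max N e"
proof -
  have jam: "0 < jam N e" using crit_density_pos[OF assms] by simp
  have v0: "0 < speed N e 0" using assms by (simp add: viable_arc_def)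
  have "continuous_on {0..jam N e} (speed N e)" by (rule viable_arc_wf[OF assms])
  then obtain d where d: "0 < d"
    "\<And>x. x \<in> {0..jam N e} \<Longrightarrow> dist x 0 < d \<Longrightarrow> dist (speed N e x) (speed N e 0) < speed N e 0"
    using jam v0 by (force simp: continuous_on_iff)
  define x where "x = min (d / 2) (jam N e)"
  have x: "x \<in> {0..jam N e}" "0 < x" "dist x 0 < d" using d(1) jam by (auto simp: x_def)
  then have "0 < speed N e x" using d(2)[of x] by (auto simp: dist_real_def)
  then have "0 < flux N e x" using x by (simp add: flux_def)
  then show ?thesis using flux_le_max[OF assms x(1)] by simp
qed

text \<open>Concavity puts the graph above the chord from 0 to the critical density. This makes 0
  the only preimage of 0 there, so that the choice made by \<open>inv_into\<close> in
  \<open>flux_inv\<close> is known at 0.\<close>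

lemma flux_pos:
  assumes "viable_arc N e" "0 < \<rho>" "\<rho> \<le> crit_density N e"
  shows "0 < flux N e \<rho>"
proof -
  define r where "r = crit_density N e"
  have r: "0 < r" "r < jam N e" using crit_density_pos[OF assms(1)] by (auto simp: r_def)
  have conc: "concave_on {0..jam N e} (flux N e)" and zero: "flux N e 0 = 0"
    by (rule viable_arc_flux[OF assms(1)])+
  have "(1 - \<rho> / r) * flux N e 0 + \<rho> / r * flux N e r
      \<le> flux N e ((1 - \<rho> / r) *\<^sub>R 0 + (\<rho> / r) *\<^sub>R r)"
    using assms r by (intro concave_onD[OF conc]) (auto simp: r_def)
  then have "\<rho> / r * flux_max N e \<le> flux N e \<rho>"
    using r zero flux_crit[OF assms(1)] by (simp add: r_def)
  moreover have "0 < \<rho> / r * flux_max N e" using assms r flux_max_pos by simp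
  ultimately show ?thesis by simp
qed

lemma flux_inv:
  assumes "viable_arc N e" "u \<in> {0..flux_max N e}"
  shows "flux_inv N e u \<in> {0..crit_density N e}" "flux N e (flux_inv N e u) = u"
proof -
  have "\<exists>x. 0 \<le> x \<and> x \<le> crit_density N e \<and> flux N e x = u"
  proof (rule IVT')
    show "flux N e 0 \<le> u" "u \<le> flux N e (crit_density N e)"
      using assms flux_crit by (auto simp: flux_def)
    show "0 \<le> crit_density N e" using crit_density_pos[OF assms(1)] by simp
    show "continuous_on {0..crit_density N e} (flux N e)"
      using crit_density_pos[OF assms(1)]
      by (intro continuous_on_subset[OF viable_arc_flux(1)[OF assms(1)]]) auto
  qed
  then have "u \<in> flux N e ` {0..crit_density N e}" by auto
  then show "flux_inv N e u \<in> {0..crit_density N e}" "flux N e (flux_inv N e u) = u"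
    unfolding flux_inv_def by (rule inv_into_into, rule f_inv_into_f)
qed

lemma flux_inv_zero:
  assumes "viable_arc N e"
  shows "flux_inv N e 0 = 0"
proof -
  have "0 \<in> {0..flux_max N e}" using flux_max_pos[OF assms] by simp
  from flux_inv[OF assms this] show ?thesis
    using flux_pos[OF assms, of "flux_inv N e 0"] by (auto simp: less_le)
qed

text \<open>With u = \<rho> v(\<rho>) and v nonincreasing, no flow is faster than on the empty road.
  For this reason the kernel vanishes up to L / v(0).\<close>

lemma flux_inv_ge:
  assumes "viable_arc N e" "u \<in> {0..flux_max N e}"
  shows "u \<le> speed N e 0 * flux_inv N e u"
proof -
  define \<rho> where "\<rho> = flux_inv N e u"
  have \<rho>: "\<rho> \<in> {0..crit_density N e}" "flux N e \<rho> = u"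
    using flux_inv[OF assms] by (auto simp: \<rho>_def)
  have "antimono_on {0..jam N e} (speed N e)" by (rule viable_arc_wf[OF assms(1)])
  then have "speed N e \<rho> \<le> speed N e 0"
    using \<rho>(1) crit_density_pos[OF assms(1)] by (auto simp: monotone_on_def)
  then have "\<rho> * speed N e \<rho> \<le> \<rho> * speed N e 0" using \<rho>(1) by (intro mult_left_mono) auto
  then show ?thesis using \<rho>(2) by (simp add: flux_def \<rho>_def mult.commute)
qed

lemma flux_inv_conj_bdd:
  assumes "viable_arc N e"
  shows "bdd_above ((\<lambda>u. q * u - flux_inv N e u) ` {0..flux_max N e})"
proof (rule bdd_aboveI2)
  fix u assume u: "u \<in> {0..flux_max N e}"
  have "q * u \<le> \<bar>q\<bar> * flux_max N e" using u by (intro mult_mono) auto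
  then show "q * u - flux_inv N e u \<le> \<bar>q\<bar> * flux_max N e" using flux_inv(1)[OF assms u] by simp
qed

lemma flux_inv_conj_upper:
  assumes "viable_arc N e" "u \<in> {0..flux_max N e}"
  shows "q * u - flux_inv N e u \<le> flux_inv_conj N e q"
  unfolding flux_inv_conj_def by (rule cSUP_upper[OF assms(2) flux_inv_conj_bdd[OF assms(1)]])

lemma flux_inv_conj_least:
  assumes "viable_arc N e" "\<And>u. u \<in> {0..flux_max N e} \<Longrightarrow> q * u - flux_inv N e u \<le> y"
  shows "flux_inv_conj N e q \<le> y"
  unfolding flux_inv_conj_def
  by (rule cSUP_least) (use assms flux_max_pos[of e] in auto)

text \<open>\<open>kernel e s\<close> is the supremum of s u - L g(u) over u in [0, F^max], so its
  slopes lie in [0, F^max]. The choice u = 0 makes it nonnegative, u = F^max gives the lower bound,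
  and \<open>flux_inv_ge\<close> makes every term nonpositive up to the delay.\<close>

lemma kernel_locale:
  assumes e: "viable_arc N e"
  shows "delay_kernel (kernel e) (delay e) (flux_max N e) (len N e * crit_density N e)"
proof
  note L = viable_arc_wf(1)[OF e] and F = flux_max_pos[OF e]
  have v0: "0 < speed N e 0" using e by (simp add: viable_arc_def)
  show "0 < delay e" using L v0 by (simp add: delay_def)
  show "0 < flux_max N e" by (rule F)
  have zero: "0 \<le> flux_inv_conj N e q" for q
    using flux_inv_conj_upper[OF e, of 0 q] F by (simp add: flux_inv_zero[OF e])
  fix s :: real
  show "kernel e s = 0" if "s \<le> delay e"
  proof -
    have s: "speed N e 0 * (s / len N e) \<le> 1" using that L v0 by (simp add: delay_def field_simps)
    have "flux_inv_conj N e (s / len N e) \<le> 0"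
    proof (rule flux_inv_conj_least[OF e])
      fix u assume u: "u \<in> {0..flux_max N e}"
      have "speed N e 0 * (s / len N e * u) \<le> u"
        using mult_right_mono[OF s, of u] u by (simp add: mult.assoc)
      also have "u \<le> speed N e 0 * flux_inv N e u" using flux_inv_ge[OF e u] .
      finally have "s / len N e * u \<le> flux_inv N e u" using mult_le_cancel_left_pos[OF v0] by blast
      then show "s / len N e * u - flux_inv N e u \<le> 0" by simp
    qed
    then show ?thesis using zero[of "s / len N e"] by (simp add: kernel_def)
  qed
  show "flux_max N e * s - len N e * crit_density N e \<le> kernel e s"
  proof -
    have "s / len N e * flux_max N e - flux_inv N e (flux_max N e)
        \<le> flux_inv_conj N e (s / len N e)"
      using F by (intro flux_inv_conj_upper[OF e]) auto
    then have "s / len N e * flux_max N e - crit_density N e \<le> flux_inv_conj N e (s / len N e)"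
      using flux_inv(1)[OF e, of "flux_max N e"] F by simp
    then have "len N e * (s / len N e * flux_max N e - crit_density N e) \<le> kernel e s"
      unfolding kernel_def using L by (intro mult_left_mono) auto
    moreover have "len N e * (s / len N e * flux_max N e - crit_density N e)
        = flux_max N e * s - len N e * crit_density N e"
      using L by (simp add: right_diff_distrib)
    ultimately show ?thesis by simp
  qed
  fix s' assume ss': "s \<le> s'"
  then have q: "s / len N e \<le> s' / len N e" using L by (simp add: divide_right_mono)
  show "kernel e s \<le> kernel e s'"
  proof -
    have "flux_inv_conj N e (s / len N e) \<le> flux_inv_conj N e (s' / len N e)"
    proof (rule flux_inv_conj_least[OF e])
      fix u assume u: "u \<in> {0..flux_max N e}"
      then have "s / len N e * u \<le> s' / len N e * u" using q by (intro mult_right_mono) auto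
      then show "s / len N e * u - flux_inv N e u \<le> flux_inv_conj N e (s' / len N e)"
        using flux_inv_conj_upper[OF e u, of "s' / len N e"] by simp
    qed
    then show ?thesis using L by (simp add: kernel_def)
  qed
  show "kernel e s' \<le> kernel e s + flux_max N e * (s' - s)"
  proof -
    have "flux_inv_conj N e (s' / len N e)
        \<le> flux_inv_conj N e (s / len N e) + (s' / len N e - s / len N e) * flux_max N e"
    proof (rule flux_inv_conj_least[OF e])
      fix u assume u: "u \<in> {0..flux_max N e}"
      then have "(s' / len N e - s / len N e) * u \<le> (s' / len N e - s / len N e) * flux_max N e"
        using q by (intro mult_left_mono) auto
      then show "s' / len N e * u - flux_inv N e u
        \<le> flux_inv_conj N e (s / len N e) + (s' / len N e - s / len N e) * flux_max N e"
        using flux_inv_conj_upper[OF e u, of "s / len N e"] by (simp add: algebra_simps)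
    qed
    then have "kernel e s' \<le> len N e * (flux_inv_conj N e (s / len N e)
        + (s' / len N e - s / len N e) * flux_max N e)"
      unfolding kernel_def using L by (intro mult_left_mono) auto
    also have "\<dots> = kernel e s + flux_max N e * (s' - s)"
      using L by (simp add: kernel_def algebra_simps)
    finally show ?thesis .
  qed
qed

text \<open>Solves F^max * lag - L rho* = total population, the clearing condition of
  \<open>outflow_ge\<close>. It depends on the network and the group sizes only, so one window
  serves every flow.\<close>

definition lag :: "arc \<Rightarrow> real" where
  "lag e = (sum G (groups N) + len N e * crit_density N e) / flux_max N e"

lemma lag_props:
  assumes "viable_arc N e"
  shows "sum G (groups N) \<le> flux_max N e * lag e - len N e * crit_density N e" "0 \<le> lag e"
proof -
  show "sum G (groups N) \<le> flux_max N e * lag e - len N e * crit_density N e"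
    using flux_max_pos[OF assms] by (simp add: lag_def)
  have "0 \<le> sum G (groups N)" using group_size_nonneg by (intro sum_nonneg) auto
  then show "0 \<le> lag e"
    using flux_max_pos[OF assms] viable_arc_wf(1)[OF assms] crit_density_pos(1)[OF assms]
    by (simp add: lag_def)
qed

text \<open>The sum stands in for a maximum: one Lipschitz constant valid on all viable
  arcs.\<close>

definition rate :: real where
  "rate = (\<Sum>e | viable_arc N e. flux_max N e)"

lemma flux_max_le_rate: "viable_arc N e \<Longrightarrow> flux_max N e \<le> rate"
  unfolding rate_def using finite_viable_arcs
  by (intro member_le_sum) (auto intro!: less_imp_le flux_max_pos)

end

section \<open>One-sided limits of monotone functions\<close>

lemma mono_tendsto_at_left:
  fixes f :: "real \<Rightarrow> real"
  assumes "mono f"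
  shows "(f \<longlongrightarrow> (SUP s\<in>{..<a}. f s)) (at_left a)"
proof (rule increasing_tendsto)
  have bdd: "bdd_above (f ` {..<a})"
    by (rule bdd_aboveI2[of _ _ "f a"]) (use assms in \<open>auto simp: mono_def\<close>)
  show "\<forall>\<^sub>F n in at_left a. f n \<le> (SUP s\<in>{..<a}. f s)"
    unfolding eventually_at_filter
    by (rule always_eventually) (auto intro!: cSUP_upper[OF _ bdd])
  fix x assume "x < (SUP s\<in>{..<a}. f s)"
  then obtain s where s: "s < a" "x < f s" using less_cSUP_iff[OF _ bdd] by auto
  show "\<forall>\<^sub>F n in at_left a. x < f n"
    unfolding eventually_at_left[OF s(1)] using s assms
    by (intro exI[of _ s]) (auto simp: mono_def intro: less_le_trans[of x "f s"])
qed

lemma mono_tendsto_at_right: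
  fixes f :: "real \<Rightarrow> real"
  assumes "mono f"
  shows "(f \<longlongrightarrow> (INF s\<in>{a<..}. f s)) (at_right a)"
proof (rule decreasing_tendsto)
  have bdd: "bdd_below (f ` {a<..})"
    by (rule bdd_belowI2[of _ "f a"]) (use assms in \<open>auto simp: mono_def\<close>)
  show "\<forall>\<^sub>F n in at_right a. (INF s\<in>{a<..}. f s) \<le> f n"
    unfolding eventually_at_filter
    by (rule always_eventually) (auto intro!: cINF_lower[OF bdd])
  fix x assume "(INF s\<in>{a<..}. f s) < x"
  then obtain s where s: "a < s" "f s < x" using cINF_less_iff[OF _ bdd] by auto
  show "\<forall>\<^sub>F n in at_right a. f n < x"
    unfolding eventually_at_right[OF s(1)] using s assms
    by (intro exI[of _ s]) (auto simp: mono_def intro: le_less_trans[of _ "f s"])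
qed

text \<open>\<open>Lim\<close> is a definite description, usable only once the limit is known to
  exist. Monotonicity provides that and turns the condition in \<open>is_enter_time\<close> into
  inequalities at neighbouring points, which pass to limits.\<close>

lemma Lim_at_left_le_iff:
  fixes f :: "real \<Rightarrow> real"
  assumes "mono f"
  shows "Lim (at_left a) f \<le> y \<longleftrightarrow> (\<forall>s<a. f s \<le> y)"
proof -
  have bdd: "bdd_above (f ` {..<a})"
    by (rule bdd_aboveI2[of _ _ "f a"]) (use assms in \<open>auto simp: mono_def\<close>)
  have "Lim (at_left a) f = (SUP s\<in>{..<a}. f s)"
    by (rule tendsto_Lim[OF _ mono_tendsto_at_left[OF assms]]) simp
  then show ?thesis using cSUP_le_iff[OF _ bdd, of y] by auto
qed

lemma le_Lim_at_right_iff: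
  fixes f :: "real \<Rightarrow> real"
  assumes "mono f"
  shows "y \<le> Lim (at_right a) f \<longleftrightarrow> (\<forall>s>a. y \<le> f s)"
proof -
  have bdd: "bdd_below (f ` {a<..})"
    by (rule bdd_belowI2[of _ "f a"]) (use assms in \<open>auto simp: mono_def\<close>)
  have "Lim (at_right a) f = (INF s\<in>{a<..}. f s)"
    by (rule tendsto_Lim[OF _ mono_tendsto_at_right[OF assms]]) simp
  then show ?thesis using le_cINF_iff[OF _ bdd, of y] by auto
qed

lemma mono_bounded_tendsto_at_top:
  fixes f :: "real \<Rightarrow> real"
  assumes "mono f" "bounded (range f)"
  shows "(f \<longlongrightarrow> Lim at_top f) at_top" "f t \<le> Lim at_top f"
proof -
  have bdd: "bdd_above (range f)" using assms(2) by (rule bounded_imp_bdd_above)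
  have lim: "(f \<longlongrightarrow> (SUP s. f s)) at_top"
  proof (rule increasing_tendsto)
    show "\<forall>\<^sub>F n in at_top. f n \<le> (SUP s. f s)"
      by (rule always_eventually) (auto intro!: cSUP_upper[OF _ bdd])
    fix x assume "x < (SUP s. f s)"
    then obtain s where s: "x < f s" using less_cSUP_iff[OF _ bdd] by auto
    then show "\<forall>\<^sub>F n in at_top. x < f n"
      using assms(1) by (intro eventually_at_top_linorderI[of s]) (auto simp: mono_def intro: less_le_trans[of x "f s"])
  qed
  then have eq: "Lim at_top f = (SUP s. f s)" by (intro tendsto_Lim) simp_all
  show "(f \<longlongrightarrow> Lim at_top f) at_top" unfolding eq by (rule lim)
  show "f t \<le> Lim at_top f" unfolding eq by (rule cSUP_upper[OF _ bdd]) simp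
qed

lemma mono_tendsto_at_bot_lower:
  fixes f :: "real \<Rightarrow> real"
  assumes "mono f" "(f \<longlongrightarrow> l) at_bot"
  shows "l \<le> f t"
proof (rule tendsto_upperbound[OF assms(2)])
  show "\<forall>\<^sub>F i in at_bot. f i \<le> f t"
    using assms(1) by (intro eventually_at_bot_linorderI[of t]) (auto dest: monoD)
qed simp

text \<open>The identity relating priorities and departures holds almost everywhere; this supplies a
  good time in every open interval.\<close>

lemma AE_lborel_Ioo:
  fixes a b :: real
  assumes "AE x in lborel. P x" "a < b"
  obtains x where "a < x" "x < b" "P x"
proof -
  obtain S where S: "S \<in> null_sets lborel" "{x. \<not> P x} \<subseteq> S"
    using assms(1) by (auto simp: eventually_ae_filter)
  have "\<not> {a<..<b} \<subseteq> S"
  proof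
    assume "{a<..<b} \<subseteq> S"
    then have "{a<..<b} \<in> null_sets lborel" using S(1) by (rule null_sets_subset[rotated 2]) auto
    then have "emeasure lborel {a<..<b} = 0" by auto
    then show False using assms(2) by simp
  qed
  then obtain x where "x \<in> {a<..<b}" "x \<notin> S" by blast
  moreover from this(2) have "P x" using S(2) by blast
  ultimately show ?thesis by (intro that) auto
qed

lemma continuous_lipschitz_mono:
  fixes f :: "real \<Rightarrow> real"
  assumes "mono f" "\<And>s t. s \<le> t \<Longrightarrow> f t \<le> f s + F * (t - s)"
  shows "continuous_on UNIV f"
proof -
  have "0 \<le> F" using assms(2)[of 0 1] monoD[OF assms(1), of 0 1] by simp
  moreover have "dist (f s) (f t) \<le> F * dist s t" for s t
    using assms(2)[of s t] assms(2)[of t s] monoD[OF assms(1), of s t] monoD[OF assms(1), of t s]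
    by (cases "s \<le> t") (auto simp: dist_real_def)
  ultimately have "F-lipschitz_on UNIV f" by (intro lipschitz_onI)
  then show ?thesis by (rule lipschitz_on_continuous_on)
qed

section \<open>Properties of an arbitrary flow\<close>

locale flow = network +
  fixes U :: "nat \<Rightarrow> path \<Rightarrow> real \<Rightarrow> real" and B :: "nat \<Rightarrow> path \<Rightarrow> real \<Rightarrow> real"
    and Um Up :: "nat \<Rightarrow> path \<Rightarrow> arc \<Rightarrow> real \<Rightarrow> real"
  assumes sol: "solution N G U B Um Up"
begin

abbreviation sz :: "nat \<Rightarrow> path \<Rightarrow> real" where "sz \<equiv> subgroup_size U"

lemma departure_props:
  assumes "(k, p) \<in> subgroups N"
  shows "mono (U k p)" "continuous (at_left t) (U k p)" "(U k p \<longlongrightarrow> 0) at_bot"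
    "(U k p \<longlongrightarrow> sz k p) at_top" "0 \<le> U k p t" "U k p t \<le> sz k p" "0 \<le> sz k p"
proof -
  have "departure_distribution (U k p)"
    using sol subgroupD[OF assms] by (auto simp: solution_def admissible_def)
  then show *: "mono (U k p)" "continuous (at_left t) (U k p)" "(U k p \<longlongrightarrow> 0) at_bot"
    and b: "(U k p \<longlongrightarrow> sz k p) at_top" "U k p t \<le> sz k p"
    by (auto simp: departure_distribution_def subgroup_size_def intro: mono_bounded_tendsto_at_top)
  show "0 \<le> U k p t" using *(1,3) by (rule mono_tendsto_at_bot_lower)
  then show "0 \<le> sz k p" using b(2) by simp
qed

lemma sum_sizes:
  assumes "k \<in> groups N"
  shows "(\<Sum>p\<in>group_paths N k. sz k p) = G k"
proof -
  have "(\<Sum>p\<in>group_paths N k. sz k p) = (\<Sum>p\<in>viable_paths N. sz k p)"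
  proof (rule sum.mono_neutral_left)
    show "\<forall>p\<in>viable_paths N - group_paths N k. sz k p = 0"
    proof
      fix p assume "p \<in> viable_paths N - group_paths N k"
      then have "U k p = (\<lambda>t. 0)" using sol assms by (auto simp: solution_def admissible_def)
      then show "sz k p = 0" by (simp add: subgroup_size_def tendsto_Lim)
    qed
  qed (auto simp: finite_viable_paths group_paths_def)
  then show ?thesis using sol assms by (simp add: solution_def admissible_def)
qed

lemma sum_subgroups: "(\<Sum>x\<in>subgroups N. sz (fst x) (snd x)) = sum G (groups N)"
proof -
  have "(\<Sum>x\<in>subgroups N. sz (fst x) (snd x)) = (\<Sum>k\<in>groups N. \<Sum>p\<in>group_paths N k. sz k p)"
    unfolding subgroups_def by (subst sum.Sigma) (auto simp: split_def)
  then show ?thesis by (simp add: sum_sizes)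
qed

lemma Um_props:
  assumes "(k, p) \<in> users N e"
  shows "mono (Um k p e)" "0 \<le> Um k p e t" "Um k p e t \<le> sz k p" "(Um k p e \<longlongrightarrow> 0) at_bot"
proof -
  have "cumulative_count (sz k p) (Um k p e)"
    using sol assms unfolding solution_def traffic_flow_def users_iff by blast
  then show *: "mono (Um k p e)" "(Um k p e \<longlongrightarrow> 0) at_bot" "Um k p e t \<le> sz k p"
    by (auto simp: cumulative_count_def)
  show "0 \<le> Um k p e t" using *(1,2) by (rule mono_tendsto_at_bot_lower)
qed

lemma Up_props:
  assumes "(k, p) \<in> users N e"
  shows "mono (Up k p e)" "0 \<le> Up k p e t" "Up k p e t \<le> sz k p" "(Up k p e \<longlongrightarrow> 0) at_bot"
proof -
  have "cumulative_count (sz k p) (Up k p e)"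
    using sol assms unfolding solution_def traffic_flow_def users_iff by blast
  then show *: "mono (Up k p e)" "(Up k p e \<longlongrightarrow> 0) at_bot" "Up k p e t \<le> sz k p"
    by (auto simp: cumulative_count_def)
  show "0 \<le> Up k p e t" using *(1,2) by (rule mono_tendsto_at_bot_lower)
qed

lemma Um_first: "(k, p) \<in> departing N e \<Longrightarrow> Um k p e = U k p"
  using sol unfolding solution_def traffic_flow_def departing_iff by blast

lemma Um_next:
  "(k, p) \<in> subgroups N \<Longrightarrow> Suc q < length (path_arcs p) \<Longrightarrow>
    Um k p (path_arcs p ! Suc q) = Up k p (path_arcs p ! q)"
  using sol unfolding solution_def traffic_flow_def by blast

lemma prio_props:
  assumes "(k, p) \<in> departing N e"
  shows "x \<in> {0..arc_size N U e} \<Longrightarrow> B k p x \<in> {0..sz k p}"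
    "mono_on {0..arc_size N U e} (B k p)"
    "AE t in lborel. B k p (arc_depart N U e t) = U k p t"
proof -
  have e: "viable_arc N e" using assms viable_users[of k p e] by (auto simp: departing_def)
  have "(\<forall>(k, p)\<in>departing N e. B k p \<in> {0..arc_size N U e} \<rightarrow> {0..sz k p} \<and>
           mono_on {0..arc_size N U e} (B k p) \<and>
           (AE t in lborel. B k p (arc_depart N U e t) = U k p t))"
    using sol e unfolding solution_def prioritizing_def by blast
  then have "B k p \<in> {0..arc_size N U e} \<rightarrow> {0..sz k p} \<and>
           mono_on {0..arc_size N U e} (B k p) \<and>
           (AE t in lborel. B k p (arc_depart N U e t) = U k p t)"
    using assms by blast
  then show "x \<in> {0..arc_size N U e} \<Longrightarrow> B k p x \<in> {0..sz k p}"
    "mono_on {0..arc_size N U e} (B k p)"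
    "AE t in lborel. B k p (arc_depart N U e t) = U k p t"
    by auto
qed

lemma sum_prio:
  assumes "viable_arc N e" "x \<in> {0..arc_size N U e}"
  shows "(\<Sum>y\<in>departing N e. B (fst y) (snd y) x) = x"
proof -
  have "\<forall>x\<in>{0..arc_size N U e}. (\<Sum>(k, p)\<in>departing N e. B k p x) = x"
    using sol assms(1) unfolding solution_def prioritizing_def by blast
  then show ?thesis using assms(2) by (simp add: split_def)
qed

abbreviation E :: "arc \<Rightarrow> real \<Rightarrow> real" where "E \<equiv> total_entered N Um"
abbreviation T :: "arc \<Rightarrow> real \<Rightarrow> real" where "T \<equiv> transit_entered N Um"
abbreviation D :: "arc \<Rightarrow> real \<Rightarrow> real" where "D \<equiv> arc_depart N U"
abbreviation X :: "arc \<Rightarrow> real \<Rightarrow> real" where "X \<equiv> total_exited N Um"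

lemma E_alt: "E e t = (\<Sum>x\<in>users N e. Um (fst x) (snd x) e t)"
  by (simp add: total_entered_def split_def)

lemma T_alt: "T e t = (\<Sum>x\<in>in_transit N e. Um (fst x) (snd x) e t)"
  by (simp add: transit_entered_def split_def)

lemma D_alt: "D e t = (\<Sum>x\<in>departing N e. U (fst x) (snd x) t)"
  by (simp add: arc_depart_def split_def)

lemma E_split: "E e t = D e t + T e t"
proof -
  have "(\<Sum>x\<in>departing N e. Um (fst x) (snd x) e t) = D e t"
    unfolding D_alt by (rule sum.cong) (auto simp: Um_first)
  then show ?thesis unfolding E_alt sum_users T_alt by simp
qed

lemma E_mono: "mono (E e)"
  unfolding E_alt[abs_def] mono_def by (auto intro!: sum_mono monoD[OF Um_props(1)])

lemma D_mono: "mono (D e)"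
  unfolding D_alt[abs_def] mono_def
    by (auto intro!: sum_mono monoD[OF departure_props(1)] departing_subgroups)

lemma E_nonneg: "0 \<le> E e t"
  unfolding E_alt by (auto intro!: sum_nonneg Um_props(2))

lemma E_le: "E e t \<le> sum G (groups N)"
proof -
  have "E e t \<le> (\<Sum>x\<in>users N e. sz (fst x) (snd x))"
    unfolding E_alt by (auto intro!: sum_mono Um_props(3))
  also have "\<dots> \<le> (\<Sum>x\<in>subgroups N. sz (fst x) (snd x))"
    by (rule sum_mono2) (auto simp: users_iff departure_props(7))
  finally show ?thesis by (simp add: sum_subgroups)
qed

lemma D_range: "D e t \<in> {0..arc_size N U e}"
  unfolding D_alt arc_size_def split_def
  by (auto intro!: sum_nonneg sum_mono departure_props(5,6) departing_subgroups)

lemma enter_iff: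
  "is_enter_time N Um e t \<tau> \<longleftrightarrow> (\<forall>s<\<tau>. E e s \<le> X e t) \<and> (\<forall>s>\<tau>. X e t \<le> E e s)"
  unfolding is_enter_time_def Lim_at_left_le_iff[OF E_mono] le_Lim_at_right_iff[OF E_mono] ..

lemma enter_ex:
  assumes "viable_arc N e"
  obtains \<tau> where "\<forall>s<\<tau>. E e s \<le> X e t" "\<forall>s>\<tau>. X e t \<le> E e s"
    "\<And>k p. (k, p) \<in> in_transit N e \<Longrightarrow> Up k p e t = Um k p e \<tau>"
    "\<And>k p. (k, p) \<in> departing N e \<Longrightarrow> X e t - T e \<tau> \<in> {0..arc_size N U e} \<and>
        Up k p e t = B k p (X e t - T e \<tau>)"
proof -
  obtain \<tau> where
    "is_enter_time N Um e t \<tau> \<and>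
      (\<forall>(k, p)\<in>in_transit N e. Up k p e t = Um k p e \<tau>) \<and>
      (\<forall>(k, p)\<in>departing N e.
         (let \<beta> = X e t - T e \<tau> in \<beta> \<in> {0..arc_size N U e} \<and> Up k p e t = B k p \<beta>))"
    using sol assms unfolding solution_def traffic_flow_def by blast
  then show ?thesis using that[of \<tau>] unfolding enter_iff Let_def by blast
qed

text \<open>At \<beta> = X - T(\<tau>) the priorities sum to \<beta>, filling exactly what the
  transit groups leave of X. It is the presence of a departing subgroup that places \<beta> in the
  domain of the priorities.\<close>

lemma sum_Up:
  assumes "(k, p) \<in> departing N e"
  shows "(\<Sum>x\<in>users N e. Up (fst x) (snd x) e t) = X e t"
proof -
  have e: "viable_arc N e" using assms viable_users departing_users by blast
  obtain \<tau> where
    \<tau>: "\<And>k p. (k, p) \<in> in_transit N e \<Longrightarrow> Up k p e t = Um k p e \<tau>"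
    "\<And>k p. (k, p) \<in> departing N e \<Longrightarrow> X e t - T e \<tau> \<in> {0..arc_size N U e} \<and>
        Up k p e t = B k p (X e t - T e \<tau>)"
    using enter_ex[OF e] by metis
  have tr: "(\<Sum>x\<in>in_transit N e. Up (fst x) (snd x) e t) = T e \<tau>"
    unfolding T_alt by (rule sum.cong) (auto simp: \<tau>(1))
  have b: "X e t - T e \<tau> \<in> {0..arc_size N U e}" using \<tau>(2) assms by blast
  have "(\<Sum>x\<in>departing N e. Up (fst x) (snd x) e t)
      = (\<Sum>x\<in>departing N e. B (fst x) (snd x) (X e t - T e \<tau>))"
    by (rule sum.cong) (auto simp: \<tau>(2))
  also have "\<dots> = X e t - T e \<tau>" by (rule sum_prio[OF e b])
  finally show ?thesis unfolding sum_users tr by simp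
qed

lemma X_lipschitz: "viable_arc N e \<Longrightarrow> t \<le> t' \<Longrightarrow> X e t' \<le> X e t + flux_max N e * (t' - t)"
  unfolding total_exited_eq
  by (rule delay_kernel.outflow_lipschitz[OF kernel_locale]) (auto simp: E_nonneg)

lemma Um_diff_le:
  assumes "(k, p) \<in> users N e" "s \<le> s'"
  shows "Um k p e s' - Um k p e s \<le> E e s' - E e s"
proof -
  have "Um (fst (k, p)) (snd (k, p)) e s' - Um (fst (k, p)) (snd (k, p)) e s
      \<le> (\<Sum>x\<in>users N e. Um (fst x) (snd x) e s' - Um (fst x) (snd x) e s)"
    using assms by (intro member_le_sum) (auto intro: monoD[OF Um_props(1)])
  then show ?thesis by (simp add: E_alt sum_subtractf)
qed

text \<open>If some group departs on \<open>e\<close>, the exits from \<open>e\<close> add up to \<open>X e\<close> and inherit its Lipschitz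
  constant.  On the other arcs this balance is not part of the definition of a flow, since \<open>T e\<close> could
  jump at the enter time; there the Lipschitz bound is propagated along each path from the
  continuity of its own entries.\<close>

lemma Up_lipschitz_transit:
  assumes kp: "(k, p) \<in> in_transit N e" and cont: "continuous_on UNIV (Um k p e)"
    and tt: "t \<le> t'"
  shows "Up k p e t' \<le> Up k p e t + flux_max N e * (t' - t)"
proof -
  have e: "viable_arc N e" using kp viable_users transit_users by blast
  obtain \<tau> where \<tau>: "\<forall>s>\<tau>. X e t \<le> E e s" "Up k p e t = Um k p e \<tau>"
    using enter_ex[OF e, of t] kp by metis
  obtain \<tau>' where \<tau>': "\<forall>s<\<tau>'. E e s \<le> X e t'" "Up k p e t' = Um k p e \<tau>'"
    using enter_ex[OF e, of t'] kp by metis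
  have "Um k p e \<tau>' - Um k p e \<tau> \<le> flux_max N e * (t' - t)"
  proof (cases "\<tau> < \<tau>'")
    case False
    then have "Um k p e \<tau>' \<le> Um k p e \<tau>"
      by (intro monoD[OF Um_props(1)[OF transit_users[OF kp]]]) simp
    moreover have "0 \<le> flux_max N e * (t' - t)" using tt flux_max_pos[OF e] by simp
    ultimately show ?thesis by linarith
  next
    case True
    \<comment> \<open>Strictly between the two enter times E lies between X t and X t', so the
      increment of one summand is at most X t' - X t; continuity of \<open>Um\<close> then carries
      the bound to the end points.\<close>
    have *: "Um k p e s' - Um k p e s \<le> flux_max N e * (t' - t)"
      if "\<tau> < s" "s \<le> s'" "s' < \<tau>'" for s s'
      using Um_diff_le[OF transit_users[OF kp] that(2)] X_lipschitz[OF e tt]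
        \<tau>(1)[rule_format, OF that(1)] \<tau>'(1)[rule_format, OF that(3)] by linarith
    define m where "m = (\<tau> + \<tau>') / 2"
    have m: "\<tau> < m" "m < \<tau>'" using True by (auto simp: m_def)
    have ct: "isCont (Um k p e) x" for x
      using cont by (simp add: continuous_on_eq_continuous_at)
    have **: "Um k p e \<tau>' - Um k p e s \<le> flux_max N e * (t' - t)" if "\<tau> < s" "s \<le> m" for s
    proof (rule tendsto_upperbound)
      show "((\<lambda>s'. Um k p e s' - Um k p e s) \<longlongrightarrow> Um k p e \<tau>' - Um k p e s) (at_left \<tau>')"
        using ct[of \<tau>'] by (intro tendsto_intros) (auto simp: isCont_def filterlim_at_split)
      show "\<forall>\<^sub>F s' in at_left \<tau>'. Um k p e s' - Um k p e s \<le> flux_max N e * (t' - t)"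
        unfolding eventually_at_left[OF m(2)] using that m by (intro exI[of _ m]) (auto intro!: *)
    qed simp
    show ?thesis
    proof (rule tendsto_upperbound)
      show "((\<lambda>s. Um k p e \<tau>' - Um k p e s) \<longlongrightarrow> Um k p e \<tau>' - Um k p e \<tau>) (at_right \<tau>)"
        using ct[of \<tau>] by (intro tendsto_intros) (auto simp: isCont_def filterlim_at_split)
      show "\<forall>\<^sub>F s in at_right \<tau>. Um k p e \<tau>' - Um k p e s \<le> flux_max N e * (t' - t)"
        unfolding eventually_at_right[OF m(1)] using m by (intro exI[of _ m]) (auto intro!: **)
    qed simp
  qed
  then show ?thesis using \<tau>(2) \<tau>'(2) by simp
qed

lemma Up_lipschitz:
  assumes "(k, p) \<in> users N e" "t \<le> t'"
  shows "Up k p e t' \<le> Up k p e t + flux_max N e * (t' - t)"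
proof -
  have kp: "(k, p) \<in> subgroups N" using assms by (simp add: users_iff)
  \<comment> \<open>The induction runs along the positions of a single path, because the arcs used
    by different paths may form cycles.\<close>
  have "\<forall>t t'. t \<le> t' \<longrightarrow> Up k p e t' \<le> Up k p e t + flux_max N e * (t' - t)"
    if "q < length (path_arcs p)" "e = path_arcs p ! q" for q e
    using that
  proof (induction q arbitrary: e)
    case 0
    then have d: "(k, p) \<in> departing N e" using kp by (simp add: departing_iff hd_conv_nth)
    then have u: "(k, p) \<in> users N e" by (rule departing_users)
    show ?case
    proof (intro allI impI)
      fix t t' :: real assume tt: "t \<le> t'"
      have "Up (fst (k, p)) (snd (k, p)) e t' - Up (fst (k, p)) (snd (k, p)) e t
        \<le> (\<Sum>x\<in>users N e. Up (fst x) (snd x) e t' - Up (fst x) (snd x) e t)"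
        using u tt by (intro member_le_sum) (auto intro: monoD[OF Up_props(1)])
      then have "Up k p e t' - Up k p e t \<le> X e t' - X e t"
        using sum_Up[OF d, of t] sum_Up[OF d, of t'] by (simp add: sum_subtractf)
      then show "Up k p e t' \<le> Up k p e t + flux_max N e * (t' - t)"
        using X_lipschitz[OF viable_users[OF u] tt] by simp
    qed
  next
    case (Suc q)
    define e' where "e' = path_arcs p ! q"
    have u: "(k, p) \<in> users N e'" using kp Suc.prems by (simp add: users_iff e'_def)
    have tr: "(k, p) \<in> in_transit N e" using Suc_in_transit[OF kp Suc.prems(1)] Suc.prems(2) by simp
    have "Um k p e = Up k p e'" using Um_next[OF kp Suc.prems(1)] Suc.prems(2) by (simp add: e'_def)
    moreover have "continuous_on UNIV (Up k p e')"
      using Suc.IH[of e'] Suc.prems(1)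
      by (intro continuous_lipschitz_mono[of _ "flux_max N e'"] Up_props(1)[OF u])
        (auto simp: e'_def)
    ultimately show ?case using Up_lipschitz_transit[OF tr] by simp
  qed
  then show ?thesis using assms by (metis in_set_conv_nth users_iff)
qed

lemma Up_cont: "(k, p) \<in> users N e \<Longrightarrow> continuous_on UNIV (Up k p e)"
  by (rule continuous_lipschitz_mono[OF Up_props(1) Up_lipschitz])

lemma Um_cont:
  assumes "(k, p) \<in> in_transit N e"
  shows "continuous_on UNIV (Um k p e)"
proof -
  obtain q where q: "Suc q < length (path_arcs p)" "e = path_arcs p ! Suc q"
    "(k, p) \<in> users N (path_arcs p ! q)" "(k, p) \<in> subgroups N"
    using assms by (rule user_prev)
  show ?thesis using Up_cont[OF q(3)] Um_next[OF q(4,1)] q(2) by simp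
qed

lemma T_cont: "continuous_on UNIV (T e)"
  unfolding T_alt[abs_def] by (intro continuous_on_sum) (auto intro: Um_cont)

text \<open>Nondecreasing summands of a constant sum are constant; continuity extends this to the
  end points.\<close>

lemma transit_const:
  assumes kp: "(k, p) \<in> in_transit N e" and "a \<le> b" and "\<And>s. a < s \<Longrightarrow> s < b \<Longrightarrow> E e s = y"
  shows "Um k p e a = Um k p e b"
proof (cases "a = b")
  case False
  then have ab: "a < b" using assms by simp
  define m where "m = (a + b) / 2"
  have m: "a < m" "m < b" using ab by (auto simp: m_def)
  have u: "(k, p) \<in> users N e" using kp by (rule transit_users)
  have *: "Um k p e s = Um k p e m" if "s \<in> {a<..<b}" for s
  proof -
    have "E e s = y" "E e m = y" using that m by (auto intro: assms(3))
    then show ?thesis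
      using Um_diff_le[OF u, of s m] Um_diff_le[OF u, of m s] monoD[OF Um_props(1)[OF u], of s m]
        monoD[OF Um_props(1)[OF u], of m s] by linarith
  qed
  have "Um k p e s = Um k p e m" if "s \<in> {a..b}" for s
  proof (rule continuous_constant_on_closure[of "{a<..<b}" "Um k p e" "Um k p e m" s])
    show "continuous_on (closure {a<..<b}) (Um k p e)"
      using Um_cont[OF kp] by (rule continuous_on_subset) simp
    show "s \<in> closure {a<..<b}" using that ab by simp
  qed (rule *)
  from this[of a] this[of b] show ?thesis using ab by simp
qed simp

section \<open>Enter times and travel times\<close>

lemma X_le_E: "viable_arc N e \<Longrightarrow> X e t \<le> E e t"
  unfolding total_exited_eq
  by (rule delay_kernel.outflow_le_inflow[OF kernel_locale]) (auto simp: E_nonneg E_mono)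

lemma E_le_X:
  assumes "viable_arc N e"
  shows "E e (t - lag e) \<le> X e t"
  unfolding total_exited_eq using lag_props[OF assms]
  by (intro delay_kernel.outflow_ge[OF kernel_locale[OF assms]]) (auto simp: E_nonneg E_mono E_le)

text \<open>The enter time can be moved into a window that does not depend on the flow; it only moves
  across an interval on which nobody enters the arc.\<close>

lemma enter_window:
  assumes e: "viable_arc N e"
  obtains \<tau> where "t - lag e \<le> \<tau>" "\<tau> \<le> t" "\<forall>s<\<tau>. E e s \<le> X e t" "\<forall>s>\<tau>. X e t \<le> E e s"
    "\<And>k p. (k, p) \<in> in_transit N e \<Longrightarrow> Up k p e t = Um k p e \<tau>"
    "\<And>k p. (k, p) \<in> departing N e \<Longrightarrow> X e t - T e \<tau> \<in> {0..arc_size N U e} \<and>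
        Up k p e t = B k p (X e t - T e \<tau>)"
proof -
  note window = that
  obtain \<tau> where \<tau>: "\<forall>s<\<tau>. E e s \<le> X e t" "\<forall>s>\<tau>. X e t \<le> E e s"
    "\<And>k p. (k, p) \<in> in_transit N e \<Longrightarrow> Up k p e t = Um k p e \<tau>"
    "\<And>k p. (k, p) \<in> departing N e \<Longrightarrow> X e t - T e \<tau> \<in> {0..arc_size N U e} \<and>
        Up k p e t = B k p (X e t - T e \<tau>)"
    using enter_ex[OF e, of t] by blast
  \<comment> \<open>A time \<sigma> may replace \<tau> as soon as the transit entries agree there,
    since T and the argument of the priorities then do not change.\<close>
  have move: thesis
    if \<sigma>: "t - lag e \<le> \<sigma>" "\<sigma> \<le> t" "\<forall>s<\<sigma>. E e s \<le> X e t" "\<forall>s>\<sigma>. X e t \<le> E e s"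
      and eq: "\<And>k p. (k, p) \<in> in_transit N e \<Longrightarrow> Um k p e \<tau> = Um k p e \<sigma>" for \<sigma>
  proof -
    have "T e \<tau> = T e \<sigma>" unfolding T_alt by (rule sum.cong) (auto simp: eq)
    then show thesis using \<sigma> \<tau>(3,4) eq by (intro window[of \<sigma>]) auto
  qed
  consider "\<tau> > t" | "\<tau> < t - lag e" | "t - lag e \<le> \<tau>" "\<tau> \<le> t" by linarith
  then show thesis
  proof cases
    case 1
    \<comment> \<open>Squeezed between X t \<le> E t \<le> E s and the enter condition E s \<le> X
      t; the other case uses E (t - lag) \<le> X t in the same way.\<close>
    have E: "E e s = X e t" if "t < s" "s < \<tau>" for s
      using \<tau>(1) that X_le_E[OF e, of t] monoD[OF E_mono[of e], of t s] by fastforce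
    show thesis
    proof (rule move[of t])
      show "t - lag e \<le> t" using lag_props(2)[OF e] by simp
      show "\<forall>s>t. X e t \<le> E e s" using X_le_E[OF e, of t] monoD[OF E_mono[of e], of t]
        by (meson less_imp_le order_trans)
      show "\<forall>s<t. E e s \<le> X e t" using 1 \<tau>(1) by simp
      show "Um k p e \<tau> = Um k p e t" if "(k, p) \<in> in_transit N e" for k p
        using transit_const[OF that, of t \<tau>] 1 E by simp
    qed simp
  next
    case 2
    have E: "E e s = X e t" if "\<tau> < s" "s < t - lag e" for s
      using \<tau>(2) that E_le_X[OF e, of t] monoD[OF E_mono[of e], of s "t - lag e"] by fastforce
    show thesis
    proof (rule move[of "t - lag e"])
      show "t - lag e \<le> t" using lag_props(2)[OF e] by simp
      show "\<forall>s>t - lag e. X e t \<le> E e s" using 2 \<tau>(2) by simp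
      show "\<forall>s<t - lag e. E e s \<le> X e t"
        using E_le_X[OF e, of t] monoD[OF E_mono[of e], of _ "t - lag e"]
        by (meson less_imp_le order_trans)
      show "Um k p e \<tau> = Um k p e (t - lag e)" if "(k, p) \<in> in_transit N e" for k p
        using transit_const[OF that, of \<tau> "t - lag e"] 2 E by simp
    qed simp
  next
    case 3
    then show thesis using \<tau> by (intro move) auto
  qed
qed

text \<open>Subtracting T from E leaves D. Since T is continuous, it may be evaluated at \<tau>
  instead of s, and so \<beta> falls between the one-sided limits of D at \<tau>.\<close>

lemma D_enter:
  assumes "\<forall>s<\<tau>. E e s \<le> X e t" "\<forall>s>\<tau>. X e t \<le> E e s"
  shows "s < \<tau> \<Longrightarrow> D e s \<le> X e t - T e \<tau>" "\<tau> < s \<Longrightarrow> X e t - T e \<tau> \<le> D e s"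
proof -
  have ct: "isCont (T e) \<tau>" using T_cont by (simp add: continuous_on_eq_continuous_at)
  show "D e s \<le> X e t - T e \<tau>" if s: "s < \<tau>"
  proof (rule tendsto_lowerbound)
    show "((\<lambda>s'. X e t - T e s') \<longlongrightarrow> X e t - T e \<tau>) (at_left \<tau>)"
      using ct by (intro tendsto_intros) (auto simp: isCont_def filterlim_at_split)
    have "D e s \<le> X e t - T e s'" if "s < s'" "s' < \<tau>" for s'
      using assms(1) that E_split[of e s'] monoD[OF D_mono[of e], of s s'] by fastforce
    then show "\<forall>\<^sub>F s' in at_left \<tau>. D e s \<le> X e t - T e s'"
      unfolding eventually_at_left[OF s] using s by blast
  qed simp
  show "X e t - T e \<tau> \<le> D e s" if s: "\<tau> < s"
  proof (rule tendsto_upperbound)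
    show "((\<lambda>s'. X e t - T e s') \<longlongrightarrow> X e t - T e \<tau>) (at_right \<tau>)"
      using ct by (intro tendsto_intros) (auto simp: isCont_def filterlim_at_split)
    have "X e t - T e s' \<le> D e s" if "\<tau> < s'" "s' < s" for s'
      using assms(2) that E_split[of e s'] monoD[OF D_mono[of e], of s' s] by fastforce
    then show "\<forall>\<^sub>F s' in at_right \<tau>. X e t - T e s' \<le> D e s"
      unfolding eventually_at_right[OF s] using s by blast
  qed simp
qed

text \<open>Crossing an arc takes between 0 and \<open>lag e\<close>, subgroup by subgroup. For a
  departing subgroup, \<beta> is compared with D at nearby times where B composed with D equals U.
  The comparisons of times are strict because U may jump at the enter time.\<close>

lemma Um_Up:
  assumes kp: "(k, p) \<in> users N e"
  shows "s < t - lag e \<Longrightarrow> Um k p e s \<le> Up k p e t" "t < s \<Longrightarrow> Up k p e t \<le> Um k p e s"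
proof -
  have e: "viable_arc N e" using kp by (rule viable_users)
  obtain \<tau> where \<tau>: "t - lag e \<le> \<tau>" "\<tau> \<le> t" "\<forall>s<\<tau>. E e s \<le> X e t" "\<forall>s>\<tau>. X e t \<le> E e s"
    "\<And>k p. (k, p) \<in> in_transit N e \<Longrightarrow> Up k p e t = Um k p e \<tau>"
    "\<And>k p. (k, p) \<in> departing N e \<Longrightarrow> X e t - T e \<tau> \<in> {0..arc_size N U e} \<and>
        Up k p e t = B k p (X e t - T e \<tau>)"
    using enter_window[OF e, of t] by blast
  have "(s < \<tau> \<longrightarrow> Um k p e s \<le> Up k p e t) \<and> (\<tau> < s \<longrightarrow> Up k p e t \<le> Um k p e s)" for s
  proof (cases "(k, p) \<in> in_transit N e")
    case True
    then show ?thesis using \<tau>(5)[OF True] monoD[OF Um_props(1)[OF kp]] by simp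
  next
    case False
    then have d: "(k, p) \<in> departing N e" using kp users_split(1)[of e] by auto
    note U = departure_props(1)[OF departing_subgroups[OF d]]
    define \<beta> where "\<beta> = X e t - T e \<tau>"
    have \<beta>: "\<beta> \<in> {0..arc_size N U e}" "Up k p e t = B k p \<beta>" using \<tau>(6)[OF d] by (auto simp: \<beta>_def)
    show ?thesis unfolding Um_first[OF d] \<beta>(2)
    proof (intro conjI impI)
      assume "s < \<tau>"
      then obtain s' where s': "s < s'" "s' < \<tau>" "B k p (D e s') = U k p s'"
        using AE_lborel_Ioo[OF prio_props(3)[OF d]] by metis
      have "U k p s \<le> B k p (D e s')" using s' monoD[OF U, of s s'] by simp
      also have "\<dots> \<le> B k p \<beta>"
        using D_enter(1)[OF \<tau>(3,4) s'(2)] D_range[of e s'] \<beta>(1)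
        by (intro monotone_onD[OF prio_props(2)[OF d]]) (auto simp: \<beta>_def)
      finally show "U k p s \<le> B k p \<beta>" .
    next
      assume "\<tau> < s"
      then obtain s' where s': "\<tau> < s'" "s' < s" "B k p (D e s') = U k p s'"
        using AE_lborel_Ioo[OF prio_props(3)[OF d]] by metis
      have "B k p \<beta> \<le> B k p (D e s')"
        using D_enter(2)[OF \<tau>(3,4) s'(1)] D_range[of e s'] \<beta>(1)
        by (intro monotone_onD[OF prio_props(2)[OF d]]) (auto simp: \<beta>_def)
      also have "\<dots> \<le> U k p s" using s' monoD[OF U, of s' s] by simp
      finally show "B k p \<beta> \<le> U k p s" .
    qed
  qed
  then show "s < t - lag e \<Longrightarrow> Um k p e s \<le> Up k p e t" "t < s \<Longrightarrow> Up k p e t \<le> Um k p e s"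
    using \<tau>(1,2) by auto
qed

text \<open>The two halves say that nobody leaves an arc before departing and that everyone leaves
  it eventually; on the last arc the second keeps the sets defining \<open>arrival_time\<close>
  nonempty.\<close>

lemma Up_departed:
  assumes u: "(k, p) \<in> users N e"
  shows "t < s \<Longrightarrow> Up k p e t \<le> U k p s" "\<exists>t. U k p s \<le> Up k p e t"
proof -
  have kp: "(k, p) \<in> subgroups N" using u by (simp add: users_iff)
  have claim: "(\<forall>s t. t < s \<longrightarrow> Up k p (path_arcs p ! q) t \<le> U k p s) \<and>
      (\<forall>s. \<exists>t. U k p s \<le> Up k p (path_arcs p ! q) t)"
    if "q < length (path_arcs p)" for q
    using that
  proof (induction q)
    case 0
    define e where "e = path_arcs p ! 0"
    have d: "(k, p) \<in> departing N e" using kp 0 by (simp add: departing_iff hd_conv_nth e_def)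
    have "U k p s \<le> Up k p e (s + lag e + 1)" for s
      using Um_Up(1)[OF departing_users[OF d], of s "s + lag e + 1"] Um_first[OF d] by simp
    then show ?case
      using Um_Up(2)[OF departing_users[OF d]] Um_first[OF d] by (auto simp: e_def)
  next
    case (Suc q)
    define e where "e = path_arcs p ! Suc q"
    have u: "(k, p) \<in> users N e" using kp Suc.prems by (simp add: users_iff e_def)
    have Um: "Um k p e = Up k p (path_arcs p ! q)" using Um_next[OF kp Suc.prems]
      by (simp add: e_def)
    have IH: "\<And>s t. t < s \<Longrightarrow> Um k p e t \<le> U k p s" "\<And>s. \<exists>t. U k p s \<le> Um k p e t"
      using Suc unfolding Um by auto
    show ?case unfolding e_def[symmetric]
    proof (intro conjI allI impI)
      fix s t :: real assume "t < s"
      \<comment> \<open>The midpoint splits the strict gap between the current arc and the induction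
        hypothesis.\<close>
      then have "t < (t + s) / 2" "(t + s) / 2 < s" by auto
      then show "Up k p e t \<le> U k p s"
        using Um_Up(2)[OF u, of t "(t + s) / 2"] IH(1)[of "(t + s) / 2" s] by simp
    next
      fix s
      obtain t where "U k p s \<le> Um k p e t" using IH(2) by blast
      then show "\<exists>t. U k p s \<le> Up k p e t"
        using Um_Up(1)[OF u, of t "t + lag e + 1"] by (intro exI[of _ "t + lag e + 1"]) simp
    qed
  qed
  obtain q where q: "q < length (path_arcs p)" "path_arcs p ! q = e"
    using u by (auto simp: users_iff in_set_conv_nth)
  from claim[OF q(1)] have *: "\<forall>s t. t < s \<longrightarrow> Up k p e t \<le> U k p s" "\<forall>s. \<exists>t. U k p s \<le> Up k p e t"
    unfolding q(2) by iprover+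
  from *(1) show "t < s \<Longrightarrow> Up k p e t \<le> U k p s" by iprover
  from *(2) show "\<exists>t. U k p s \<le> Up k p e t" by iprover
qed

abbreviation A :: "nat \<Rightarrow> path \<Rightarrow> real \<Rightarrow> real" where
  "A k p \<equiv> Up k p (last (path_arcs p))"

lemma last_users: "(k, p) \<in> subgroups N \<Longrightarrow> (k, p) \<in> users N (last (path_arcs p))"
  using subgroupD(6)[of k p] by (auto simp: users_iff)

lemma arrive:
  assumes "(k, p) \<in> subgroups N"
  shows "t < s \<Longrightarrow> A k p t \<le> U k p s" "\<exists>t. U k p s \<le> A k p t"
  using Up_departed[OF last_users[OF assms]] by blast+

end

section \<open>Cost\<close>

text \<open>Counts may jump or stay constant, so times are handled through comparisons with the
  generalized inverse. The limit 0 at -infinity bounds the set below, t0 makes it nonempty, and the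
  last part is strict because the infimum need not be attained.\<close>

lemma quantile:
  fixes f :: "real \<Rightarrow> real"
  assumes "mono f" "(f \<longlongrightarrow> 0) at_bot" "0 < \<beta>" "\<beta> \<le> f t0"
  shows "\<beta> \<le> f t \<Longrightarrow> Inf {t. \<beta> \<le> f t} \<le> t" "f t < \<beta> \<Longrightarrow> t \<le> Inf {t. \<beta> \<le> f t}"
    "Inf {t. \<beta> \<le> f t} < t \<Longrightarrow> \<beta> \<le> f t"
proof -
  have "\<forall>\<^sub>F t in at_bot. f t < \<beta>" by (rule order_tendstoD(2)[OF assms(2,3)])
  then obtain b where b: "f b < \<beta>" by (meson eventually_happens trivial_limit_at_bot_linorder)
  have lb: "t \<le> s" if "f t < \<beta>" "\<beta> \<le> f s" for t s
    using that monoD[OF assms(1), of s t] by linarith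
  have bdd: "bdd_below {t. \<beta> \<le> f t}" by (rule bdd_belowI[of _ b]) (use lb[OF b] in auto)
  have ne: "{t. \<beta> \<le> f t} \<noteq> {}" using assms(4) by auto
  show "\<beta> \<le> f t \<Longrightarrow> Inf {t. \<beta> \<le> f t} \<le> t" using bdd by (intro cInf_lower) auto
  show "f t < \<beta> \<Longrightarrow> t \<le> Inf {t. \<beta> \<le> f t}" using ne lb by (intro cInf_greatest) auto
  assume "Inf {t. \<beta> \<le> f t} < t"
  then obtain s where "s < t" "\<beta> \<le> f s" using cInf_less_iff[OF ne bdd] by auto
  then show "\<beta> \<le> f t" using monoD[OF assms(1), of s t] by linarith
qed

text \<open>\<open>ennreal\<close> truncates at 0, so this is x^+ + c = (x + c) + x^-, a form that
  avoids subtraction.\<close>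

lemma ennreal_pos_neg_shift:
  assumes "- c \<le> x" "0 \<le> c"
  shows "ennreal x + ennreal c = ennreal (x + c) + ennreal (- x)"
proof (cases "0 \<le> x")
  case True
  then show ?thesis using assms by (simp add: ennreal_neg flip: ennreal_plus)
next
  case False
  then show ?thesis using assms by (simp add: ennreal_neg flip: ennreal_plus)
qed

context network
begin

lemma cost_deriv:
  assumes "k \<in> groups N"
  shows "(dep_cost N k has_real_derivative deriv (dep_cost N k) t) (at t)"
    "(arr_cost N k has_real_derivative deriv (arr_cost N k) t) (at t)"
    "deriv (dep_cost N k) t < 0" "0 < deriv (arr_cost N k) t"
proof -
  have *: "(f has_real_derivative deriv f t) (at t)" if d: "f C1_differentiable_on UNIV"
    for f :: "real \<Rightarrow> real"
  proof -
    obtain D where "(f has_vector_derivative D) (at t)"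
      using d unfolding C1_differentiable_on_def by blast
    then show ?thesis by (metis DERIV_imp_deriv has_real_derivative_iff_has_vector_derivative)
  qed
  show "(dep_cost N k has_real_derivative deriv (dep_cost N k) t) (at t)"
    "(arr_cost N k has_real_derivative deriv (arr_cost N k) t) (at t)"
    "deriv (dep_cost N k) t < 0" "0 < deriv (arr_cost N k) t"
    using cost_assm assms by (auto simp: cost_assumption_def intro: *)
qed

lemma cost_monotone:
  assumes "k \<in> groups N" "s \<le> t"
  shows "dep_cost N k t \<le> dep_cost N k s" "arr_cost N k s \<le> arr_cost N k t"
proof -
  show "dep_cost N k t \<le> dep_cost N k s"
    by (rule DERIV_nonpos_imp_nonincreasing[OF assms(2)])
      (use cost_deriv(1,3)[OF assms(1)] in \<open>auto intro: less_imp_le\<close>)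
  show "arr_cost N k s \<le> arr_cost N k t"
    by (rule DERIV_nonneg_imp_nondecreasing[OF assms(2)])
      (use cost_deriv(2,4)[OF assms(1)] in \<open>auto intro: less_imp_le\<close>)
qed

lemma cost_isCont:
  assumes "k \<in> groups N"
  shows "isCont (dep_cost N k) t" "isCont (arr_cost N k) t"
  using cost_deriv(1,2)[OF assms] by (blast intro: DERIV_isCont)+

lemma cost_coercive:
  assumes "k \<in> groups N"
  obtains R where "0 < R" "\<And>t. R \<le> \<bar>t\<bar> \<Longrightarrow> y \<le> dep_cost N k t + arr_cost N k t"
proof -
  have "filterlim (\<lambda>t. dep_cost N k t + arr_cost N k t) at_top at_infinity"
    using cost_assm assms by (simp add: cost_assumption_def)
  then have "\<forall>\<^sub>F t in at_infinity. y \<le> dep_cost N k t + arr_cost N k t"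
    by (simp add: filterlim_at_top)
  then obtain R where "0 < R" "\<And>t. R \<le> norm t \<Longrightarrow> y \<le> dep_cost N k t + arr_cost N k t"
    by (auto simp: eventually_at_infinity_pos)
  then show ?thesis using that by simp
qed

text \<open>Minus a lower bound of phi_k + psi_k, which exists since the sum is continuous and tends
  to +infinity at both ends. Adding it makes each driver's cost nonnegative, as Fatou's lemma
  requires.\<close>

definition shift :: "nat \<Rightarrow> real" where
  "shift k = (SOME c. 0 \<le> c \<and> (\<forall>t. - c \<le> dep_cost N k t + arr_cost N k t))"

lemma shift_props:
  assumes "k \<in> groups N"
  shows "0 \<le> shift k" "- shift k \<le> dep_cost N k t + arr_cost N k t"
proof -
  define f where "f t = dep_cost N k t + arr_cost N k t" for t
  obtain R where R: "0 < R" "\<And>t. R \<le> \<bar>t\<bar> \<Longrightarrow> 0 \<le> f t"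
    using cost_coercive[OF assms, of 0] unfolding f_def by blast
  have "compact {-R..R}" "{-R..R} \<noteq> {}" "continuous_on {-R..R} f"
    using R(1) cost_isCont[OF assms]
    by (auto simp: f_def intro!: continuous_at_imp_continuous_on continuous_intros)
  from continuous_attains_inf[OF this] obtain x where "\<forall>y\<in>{-R..R}. f x \<le> f y" by blast
  then have "\<bar>t\<bar> < R \<Longrightarrow> f x \<le> f t" for t by (simp add: abs_less_iff)
  then have "- \<bar>f x\<bar> \<le> f t" for t
    using R(2)[of t] by (cases "R \<le> \<bar>t\<bar>") (fastforce simp: not_le)+
  then have "\<exists>c. 0 \<le> c \<and> (\<forall>t. - c \<le> dep_cost N k t + arr_cost N k t)"
    unfolding f_def by (intro exI[of _ "\<bar>f x\<bar>"]) (auto simp: f_def)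
  from someI_ex[OF this] show "0 \<le> shift k" "- shift k \<le> dep_cost N k t + arr_cost N k t"
    unfolding shift_def by auto
qed

text \<open>The end points are left out: at \<beta> = 0 the quantile sets are unbounded below, at
  \<beta> = G_kp they may be empty.\<close>

definition shifted_cost ::
  "(nat \<Rightarrow> path \<Rightarrow> real \<Rightarrow> real) \<Rightarrow> (nat \<Rightarrow> path \<Rightarrow> arc \<Rightarrow> real \<Rightarrow> real) \<Rightarrow> nat \<Rightarrow> path \<Rightarrow> real \<Rightarrow> ennreal"
  where "shifted_cost U Up k p \<beta> = ennreal (dep_cost N k (departure_time U k p \<beta>) +
    arr_cost N k (arrival_time Up k p \<beta>) + shift k) * indicator {0<..<subgroup_size U k p} \<beta>"

definition shifted_total ::
  "(nat \<Rightarrow> path \<Rightarrow> real \<Rightarrow> real) \<Rightarrow> (nat \<Rightarrow> path \<Rightarrow> arc \<Rightarrow> real \<Rightarrow> real) \<Rightarrow> ennreal" where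
  "shifted_total U Up =
    (\<Sum>x\<in>subgroups N. \<integral>\<^sup>+\<beta>. shifted_cost U Up (fst x) (snd x) \<beta> \<partial>lborel)"

end

context flow
begin

abbreviation td :: "nat \<Rightarrow> path \<Rightarrow> real \<Rightarrow> real" where "td \<equiv> departure_time U"
abbreviation ta :: "nat \<Rightarrow> path \<Rightarrow> real \<Rightarrow> real" where "ta \<equiv> arrival_time Up"

lemma departed_ex:
  assumes "(k, p) \<in> subgroups N" "\<beta> < sz k p"
  obtains t where "\<beta> < U k p t"
proof -
  have "\<forall>\<^sub>F t in at_top. \<beta> < U k p t"
    by (rule order_tendstoD(1)[OF departure_props(4)[OF assms(1)] assms(2)])
  then show ?thesis using that by (meson eventually_happens trivial_limit_at_top_linorder)
qed

lemma td_props: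
  assumes "(k, p) \<in> subgroups N" "0 < \<beta>" "\<beta> < sz k p"
  shows "\<beta> \<le> U k p t \<Longrightarrow> td k p \<beta> \<le> t" "U k p t < \<beta> \<Longrightarrow> t \<le> td k p \<beta>" "td k p \<beta> < t \<Longrightarrow> \<beta> \<le> U k p t"
proof -
  obtain t0 where "\<beta> < U k p t0" using departed_ex[OF assms(1,3)] .
  note q = quantile[OF departure_props(1)[OF assms(1)] departure_props(3)[OF assms(1)] assms(2) less_imp_le[OF this]]
  show "\<beta> \<le> U k p t \<Longrightarrow> td k p \<beta> \<le> t" "U k p t < \<beta> \<Longrightarrow> t \<le> td k p \<beta>" "td k p \<beta> < t \<Longrightarrow> \<beta> \<le> U k p t"
    unfolding departure_time_def using q[of t] by auto
qed

lemma ta_props: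
  assumes "(k, p) \<in> subgroups N" "0 < \<beta>" "\<beta> < sz k p"
  shows "\<beta> \<le> A k p t \<Longrightarrow> ta k p \<beta> \<le> t" "A k p t < \<beta> \<Longrightarrow> t \<le> ta k p \<beta>" "ta k p \<beta> < t \<Longrightarrow> \<beta> \<le> A k p t"
proof -
  obtain t0 where t0: "\<beta> < U k p t0" using departed_ex[OF assms(1,3)] .
  obtain t1 where "U k p t0 \<le> A k p t1" using arrive(2)[OF assms(1)] by blast
  then have t1: "\<beta> \<le> A k p t1" using t0 by simp
  note u = last_users[OF assms(1)]
  note q = quantile[OF Up_props(1)[OF u] Up_props(4)[OF u] assms(2) t1]
  show "\<beta> \<le> A k p t \<Longrightarrow> ta k p \<beta> \<le> t" "A k p t < \<beta> \<Longrightarrow> t \<le> ta k p \<beta>" "ta k p \<beta> < t \<Longrightarrow> \<beta> \<le> A k p t"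
    unfolding arrival_time_def using q[of t] by auto
qed

lemma td_mono:
  assumes "(k, p) \<in> subgroups N" "0 < \<beta>" "\<beta> \<le> \<beta>'" "\<beta>' < sz k p"
  shows "td k p \<beta> \<le> td k p \<beta>'"
proof (rule dense_ge)
  fix t assume "td k p \<beta>' < t"
  then have "\<beta>' \<le> U k p t" using td_props(3)[of k p \<beta>' t] assms by simp
  then show "td k p \<beta> \<le> t" using td_props(1)[of k p \<beta> t] assms by simp
qed

lemma ta_mono:
  assumes "(k, p) \<in> subgroups N" "0 < \<beta>" "\<beta> \<le> \<beta>'" "\<beta>' < sz k p"
  shows "ta k p \<beta> \<le> ta k p \<beta>'"
proof (rule dense_ge)
  fix t assume "ta k p \<beta>' < t"
  then have "\<beta>' \<le> A k p t" using ta_props(3)[of k p \<beta>' t] assms by simp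
  then show "ta k p \<beta> \<le> t" using ta_props(1)[of k p \<beta> t] assms by simp
qed

lemma td_le_ta:
  assumes "(k, p) \<in> subgroups N" "0 < \<beta>" "\<beta> < sz k p"
  shows "td k p \<beta> \<le> ta k p \<beta>"
proof (rule dense_ge)
  fix t assume t: "ta k p \<beta> < t"
  then obtain s where s: "ta k p \<beta> < s" "s < t" using dense by blast
  have "\<beta> \<le> A k p s" by (rule ta_props(3)[OF assms s(1)])
  also have "\<dots> \<le> U k p t" by (rule arrive(1)[OF assms(1) s(2)])
  finally show "td k p \<beta> \<le> t" by (rule td_props(1)[OF assms])
qed

lemma driver_cost_ge:
  assumes "(k, p) \<in> subgroups N" "0 < \<beta>" "\<beta> < sz k p"
  shows "dep_cost N k (td k p \<beta>) + arr_cost N k (td k p \<beta>)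
    \<le> dep_cost N k (td k p \<beta>) + arr_cost N k (ta k p \<beta>)"
  using cost_monotone(2)[OF subgroupD(1)[OF assms(1)] td_le_ta[OF assms]] by simp

lemma driver_cost_measurable:
  assumes "(k, p) \<in> subgroups N"
  shows "(\<lambda>\<beta>. dep_cost N k (td k p \<beta>) + arr_cost N k (ta k p \<beta>))
    \<in> borel_measurable (restrict_space borel {0<..<sz k p})"
proof -
  have k: "k \<in> groups N" using subgroupD(1)[OF assms] .
  have "td k p \<in> borel_measurable (restrict_space borel {0<..<sz k p})"
    "ta k p \<in> borel_measurable (restrict_space borel {0<..<sz k p})"
    by (rule borel_measurable_mono_on_fnc,
        force intro!: mono_onI td_mono[OF assms] ta_mono[OF assms])+
  moreover have "dep_cost N k \<in> borel_measurable borel" "arr_cost N k \<in> borel_measurable borel"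
    using cost_isCont[OF k]
    by (auto intro!: borel_measurable_continuous_onI continuous_at_imp_continuous_on)
  ultimately show ?thesis by measurable
qed

lemma shifted_cost_measurable:
  assumes "(k, p) \<in> subgroups N"
  shows "shifted_cost U Up k p \<in> borel_measurable lborel"
proof -
  have "(\<lambda>\<beta>. ennreal (dep_cost N k (td k p \<beta>) + arr_cost N k (ta k p \<beta>) + shift k))
      \<in> borel_measurable (restrict_space borel {0<..<sz k p})"
    using driver_cost_measurable[OF assms] by measurable
  then show ?thesis
    unfolding shifted_cost_def[abs_def]
    by (subst (asm) borel_measurable_restrict_space_iff_ennreal) auto
qed

text \<open>P and Q are the integrals of the positive and the negative part, W that of the shifted
  cost. In \<open>ennreal\<close> one gets P + c * G_kp = W + Q; Q is finite because the cost is at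
  least -c, so it can be moved across.\<close>

lemma shifted_integral:
  assumes kp: "(k, p) \<in> subgroups N"
  shows "extended_integral {0..sz k p} (\<lambda>\<beta>. dep_cost N k (td k p \<beta>) + arr_cost N k (ta k p \<beta>))
      + ereal (shift k * sz k p) = enn2ereal (\<integral>\<^sup>+\<beta>. shifted_cost U Up k p \<beta> \<partial>lborel)"
proof -
  define S where "S = {0<..<sz k p}"
  define f where "f \<beta> = dep_cost N k (td k p \<beta>) + arr_cost N k (ta k p \<beta>)" for \<beta>
  define c where "c = shift k"
  have c: "0 \<le> c" using shift_props(1)[OF subgroupD(1)[OF kp]] by (simp add: c_def)
  have f: "- c \<le> f \<beta>" if "\<beta> \<in> S" for \<beta>
    using driver_cost_ge[OF kp, of \<beta>] shift_props(2)[OF subgroupD(1)[OF kp], of "td k p \<beta>"] that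
    by (simp add: S_def f_def c_def)
  have fm: "f \<in> borel_measurable (restrict_space borel S)"
    using driver_cost_measurable[OF kp] by (simp add: f_def[abs_def] S_def)
  have meas: "(\<lambda>\<beta>. ennreal (g (f \<beta>)) * indicator S \<beta>) \<in> borel_measurable lborel"
    if "g \<in> borel_measurable borel" for g
  proof -
    have "(\<lambda>\<beta>. ennreal (g (f \<beta>))) \<in> borel_measurable (restrict_space borel S)"
      using fm that by measurable
    then show ?thesis by (subst (asm) borel_measurable_restrict_space_iff_ennreal) (auto simp: S_def)
  qed
  have AE: "AE \<beta> in lborel. indicator {0..sz k p} \<beta> = (indicator S \<beta> :: ennreal)"
  proof -
    have "AE \<beta> in lborel. \<beta> \<notin> {0, sz k p}"
      by (rule AE_not_in) (rule countable_imp_null_set_lborel, simp)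
    then show ?thesis by eventually_elim (auto simp: S_def indicator_def)
  qed
  define P where "P = (\<integral>\<^sup>+\<beta>. ennreal (f \<beta>) * indicator S \<beta> \<partial>lborel)"
  define Q where "Q = (\<integral>\<^sup>+\<beta>. ennreal (- f \<beta>) * indicator S \<beta> \<partial>lborel)"
  define W where "W = (\<integral>\<^sup>+\<beta>. ennreal (f \<beta> + c) * indicator S \<beta> \<partial>lborel)"
  have PQ: "extended_integral {0..sz k p} f = enn2ereal P - enn2ereal Q"
    unfolding extended_integral_def P_def Q_def
    by (intro arg_cong2[of _ _ _ _ "\<lambda>x y. enn2ereal x - enn2ereal y"] nn_integral_cong_AE)
      (use AE in \<open>auto elim!: eventually_mono\<close>)
  have cS: "(\<integral>\<^sup>+\<beta>. ennreal c * indicator S \<beta> \<partial>lborel) = ennreal (c * sz k p)"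
    using departure_props(7)[OF kp] c by (simp add: S_def nn_integral_cmult_indicator ennreal_mult)
  have "Q \<le> (\<integral>\<^sup>+\<beta>. ennreal c * indicator S \<beta> \<partial>lborel)"
    unfolding Q_def
    by (intro nn_integral_mono) (use f in \<open>force simp: indicator_def intro!: ennreal_leI\<close>)
  then have Qfin: "Q < \<infinity>" unfolding cS by (rule le_less_trans) simp
  have "P + ennreal (c * sz k p) = (\<integral>\<^sup>+\<beta>. ennreal (f \<beta>) * indicator S \<beta> + ennreal c * indicator S \<beta> \<partial>lborel)"
    unfolding P_def cS[symmetric]
    by (rule nn_integral_add[symmetric], use meas[of "\<lambda>x. x"] in simp) (simp add: S_def)
  also have "\<dots> = (\<integral>\<^sup>+\<beta>. ennreal (f \<beta> + c) * indicator S \<beta> + ennreal (- f \<beta>) * indicator S \<beta> \<partial>lborel)"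
  proof (rule nn_integral_cong)
    fix \<beta>
    show "ennreal (f \<beta>) * indicator S \<beta> + ennreal c * indicator S \<beta>
        = ennreal (f \<beta> + c) * indicator S \<beta> + ennreal (- f \<beta>) * indicator S \<beta>"
      using ennreal_pos_neg_shift[OF f c, of \<beta>] by (cases "\<beta> \<in> S") auto
  qed
  also have "\<dots> = W + Q"
    unfolding W_def Q_def
    by (rule nn_integral_add) (use meas[of "\<lambda>x. x + c"] meas[of "\<lambda>x. - x"] in simp_all)
  finally have *: "enn2ereal P + ereal (c * sz k p) = enn2ereal W + enn2ereal Q"
    using departure_props(7)[OF kp] c
      by (metis enn2ereal_ennreal mult_nonneg_nonneg plus_ennreal.rep_eq)
  have "enn2ereal P - enn2ereal Q + ereal (c * sz k p) = enn2ereal W"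
  proof -
    obtain q where q: "enn2ereal Q = ereal q" using Qfin by (cases Q) auto
    show ?thesis using * unfolding q
      by (cases "enn2ereal P"; cases "enn2ereal W") auto
  qed
  then show ?thesis using PQ
    by (simp add: f_def[abs_def] W_def c_def S_def shifted_cost_def)
qed

lemma total_cost_shifted:
  "total_cost N U Up + ereal (\<Sum>k\<in>groups N. shift k * G k) = enn2ereal (shifted_total U Up)"
proof -
  have "(\<Sum>k\<in>groups N. shift k * G k) = (\<Sum>k\<in>groups N. \<Sum>p\<in>group_paths N k. shift k * sz k p)"
    by (intro sum.cong) (simp_all add: sum_sizes flip: sum_distrib_left)
  also have "\<dots> = (\<Sum>x\<in>subgroups N. shift (fst x) * sz (fst x) (snd x))"
    unfolding subgroups_def by (subst sum.Sigma) (auto simp: split_def)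
  finally have "total_cost N U Up + ereal (\<Sum>k\<in>groups N. shift k * G k) =
      (\<Sum>x\<in>subgroups N. extended_integral {0..sz (fst x) (snd x)}
          (\<lambda>\<beta>. dep_cost N (fst x) (td (fst x) (snd x) \<beta>) + arr_cost N (fst x) (ta (fst x) (snd x) \<beta>))
        + ereal (shift (fst x) * sz (fst x) (snd x)))"
    unfolding total_cost_def split_def sum.distrib by simp
  also have "\<dots> = (\<Sum>x\<in>subgroups N. enn2ereal (\<integral>\<^sup>+\<beta>. shifted_cost U Up (fst x) (snd x) \<beta> \<partial>lborel))"
    by (rule sum.cong) (auto simp: shifted_integral)
  finally show ?thesis unfolding shifted_total_def by simp
qed

text \<open>Markov's inequality for the drivers between a and b. Only the departure time enters the
  hypothesis, because arriving no earlier than departing can only add to the cost.\<close>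

lemma shifted_cost_ge:
  assumes kp: "(k, p) \<in> subgroups N" and tot: "shifted_total U Up \<le> ennreal K" and K: "0 \<le> K"
    and ab: "0 \<le> a" "a \<le> b" "b \<le> sz k p" and y: "0 \<le> y"
    and far: "\<And>\<beta>. a < \<beta> \<Longrightarrow> \<beta> < b \<Longrightarrow> y \<le> dep_cost N k (td k p \<beta>) + arr_cost N k (td k p \<beta>)"
  shows "y * (b - a) \<le> K"
proof -
  have "ennreal (y * (b - a)) = (\<integral>\<^sup>+\<beta>. ennreal y * indicator {a<..<b} \<beta> \<partial>lborel)"
    using ab y by (simp add: nn_integral_cmult_indicator ennreal_mult)
  also have "\<dots> \<le> (\<integral>\<^sup>+\<beta>. shifted_cost U Up k p \<beta> \<partial>lborel)"
  proof (rule nn_integral_mono)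
    fix \<beta>
    show "ennreal y * indicator {a<..<b} \<beta> \<le> shifted_cost U Up k p \<beta>"
    proof (cases "\<beta> \<in> {a<..<b}")
      case True
      then have \<beta>: "0 < \<beta>" "\<beta> < sz k p" using ab by auto
      have "y \<le> dep_cost N k (td k p \<beta>) + arr_cost N k (ta k p \<beta>) + shift k"
        using far[of \<beta>] True driver_cost_ge[OF kp \<beta>] shift_props(1)[OF subgroupD(1)[OF kp]] by simp
      then show ?thesis using True \<beta> by (simp add: shifted_cost_def ennreal_leI)
    qed simp
  qed
  also have "\<dots> = (\<integral>\<^sup>+\<beta>. shifted_cost U Up (fst (k, p)) (snd (k, p)) \<beta> \<partial>lborel)" by simp
  also have "\<dots> \<le> shifted_total U Up"
    unfolding shifted_total_def using kp by (intro member_le_sum) auto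
  also have "\<dots> \<le> ennreal K" by (rule tot)
  finally show ?thesis using K by (simp add: ennreal_le_iff)
qed

text \<open>The first U(-R) drivers depart by time -R, those beyond U(R) not before R, and each of
  them pays at least y. The bounds depend on the flow only through K.\<close>

lemma tight:
  assumes kp: "(k, p) \<in> subgroups N" and tot: "shifted_total U Up \<le> ennreal K" and K: "0 \<le> K"
    and y: "0 \<le> y" and R: "\<And>t. R \<le> \<bar>t\<bar> \<Longrightarrow> y \<le> dep_cost N k t + arr_cost N k t" and "0 < R"
  shows "y * U k p (- R) \<le> K" "y * (sz k p - U k p R) \<le> K"
proof -
  have "y * (U k p (- R) - 0) \<le> K"
  proof (rule shifted_cost_ge[OF kp tot K])
    fix \<beta> assume "0 < \<beta>" "\<beta> < U k p (- R)"
    then show "y \<le> dep_cost N k (td k p \<beta>) + arr_cost N k (td k p \<beta>)"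
      using td_props(1)[OF kp, of \<beta> "- R"] departure_props(6)[OF kp, of "- R"] \<open>0 < R\<close>
        by (intro R) simp
  qed (use departure_props[OF kp] y in auto)
  then show "y * U k p (- R) \<le> K" by simp
  show "y * (sz k p - U k p R) \<le> K"
  proof (rule shifted_cost_ge[OF kp tot K])
    fix \<beta> assume "U k p R < \<beta>" "\<beta> < sz k p"
    then show "y \<le> dep_cost N k (td k p \<beta>) + arr_cost N k (td k p \<beta>)"
      using td_props(2)[OF kp, of \<beta> R] departure_props(5)[OF kp, of R] by (intro R) simp
  qed (use departure_props[OF kp] y in auto)
qed

end

section \<open>Limits of flows\<close>

lemma mono_limit:
  fixes f :: "nat \<Rightarrow> real \<Rightarrow> real"
  assumes "\<And>n. mono (f n)" "\<And>x. (\<lambda>n. f n x) \<longlonglongrightarrow> g x"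
  shows "mono g"
proof (rule monoI)
  fix x y :: real assume "x \<le> y"
  then show "g x \<le> g y" using assms(1)
    by (intro LIMSEQ_le[OF assms(2) assms(2)]) (auto dest: monoD)
qed

text \<open>Needed because enter times and the arguments of the priorities move with n.\<close>

lemma tendsto_equilipschitz:
  fixes f :: "nat \<Rightarrow> real \<Rightarrow> real"
  assumes mono: "\<And>n. mono (f n)" and lip: "\<And>n x y. x \<le> y \<Longrightarrow> f n y \<le> f n x + F * (y - x)"
    and conv: "(\<lambda>n. f n x) \<longlonglongrightarrow> g" and x: "xs \<longlonglongrightarrow> x"
  shows "(\<lambda>n. f n (xs n)) \<longlonglongrightarrow> g"
proof -
  have "\<bar>f n (xs n) - f n x\<bar> \<le> F * \<bar>xs n - x\<bar>" for n
    using lip[of "xs n" x n] lip[of x "xs n" n] monoD[OF mono[of n], of x "xs n"]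
      monoD[OF mono[of n], of "xs n" x] by (cases "x \<le> xs n") auto
  moreover have "(\<lambda>n. F * \<bar>xs n - x\<bar>) \<longlonglongrightarrow> F * \<bar>x - x\<bar>" by (intro tendsto_intros x)
  ultimately have "(\<lambda>n. f n (xs n) - f n x) \<longlonglongrightarrow> 0"
    by (intro Lim_null_comparison[of "\<lambda>n. f n (xs n) - f n x" "\<lambda>n. F * \<bar>xs n - x\<bar>"] always_eventually)
      auto
  from tendsto_add[OF this conv] show ?thesis by simp
qed

context flow
begin

lemma Up_rate:
  assumes "(k, p) \<in> users N e" "t \<le> t'"
  shows "Up k p e t' \<le> Up k p e t + rate * (t' - t)"
  using Up_lipschitz[OF assms] assms(2)
    mult_right_mono[OF flux_max_le_rate[OF viable_users[OF assms(1)]], of "t' - t"] by simp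

lemma Um_rate:
  assumes "(k, p) \<in> in_transit N e" "t \<le> t'"
  shows "Um k p e t' \<le> Um k p e t + rate * (t' - t)"
proof -
  obtain q where q: "Suc q < length (path_arcs p)" "e = path_arcs p ! Suc q"
    "(k, p) \<in> users N (path_arcs p ! q)" "(k, p) \<in> subgroups N"
    using assms(1) by (rule user_prev)
  show ?thesis using Up_rate[OF q(3) assms(2)] Um_next[OF q(4,1)] q(2) by simp
qed

text \<open>Since \<open>B\<close> is only controlled on \<open>{0..arc_size}\<close>, and these intervals vary along a sequence
  of flows, limits are taken of its extension by constants.\<close>

definition Bx :: "nat \<Rightarrow> path \<Rightarrow> real \<Rightarrow> real" where
  "Bx k p x = B k p (max 0 (min (arc_size N U (hd (path_arcs p))) x))"

lemma arc_size_nonneg: "0 \<le> arc_size N U e"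
  using D_range[of e 0] by simp

lemma Bx_eq: "(k, p) \<in> departing N e \<Longrightarrow> x \<in> {0..arc_size N U e} \<Longrightarrow> Bx k p x = B k p x"
  by (simp add: Bx_def departing_iff)

lemma Bx_range:
  assumes "(k, p) \<in> subgroups N"
  shows "0 \<le> Bx k p x" "Bx k p x \<le> sz k p"
  using prio_props(1)[OF departing_hd[OF assms], of "max 0 (min (arc_size N U (hd (path_arcs p))) x)"]
    arc_size_nonneg[of "hd (path_arcs p)"] by (auto simp: Bx_def)

lemma Bx_mono:
  assumes "(k, p) \<in> subgroups N"
  shows "mono (Bx k p)"
proof (rule monoI)
  fix x y :: real assume "x \<le> y"
  then show "Bx k p x \<le> Bx k p y"
    unfolding Bx_def using arc_size_nonneg[of "hd (path_arcs p)"]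
    by (intro monotone_onD[OF prio_props(2)[OF departing_hd[OF assms]]]) auto
qed

lemma sum_Bx:
  assumes "viable_arc N e"
  shows "(\<Sum>y\<in>departing N e. Bx (fst y) (snd y) x) = max 0 (min (arc_size N U e) x)"
proof -
  have "(\<Sum>y\<in>departing N e. Bx (fst y) (snd y) x)
      = (\<Sum>y\<in>departing N e. B (fst y) (snd y) (max 0 (min (arc_size N U e) x)))"
    by (rule sum.cong) (auto simp: Bx_def departing_iff)
  then show ?thesis using sum_prio[OF assms] arc_size_nonneg[of e] by simp
qed

lemma Bx_lipschitz:
  assumes kp: "(k, p) \<in> subgroups N" and "x \<le> y"
  shows "Bx k p y \<le> Bx k p x + 1 * (y - x)"
proof -
  define e where "e = hd (path_arcs p)"
  have d: "(k, p) \<in> departing N e" using kp by (simp add: departing_iff e_def)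
  have e: "viable_arc N e" using viable_users[OF departing_users[OF d]] .
  have "Bx (fst (k, p)) (snd (k, p)) y - Bx (fst (k, p)) (snd (k, p)) x
      \<le> (\<Sum>z\<in>departing N e. Bx (fst z) (snd z) y - Bx (fst z) (snd z) x)"
    using d assms(2)
    by (intro member_le_sum) (auto intro!: monoD[OF Bx_mono] simp: departing_iff)
  then show ?thesis
    using sum_Bx[OF e, of x] sum_Bx[OF e, of y] assms(2) by (simp add: sum_subtractf)
qed

end

text \<open>What compactness provides: departures converge only off the countable set C, while
  exits, transit entries and extended priorities converge everywhere, being equi-Lipschitz.
  Convergence of the sizes is a separate assumption because pointwise convergence would let mass
  escape to infinity.\<close>

locale flow_limit = network +
  fixes Us Bs :: "nat \<Rightarrow> nat \<Rightarrow> path \<Rightarrow> real \<Rightarrow> real"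
    and Ums Ups :: "nat \<Rightarrow> nat \<Rightarrow> path \<Rightarrow> arc \<Rightarrow> real \<Rightarrow> real"
    and U B :: "nat \<Rightarrow> path \<Rightarrow> real \<Rightarrow> real" and Um Up :: "nat \<Rightarrow> path \<Rightarrow> arc \<Rightarrow> real \<Rightarrow> real"
    and C :: "real set"
  assumes sols: "\<And>n. solution N G (Us n) (Bs n) (Ums n) (Ups n)"
    and C: "countable C"
    and U_dist: "\<And>k p. (k, p) \<in> subgroups N \<Longrightarrow> departure_distribution (U k p)"
    and U_else: "\<And>k p t. (k, p) \<notin> subgroups N \<Longrightarrow> U k p t = 0"
    and U_conv: "\<And>k p t. (k, p) \<in> subgroups N \<Longrightarrow> t \<notin> C \<Longrightarrow> (\<lambda>n. Us n k p t) \<longlonglongrightarrow> U k p t"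
    and size_conv: "\<And>k p. (k, p) \<in> subgroups N \<Longrightarrow>
      (\<lambda>n. subgroup_size (Us n) k p) \<longlonglongrightarrow> subgroup_size U k p"
    and Up_conv: "\<And>k p e t. (k, p) \<in> users N e \<Longrightarrow> (\<lambda>n. Ups n k p e t) \<longlonglongrightarrow> Up k p e t"
    and Um_first': "\<And>k p e. (k, p) \<in> departing N e \<Longrightarrow> Um k p e = U k p"
    and Um_conv: "\<And>k p e t. (k, p) \<in> in_transit N e \<Longrightarrow> (\<lambda>n. Ums n k p e t) \<longlonglongrightarrow> Um k p e t"
    and B_conv: "\<And>k p x. (k, p) \<in> subgroups N \<Longrightarrow> (\<lambda>n. flow.Bx N (Us n) (Bs n) k p x) \<longlonglongrightarrow> B k p x"

sublocale flow_limit \<subseteq> seq: flow N G "Us n" "Bs n" "Ums n" "Ups n" for n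
  by unfold_locales (rule sols)

context flow_limit
begin

lemma generic_between: "s < t \<Longrightarrow> \<exists>s'. s < s' \<and> s' < t \<and> s' \<notin> C"
  using open_minus_countable[OF C, of "{s<..<t}"] by auto

lemma U_props:
  assumes "(k, p) \<in> subgroups N"
  shows "mono (U k p)" "(U k p \<longlongrightarrow> 0) at_bot" "U k p t \<le> subgroup_size U k p" "0 \<le> U k p t"
proof -
  have "departure_distribution (U k p)" by (rule U_dist[OF assms])
  then show *: "mono (U k p)" "(U k p \<longlongrightarrow> 0) at_bot" "U k p t \<le> subgroup_size U k p"
    by (auto simp: departure_distribution_def subgroup_size_def intro: mono_bounded_tendsto_at_top)
  show "0 \<le> U k p t" using *(1,2) by (rule mono_tendsto_at_bot_lower)
qed

lemma Um_conv': "(k, p) \<in> users N e \<Longrightarrow> t \<notin> C \<Longrightarrow> (\<lambda>n. Ums n k p e t) \<longlonglongrightarrow> Um k p e t"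
  by (erule user_or)
    (auto simp: Um_first' seq.Um_first intro: Um_conv U_conv departing_subgroups)

text \<open>U tends to 0 at -infinity, and this comparison hands the decay to the limit exits;
  pointwise convergence alone would not.\<close>

lemma Up_le_U:
  assumes u: "(k, p) \<in> users N e" and "t < s"
  shows "Up k p e t \<le> U k p s"
proof -
  have kp: "(k, p) \<in> subgroups N" using u by (simp add: users_iff)
  obtain s' where s': "t < s'" "s' < s" "s' \<notin> C" using generic_between[OF assms(2)] by blast
  have "Up k p e t \<le> U k p s'"
    using seq.Up_departed(1)[OF u s'(1)]
    by (intro LIMSEQ_le[OF Up_conv[OF u] U_conv[OF kp s'(3)]]) auto
  also have "\<dots> \<le> U k p s" using s' by (intro monoD[OF U_props(1)[OF kp]]) simp
  finally show ?thesis .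
qed

lemma Up_count:
  assumes u: "(k, p) \<in> users N e"
  shows "cumulative_count (subgroup_size U k p) (Up k p e)"
proof -
  have kp: "(k, p) \<in> subgroups N" using u by (simp add: users_iff)
  have "mono (Up k p e)" by (rule mono_limit[OF seq.Up_props(1)[OF u] Up_conv[OF u]])
  moreover have "(Up k p e \<longlongrightarrow> 0) at_bot"
  proof (rule tendsto_sandwich)
    show "\<forall>\<^sub>F t in at_bot. 0 \<le> Up k p e t"
      by (intro always_eventually allI LIMSEQ_le_const[OF Up_conv[OF u]])
        (auto intro: seq.Up_props[OF u])
    show "\<forall>\<^sub>F t in at_bot. Up k p e t \<le> U k p (t + 1)"
      by (intro always_eventually allI Up_le_U[OF u]) simp
    have "filterlim (\<lambda>t::real. t + 1) at_bot at_bot"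
      unfolding filterlim_at_bot eventually_at_bot_linorder
    proof
      show "\<exists>M. \<forall>t\<le>M. t + 1 \<le> y" for y :: real by (rule exI[of _ "y - 1"]) simp
    qed
    then show "((\<lambda>t. U k p (t + 1)) \<longlongrightarrow> 0) at_bot"
      by (rule filterlim_compose[OF U_props(2)[OF kp]])
  qed simp
  moreover have "Up k p e t \<le> subgroup_size U k p" for t
    by (intro LIMSEQ_le[OF Up_conv[OF u] size_conv[OF kp]]) (auto intro: seq.Up_props[OF u])
  ultimately show ?thesis by (simp add: cumulative_count_def)
qed

lemma Um_next':
  assumes "(k, p) \<in> subgroups N" "Suc q < length (path_arcs p)"
  shows "Um k p (path_arcs p ! Suc q) = Up k p (path_arcs p ! q)"
proof
  fix t
  define e where "e = path_arcs p ! Suc q"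
  have tr: "(k, p) \<in> in_transit N e" unfolding e_def by (rule Suc_in_transit[OF assms])
  have u: "(k, p) \<in> users N (path_arcs p ! q)" using assms by (simp add: users_iff)
  have "(\<lambda>n. Ums n k p e t) \<longlonglongrightarrow> Up k p (path_arcs p ! q) t"
    using Up_conv[OF u] by (simp add: e_def seq.Um_next[OF assms])
  then show "Um k p (path_arcs p ! Suc q) t = Up k p (path_arcs p ! q) t"
    using Um_conv[OF tr] LIMSEQ_unique by (auto simp: e_def)
qed

lemma Um_count:
  assumes u: "(k, p) \<in> users N e"
  shows "cumulative_count (subgroup_size U k p) (Um k p e)"
  using u
proof (rule user_or)
  assume d: "(k, p) \<in> departing N e"
  show ?thesis using U_props[OF departing_subgroups[OF d]]
    by (simp add: Um_first'[OF d] cumulative_count_def)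
next
  assume "(k, p) \<in> in_transit N e"
  then obtain q where q: "Suc q < length (path_arcs p)" "e = path_arcs p ! Suc q"
    "(k, p) \<in> users N (path_arcs p ! q)" "(k, p) \<in> subgroups N"
    by (rule user_prev)
  show ?thesis using Up_count[OF q(3)] by (simp add: q(2) Um_next'[OF q(4,1)])
qed

lemma Um_bounds:
  assumes "(k, p) \<in> users N e"
  shows "mono (Um k p e)" "0 \<le> Um k p e t" "Um k p e t \<le> subgroup_size U k p"
proof -
  show *: "mono (Um k p e)" and "Um k p e t \<le> subgroup_size U k p"
    using Um_count[OF assms] by (auto simp: cumulative_count_def)
  show "0 \<le> Um k p e t"
    using Um_count[OF assms] by (intro mono_tendsto_at_bot_lower[OF *]) (simp add: cumulative_count_def)
qed

lemma limit_admissible: "admissible N G U"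
proof -
  have zero: "departure_distribution (\<lambda>t. 0)"
    by (auto simp: departure_distribution_def mono_def)
  have sub: "(k, p) \<in> subgroups N \<longleftrightarrow> p \<in> group_paths N k" if "k \<in> groups N" for k p
    using that by (auto simp: subgroups_def)
  have U0: "U k p = (\<lambda>t. 0)" if "k \<in> groups N" "p \<notin> group_paths N k" for k p
    using that sub U_else by auto
  have "(\<Sum>p\<in>viable_paths N. subgroup_size U k p) = G k" if k: "k \<in> groups N" for k
  proof -
    have "(\<Sum>p\<in>viable_paths N. subgroup_size U k p) = (\<Sum>p\<in>group_paths N k. subgroup_size U k p)"
      by (rule sum.mono_neutral_right)
        (auto simp: finite_viable_paths group_paths_def subgroup_size_def tendsto_Lim
          U0[OF k, unfolded group_paths_def])
    also have "\<dots> = G k"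
    proof (rule LIMSEQ_unique)
      show "(\<lambda>n. \<Sum>p\<in>group_paths N k. subgroup_size (Us n) k p) \<longlonglongrightarrow> (\<Sum>p\<in>group_paths N k. subgroup_size U k p)"
        by (intro tendsto_sum size_conv) (simp add: sub[OF k])
      show "(\<lambda>n. \<Sum>p\<in>group_paths N k. subgroup_size (Us n) k p) \<longlonglongrightarrow> G k"
        by (simp add: seq.sum_sizes[OF k])
    qed
    finally show ?thesis .
  qed
  moreover have "departure_distribution (U k p)" if "k \<in> groups N" for k p
    using U_dist[of k p] U0[OF that] sub[OF that] zero by (cases "p \<in> group_paths N k") auto
  ultimately show ?thesis unfolding admissible_def using U0 by (auto simp: fun_eq_iff)
qed

lemma arc_size_conv: "(\<lambda>n. arc_size N (Us n) e) \<longlonglongrightarrow> arc_size N U e"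
  unfolding arc_size_def split_def
  by (intro tendsto_sum) (auto intro!: size_conv departing_subgroups)

lemma arc_depart_conv: "t \<notin> C \<Longrightarrow> (\<lambda>n. arc_depart N (Us n) e t) \<longlonglongrightarrow> arc_depart N U e t"
  unfolding arc_depart_def split_def
  by (intro tendsto_sum) (auto intro!: U_conv departing_subgroups)

lemma B_seq_conv:
  assumes d: "(k, p) \<in> departing N e" and x: "xs \<longlonglongrightarrow> x"
    and range: "\<And>n. xs n \<in> {0..arc_size N (Us (r n)) e}" and r: "strict_mono r"
  shows "(\<lambda>n. Bs (r n) k p (xs n)) \<longlonglongrightarrow> B k p x"
proof -
  note kp = departing_subgroups[OF d]
  have "(\<lambda>n. seq.Bx (r n) k p (xs n)) \<longlonglongrightarrow> B k p x"
    using LIMSEQ_subseq_LIMSEQ[OF B_conv[OF kp] r]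
    by (intro tendsto_equilipschitz[OF seq.Bx_mono[OF kp] seq.Bx_lipschitz[OF kp] _ x])
      (simp_all add: o_def)
  then show ?thesis using seq.Bx_eq[OF d range] by simp
qed

lemma limit_prioritizing: "prioritizing N U B"
  unfolding prioritizing_def
proof (intro allI impI conjI ballI)
  fix e assume e: "viable_arc N e"
  fix x assume x: "x \<in> {0..arc_size N U e}"
  show "(\<Sum>(k, p)\<in>departing N e. B k p x) = x"
  proof (rule LIMSEQ_unique)
    show "(\<lambda>n. \<Sum>y\<in>departing N e. seq.Bx n (fst y) (snd y) x) \<longlonglongrightarrow> (\<Sum>(k, p)\<in>departing N e. B k p x)"
      unfolding split_def by (intro tendsto_sum) (auto intro!: B_conv departing_subgroups)
    have "(\<lambda>n. max 0 (min (arc_size N (Us n) e) x)) \<longlonglongrightarrow> max 0 (min (arc_size N U e) x)"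
      by (intro tendsto_intros arc_size_conv)
    then show "(\<lambda>n. \<Sum>y\<in>departing N e. seq.Bx n (fst y) (snd y) x) \<longlonglongrightarrow> x"
      using x by (simp add: seq.sum_Bx[OF e])
  qed
next
  fix e y assume e: "viable_arc N e" and y: "y \<in> departing N e"
  obtain k p where kp: "y = (k, p)" by (cases y)
  have d: "(k, p) \<in> departing N e" using y kp by simp
  note sub = departing_subgroups[OF d]
  have "0 \<le> B k p x" "B k p x \<le> subgroup_size U k p" for x
    by (intro LIMSEQ_le_const[OF B_conv[OF sub]] LIMSEQ_le[OF B_conv[OF sub] size_conv[OF sub]];
        auto intro: seq.Bx_range[OF sub])+
  moreover have "mono (B k p)" by (rule mono_limit[OF seq.Bx_mono[OF sub] B_conv[OF sub]])
  moreover have "AE t in lborel. B k p (arc_depart N U e t) = U k p t"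
  proof -
    \<comment> \<open>One null set serves all n; outside it and outside C both sides
      converge.\<close>
    have "AE t in lborel. \<forall>n. Bs n k p (arc_depart N (Us n) e t) = Us n k p t"
      using seq.prio_props(3)[OF d] by (simp add: AE_all_countable)
    moreover have "AE t in lborel. t \<notin> C"
      by (rule AE_not_in) (rule countable_imp_null_set_lborel[OF C])
    ultimately show ?thesis
    proof eventually_elim
      case (elim t)
      have "(\<lambda>n. Bs n k p (arc_depart N (Us n) e t)) \<longlonglongrightarrow> B k p (arc_depart N U e t)"
        by (rule B_seq_conv[OF d arc_depart_conv[OF elim(2)], where r = "\<lambda>n. n"])
          (use seq.D_range in \<open>auto simp: strict_mono_def\<close>)
      then have "(\<lambda>n. Us n k p t) \<longlonglongrightarrow> B k p (arc_depart N U e t)" using elim(1) by simp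
      then show ?case using U_conv[OF sub elim(2)] LIMSEQ_unique by blast
    qed
  qed
  ultimately show "case y of (k, p) \<Rightarrow> B k p \<in> {0..arc_size N U e} \<rightarrow> {0..subgroup_size U k p} \<and>
           mono_on {0..arc_size N U e} (B k p) \<and>
           (AE t in lborel. B k p (arc_depart N U e t) = U k p t)"
    by (auto simp: kp intro: mono_on_subset)
qed

lemma total_entered_conv:
  "t \<notin> C \<Longrightarrow> (\<lambda>n. total_entered N (Ums n) e t) \<longlonglongrightarrow> total_entered N Um e t"
  unfolding total_entered_def split_def by (intro tendsto_sum) (auto intro!: Um_conv')

lemma total_entered_mono: "mono (total_entered N Um e)"
  unfolding total_entered_def split_def mono_def
  by (auto intro!: sum_mono monoD[OF Um_bounds(1)])

lemma total_exited_conv: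
  assumes "viable_arc N e"
  shows "(\<lambda>n. total_exited N (Ums n) e t) \<longlonglongrightarrow> total_exited N Um e t"
proof -
  have "total_entered N Um e t \<le> (\<Sum>x\<in>users N e. subgroup_size U (fst x) (snd x))" for t
    unfolding total_entered_def split_def
    by (auto intro!: sum_mono Um_bounds(3))
  moreover have "0 \<le> total_entered N Um e t" for t
    unfolding total_entered_def split_def by (auto intro!: sum_nonneg Um_bounds(2))
  ultimately show ?thesis
    unfolding total_exited_eq
    by (intro delay_kernel.outflow_limit[OF kernel_locale[OF assms] seq.E_mono seq.E_nonneg
          total_entered_mono _ _ C total_entered_conv])
qed

text \<open>The subsequence of enter times depends on e and t. This is harmless: the counts and
  priorities already converge along the full sequence, so the identities obtained always concern the
  same limits.\<close>

lemma limit_enter: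
  assumes e: "viable_arc N e"
  shows "\<exists>\<tau>. is_enter_time N Um e t \<tau> \<and>
        (\<forall>(k, p)\<in>in_transit N e. Up k p e t = Um k p e \<tau>) \<and>
        (\<forall>(k, p)\<in>departing N e.
           (let \<beta> = total_exited N Um e t - transit_entered N Um e \<tau>
            in \<beta> \<in> {0..arc_size N U e} \<and> Up k p e t = B k p \<beta>))"
proof -
  have "\<exists>\<tau>. t - lag e \<le> \<tau> \<and> \<tau> \<le> t \<and> (\<forall>s<\<tau>. seq.E n e s \<le> seq.X n e t) \<and>
      (\<forall>s>\<tau>. seq.X n e t \<le> seq.E n e s) \<and>
      (\<forall>k p. (k, p) \<in> in_transit N e \<longrightarrow> Ups n k p e t = Ums n k p e \<tau>) \<and>
      (\<forall>k p. (k, p) \<in> departing N e \<longrightarrow> seq.X n e t - seq.T n e \<tau> \<in> {0..arc_size N (Us n) e} \<and>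
        Ups n k p e t = Bs n k p (seq.X n e t - seq.T n e \<tau>))" for n
    by (rule seq.enter_window[OF e, of t n]) blast
  then obtain \<tau> where \<tau>: "\<And>n. t - lag e \<le> \<tau> n" "\<And>n. \<tau> n \<le> t"
      "\<And>n s. s < \<tau> n \<Longrightarrow> seq.E n e s \<le> seq.X n e t"
      "\<And>n s. \<tau> n < s \<Longrightarrow> seq.X n e t \<le> seq.E n e s"
      "\<And>n k p. (k, p) \<in> in_transit N e \<Longrightarrow> Ups n k p e t = Ums n k p e (\<tau> n)"
      "\<And>n k p. (k, p) \<in> departing N e \<Longrightarrow>
        seq.X n e t - seq.T n e (\<tau> n) \<in> {0..arc_size N (Us n) e} \<and>
        Ups n k p e t = Bs n k p (seq.X n e t - seq.T n e (\<tau> n))"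
    by metis
  have "\<forall>n. \<tau> n \<in> {t - lag e..t}" using \<tau>(1,2) by simp
  then obtain l r where r: "strict_mono r" and "(\<tau> \<circ> r) \<longlonglongrightarrow> l"
    using seq_compactE[OF compact_imp_seq_compact[OF compact_Icc]] by metis
  then have l: "(\<lambda>n. \<tau> (r n)) \<longlonglongrightarrow> l" by (simp add: o_def)
  note sub = LIMSEQ_subseq_LIMSEQ[OF _ r, unfolded o_def]
  note X = sub[OF total_exited_conv[OF e, of t]]
  have "total_entered N Um e s \<le> total_exited N Um e t" if "s < l" for s
  proof -
    \<comment> \<open>Entered totals converge only off C; the inequality is taken to the limit at s'
      and returned to s by monotonicity.\<close>
    obtain s' where s': "s < s'" "s' < l" "s' \<notin> C" using generic_between[OF \<open>s < l\<close>] by blast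
    have "total_entered N Um e s' \<le> total_exited N Um e t"
    proof (rule tendsto_le[OF _ X sub[OF total_entered_conv[OF s'(3)]]])
      show "\<forall>\<^sub>F n in sequentially. seq.E (r n) e s' \<le> seq.X (r n) e t"
        using order_tendstoD(1)[OF l s'(2)] by eventually_elim (rule \<tau>(3))
    qed simp
    then show ?thesis using monoD[OF total_entered_mono, of s s' e] s' by simp
  qed
  moreover have "total_exited N Um e t \<le> total_entered N Um e s" if "l < s" for s
  proof -
    obtain s' where s': "l < s'" "s' < s" "s' \<notin> C" using generic_between[OF \<open>l < s\<close>] by blast
    have "total_exited N Um e t \<le> total_entered N Um e s'"
    proof (rule tendsto_le[OF _ sub[OF total_entered_conv[OF s'(3)]] X])
      show "\<forall>\<^sub>F n in sequentially. seq.X (r n) e t \<le> seq.E (r n) e s'"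
        using order_tendstoD(2)[OF l s'(1)] by eventually_elim (rule \<tau>(4))
    qed simp
    then show ?thesis using monoD[OF total_entered_mono, of s' s e] s' by simp
  qed
  ultimately have enter: "is_enter_time N Um e t l"
    unfolding is_enter_time_def
    by (simp add: Lim_at_left_le_iff total_entered_mono le_Lim_at_right_iff)
  \<comment> \<open>Transit entries share a Lipschitz constant, so they may be evaluated at the
    moving times \<open>\<tau> (r n)\<close>.\<close>
  have Um_l: "(\<lambda>n. Ums (r n) k p e (\<tau> (r n))) \<longlonglongrightarrow> Um k p e l" if tr: "(k, p) \<in> in_transit N e" for k p
    by (rule tendsto_equilipschitz[OF seq.Um_props(1)[OF transit_users[OF tr]]
          seq.Um_rate[OF tr] sub[OF Um_conv[OF tr]] l])
  have "Up k p e t = Um k p e l" if tr: "(k, p) \<in> in_transit N e" for k p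
    using LIMSEQ_unique[OF sub[OF Up_conv[OF transit_users[OF tr]]], of t] Um_l[OF tr]
    by (simp only: \<tau>(5)[OF tr])
  moreover have "total_exited N Um e t - transit_entered N Um e l \<in> {0..arc_size N U e} \<and>
      Up k p e t = B k p (total_exited N Um e t - transit_entered N Um e l)"
    if d: "(k, p) \<in> departing N e" for k p
  proof -
    define \<beta> where "\<beta> n = seq.X (r n) e t - seq.T (r n) e (\<tau> (r n))" for n
    have "(\<lambda>n. seq.T (r n) e (\<tau> (r n))) \<longlonglongrightarrow> transit_entered N Um e l"
      unfolding transit_entered_def split_def by (intro tendsto_sum) (auto intro!: Um_l)
    then have \<beta>: "\<beta> \<longlonglongrightarrow> total_exited N Um e t - transit_entered N Um e l"
      unfolding \<beta>_def by (intro tendsto_diff X)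
    have range: "\<beta> n \<in> {0..arc_size N (Us (r n)) e}" for n using \<tau>(6)[OF d] by (simp add: \<beta>_def)
    have "0 \<le> total_exited N Um e t - transit_entered N Um e l"
      using range by (intro LIMSEQ_le_const[OF \<beta>]) auto
    moreover have "total_exited N Um e t - transit_entered N Um e l \<le> arc_size N U e"
      using range by (intro LIMSEQ_le[OF \<beta> sub[OF arc_size_conv]]) auto
    moreover have lim: "(\<lambda>n. Ups (r n) k p e t) \<longlonglongrightarrow> B k p (total_exited N Um e t - transit_entered N Um e l)"
      using B_seq_conv[OF d \<beta> range r] \<tau>(6)[OF d] by (simp add: \<beta>_def)
    moreover have "Up k p e t = B k p (total_exited N Um e t - transit_entered N Um e l)"
      using LIMSEQ_unique[OF sub[OF Up_conv[OF departing_users[OF d]]] lim] .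
    ultimately show ?thesis by simp
  qed
  ultimately show ?thesis using enter by (intro exI[of _ l]) (auto simp: Let_def)
qed

lemma limit_solution: "solution N G U B Um Up"
  unfolding solution_def
proof (intro conjI limit_admissible limit_prioritizing)
  define Q where "Q e t \<tau> \<longleftrightarrow> is_enter_time N Um e t \<tau> \<and>
        (\<forall>(k, p)\<in>in_transit N e. Up k p e t = Um k p e \<tau>) \<and>
        (\<forall>(k, p)\<in>departing N e.
           (let \<beta> = total_exited N Um e t - transit_entered N Um e \<tau>
            in \<beta> \<in> {0..arc_size N U e} \<and> Up k p e t = B k p \<beta>))" for e t \<tau>
  have "viable_arc N e \<longrightarrow> Q e t (SOME \<tau>. Q e t \<tau>)" for e t
    using someI_ex[of "Q e t"] limit_enter[of e t] unfolding Q_def by blast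
  then have "\<exists>\<tau>enter. \<forall>e t. viable_arc N e \<longrightarrow> Q e t (\<tau>enter e t)"
    by (intro exI[of _ "\<lambda>e t. SOME \<tau>. Q e t \<tau>"]) simp
  moreover have "(\<forall>e\<in>set (path_arcs p).
           cumulative_count (subgroup_size U k p) (Um k p e) \<and>
           cumulative_count (subgroup_size U k p) (Up k p e)) \<and>
        Um k p (hd (path_arcs p)) = U k p \<and>
        (\<forall>q. Suc q < length (path_arcs p) \<longrightarrow>
           Um k p (path_arcs p ! Suc q) = Up k p (path_arcs p ! q))"
    if "(k, p) \<in> subgroups N" for k p
    using that Um_count[of k p] Up_count[of k p] Um_first'[OF departing_hd[OF that]] Um_next'[OF that]
    by (simp add: users_iff)
  ultimately show "traffic_flow N U B Um Up" unfolding traffic_flow_def Q_def by blast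
qed

end

section \<open>Lower semicontinuity and compactness\<close>

lemma ennreal_le_of_less:
  assumes "\<And>\<epsilon>. 0 < \<epsilon> \<Longrightarrow> ennreal (x - \<epsilon>) \<le> L"
  shows "ennreal x \<le> L"
proof (rule tendsto_upperbound)
  show "((\<lambda>\<epsilon>. ennreal (x - \<epsilon>)) \<longlongrightarrow> ennreal x) (at_right 0)"
    by (rule tendsto_ennrealI) (auto intro!: tendsto_eq_intros)
  show "\<forall>\<^sub>F \<epsilon> in at_right 0. ennreal (x - \<epsilon>) \<le> L"
    by (rule eventually_mono[OF eventually_at_right_less]) (rule assms)
qed simp

text \<open>Fatou's lemma for a counting measure.\<close>

lemma sum_liminf_le:
  fixes u :: "nat \<Rightarrow> 'a \<Rightarrow> ennreal"
  assumes "finite A"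
  shows "(\<Sum>x\<in>A. liminf (\<lambda>n. u n x)) \<le> liminf (\<lambda>n. \<Sum>x\<in>A. u n x)"
  using nn_integral_liminf[of u "count_space A"] by (simp add: nn_integral_count_space_finite assms)

text \<open>Passing from f(x) to -f(-x) exchanges left and right continuity and keeps monotonicity,
  so \<open>Helly_selection\<close> applies.\<close>

lemma Helly_selection_left:
  fixes f :: "nat \<Rightarrow> real \<Rightarrow> real"
  assumes lcont: "\<And>n x. continuous (at_left x) (f n)" and mono: "\<And>n. mono (f n)"
    and bdd: "\<And>n x. \<bar>f n x\<bar> \<le> M"
  shows "\<exists>s F. strict_mono (s :: nat \<Rightarrow> nat) \<and> (\<forall>x. continuous (at_left x) F) \<and> mono F \<and>
    (\<forall>x. \<bar>F x\<bar> \<le> M) \<and> (\<forall>x. isCont F x \<longrightarrow> (\<lambda>n. f (s n) x) \<longlonglongrightarrow> F x)"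
proof -
  have "\<exists>s. strict_mono (s :: nat \<Rightarrow> nat) \<and> (\<exists>F. (\<forall>x. continuous (at_right x) F) \<and> mono F \<and>
    (\<forall>x. \<bar>F x\<bar> \<le> M) \<and> (\<forall>x. continuous (at x) F \<longrightarrow> (\<lambda>n. - f (s n) (- x)) \<longlonglongrightarrow> F x))"
  proof (rule Helly_selection)
    fix n x
    have "((f n) \<longlongrightarrow> f n (- x)) (at_left (- x))" using lcont[of "- x" n]
      by (simp add: continuous_within)
    then have "((\<lambda>x. f n (- x)) \<longlongrightarrow> f n (- x)) (at_right x)"
      by (subst (asm) filterlim_at_left_to_right) simp
    then show "continuous (at_right x) (\<lambda>x. - f n (- x))"
      by (simp add: continuous_within tendsto_minus)
    show "\<bar>- f n (- x)\<bar> \<le> M" using bdd by simp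
  qed (auto simp: mono_def intro: monoD[OF mono])
  then obtain s F where s: "strict_mono (s :: nat \<Rightarrow> nat)" and F: "\<And>x. continuous (at_right x) F"
    "mono F" "\<And>x. \<bar>F x\<bar> \<le> M" "\<And>x. isCont F x \<Longrightarrow> (\<lambda>n. - f (s n) (- x)) \<longlonglongrightarrow> F x"
    by blast
  define H where "H x = - F (- x)" for x
  have FH: "F = (\<lambda>x. - H (- x))" by (simp add: H_def)
  have "continuous (at_left x) H" for x
  proof -
    have "(F \<longlongrightarrow> F (- x)) (at_right (- x))" using F(1)[of "- x"] by (simp add: continuous_within)
    then have "((\<lambda>x. F (- x)) \<longlongrightarrow> F (- x)) (at_left x)"
      by (subst filterlim_at_left_to_right) simp
    then show ?thesis by (simp add: continuous_within H_def[abs_def] tendsto_minus)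
  qed
  moreover have "mono H" using F(2) by (auto simp: mono_def H_def)
  moreover have "\<bar>H x\<bar> \<le> M" for x using F(3) by (simp add: H_def)
  moreover have "(\<lambda>n. f (s n) x) \<longlonglongrightarrow> H x" if "isCont H x" for x
  proof -
    have "isCont (\<lambda>x. - H (- x)) (- x)"
      by (intro continuous_intros isCont_o2[of "- x" uminus H]) (use that in auto)
    then have "isCont F (- x)" by (simp only: FH)
    from tendsto_minus[OF F(4)[OF this]] show ?thesis by (simp add: H_def)
  qed
  ultimately show ?thesis using s by blast
qed

lemma Helly_selection_family:
  fixes f :: "'i \<Rightarrow> nat \<Rightarrow> real \<Rightarrow> real"
  assumes "finite I"
    and lcont: "\<And>i n x. i \<in> I \<Longrightarrow> continuous (at_left x) (f i n)"
    and mono: "\<And>i n. i \<in> I \<Longrightarrow> mono (f i n)" and bdd: "\<And>i n x. i \<in> I \<Longrightarrow> \<bar>f i n x\<bar> \<le> M"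
  shows "\<exists>s F. strict_mono (s :: nat \<Rightarrow> nat) \<and> (\<forall>i\<in>I. (\<forall>x. continuous (at_left x) (F i)) \<and>
    mono (F i) \<and> (\<forall>x. \<bar>F i x\<bar> \<le> M) \<and> (\<forall>x. isCont (F i) x \<longrightarrow> (\<lambda>n. f i (s n) x) \<longlonglongrightarrow> F i x))"
  using assms
proof (induction I)
  case empty
  show ?case
    by (rule exI[of _ "\<lambda>n. n"], rule exI[of _ "\<lambda>_ _. 0"]) (simp add: strict_mono_def)
next
  case (insert j I)
  have "\<exists>s F. strict_mono (s :: nat \<Rightarrow> nat) \<and> (\<forall>i\<in>I. (\<forall>x. continuous (at_left x) (F i)) \<and>
    mono (F i) \<and> (\<forall>x. \<bar>F i x\<bar> \<le> M) \<and> (\<forall>x. isCont (F i) x \<longrightarrow> (\<lambda>n. f i (s n) x) \<longlonglongrightarrow> F i x))"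
    by (rule insert.IH) (use insert.prems in auto)
  then obtain s F where s: "strict_mono (s :: nat \<Rightarrow> nat)" and
    F: "\<And>i. i \<in> I \<Longrightarrow> (\<forall>x. continuous (at_left x) (F i)) \<and> mono (F i) \<and> (\<forall>x. \<bar>F i x\<bar> \<le> M) \<and>
      (\<forall>x. isCont (F i) x \<longrightarrow> (\<lambda>n. f i (s n) x) \<longlonglongrightarrow> F i x)"
    by blast
  obtain s' H where s': "strict_mono (s' :: nat \<Rightarrow> nat)" and
    H: "(\<forall>x. continuous (at_left x) H) \<and> mono H \<and> (\<forall>x. \<bar>H x\<bar> \<le> M) \<and>
      (\<forall>x. isCont H x \<longrightarrow> (\<lambda>n. f j (s (s' n)) x) \<longlonglongrightarrow> H x)"
    using Helly_selection_left[of "\<lambda>n. f j (s n)" M] insert.prems by blast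
  have "(\<lambda>n. f i (s (s' n)) x) \<longlonglongrightarrow> F i x" if "i \<in> I" "isCont (F i) x" for i x
    using LIMSEQ_subseq_LIMSEQ[OF _ s', of "\<lambda>n. f i (s n) x" "F i x"] F[OF that(1)] that(2)
    by (simp add: o_def)
  then have "\<forall>i\<in>insert j I. (\<forall>x. continuous (at_left x) ((F(j := H)) i)) \<and> mono ((F(j := H)) i) \<and>
      (\<forall>x. \<bar>(F(j := H)) i x\<bar> \<le> M) \<and>
      (\<forall>x. isCont ((F(j := H)) i) x \<longrightarrow> (\<lambda>n. f i ((s \<circ> s') n) x) \<longlonglongrightarrow> (F(j := H)) i x)"
    using F H by simp
  then show ?case using strict_mono_o[OF s s'] by blast
qed

text \<open>Convergence is given at continuity points of g. Comparing values at such points shows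
  that g inherits the Lipschitz bound; so g is continuous everywhere and the convergence holds
  everywhere.\<close>

lemma lipschitz_limit:
  fixes f :: "nat \<Rightarrow> real \<Rightarrow> real"
  assumes lip: "\<And>n x y. x \<le> y \<Longrightarrow> f n y \<le> f n x + F * (y - x)"
    and g: "mono g" "\<And>x. continuous (at_left x) g"
    and conv: "\<And>x. isCont g x \<Longrightarrow> (\<lambda>n. f n x) \<longlonglongrightarrow> g x" and "0 \<le> F"
  shows "(\<lambda>n. f n x) \<longlonglongrightarrow> g x"
proof -
  have cnt: "countable {x. \<not> isCont g x}" using mono_ctble_discont[OF g(1)] .
  have gen: "\<exists>z. a < z \<and> z < b \<and> isCont g z" if "a < b" for a b
    using open_minus_countable[OF cnt, of "{a<..<b}"] that by auto
  have lip_g: "g y \<le> g x + F * (y - x)" if "x \<le> y" for x y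
  proof (cases "x = y")
    case False
    then have xy: "x < y" using that by simp
    \<comment> \<open>A continuity point x' slightly to the left of x costs at most F \<epsilon>; y'
      is brought up to y afterwards by left continuity.\<close>
    have key: "g y' \<le> g x + F * (y - x + \<epsilon>)" if y': "x < y'" "y' < y" "isCont g y'" and \<epsilon>: "0 < \<epsilon>" for y' \<epsilon>
    proof -
      obtain x' where x': "x - \<epsilon> < x'" "x' < x" "isCont g x'" using gen[of "x - \<epsilon>" x] \<epsilon> by auto
      have "g y' \<le> g x' + F * (y' - x')"
      proof (rule LIMSEQ_le[OF conv[OF y'(3)]])
        show "(\<lambda>n. f n x' + F * (y' - x')) \<longlonglongrightarrow> g x' + F * (y' - x')"
          by (intro tendsto_intros conv x'(3))
        show "\<exists>N. \<forall>n\<ge>N. f n y' \<le> f n x' + F * (y' - x')" using x' y' lip by auto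
      qed
      also have "g x' \<le> g x" using x' by (intro monoD[OF g(1)]) simp
      also have "F * (y' - x') \<le> F * (y - x + \<epsilon>)" using \<open>0 \<le> F\<close> x' y' by (intro mult_left_mono) auto
      finally show ?thesis by simp
    qed
    have "g y \<le> g x + F * (y - x + \<epsilon>)" if \<epsilon>: "0 < \<epsilon>" for \<epsilon>
    proof (rule tendsto_upperbound)
      show "(g \<longlongrightarrow> g y) (at_left y)" using g(2)[of y] by (simp add: continuous_within)
      have "g z \<le> g x + F * (y - x + \<epsilon>)" if "x < z" "z < y" for z
      proof -
        obtain y' where "z < y'" "y' < y" "isCont g y'" using gen[OF \<open>z < y\<close>] by blast
        then show ?thesis using key[of y' \<epsilon>] \<epsilon> that monoD[OF g(1), of z y'] by simp
      qed
      then show "\<forall>\<^sub>F z in at_left y. g z \<le> g x + F * (y - x + \<epsilon>)"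
        unfolding eventually_at_left[OF xy] using xy by blast
    qed simp
    then have "\<forall>\<^sub>F \<epsilon> in at_right 0. g y \<le> g x + F * (y - x + \<epsilon>)"
      by (intro eventually_mono[OF eventually_at_right_less])
    moreover have "((\<lambda>\<epsilon>. g x + F * (y - x + \<epsilon>)) \<longlongrightarrow> g x + F * (y - x)) (at_right 0)"
      by (auto intro!: tendsto_eq_intros)
    ultimately show ?thesis by (intro tendsto_lowerbound) auto
  qed simp
  have "continuous_on UNIV g" by (rule continuous_lipschitz_mono[OF g(1) lip_g])
  then show ?thesis by (intro conv) (simp add: continuous_on_eq_continuous_at)
qed

sublocale flow_limit \<subseteq> lim: flow N G U B Um Up
  by unfold_locales (rule limit_solution)

context flow_limit
begin

text \<open>Since phi decreases and psi increases, bounding the cost below takes an upper bound t1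
  for departure times and a lower bound t2 for arrival times. The first uses continuity of the limit
  departure time at \<beta>; the second follows from the limit arrival count being below \<beta> at
  t2.\<close>

lemma driver_cost_liminf:
  assumes kp: "(k, p) \<in> subgroups N" and \<beta>: "0 < \<beta>" "\<beta> < lim.sz k p" and cont: "isCont (lim.td k p) \<beta>"
    and \<epsilon>: "0 < \<epsilon>"
  shows "\<forall>\<^sub>F n in sequentially.
    ennreal (dep_cost N k (lim.td k p \<beta>) + arr_cost N k (lim.ta k p \<beta>) + shift k - \<epsilon>)
      \<le> shifted_cost (Us n) (Ups n) k p \<beta>"
proof -
  have k: "k \<in> groups N" using subgroupD(1)[OF kp] .
  have "\<forall>\<^sub>F t in at_right (lim.td k p \<beta>). dep_cost N k (lim.td k p \<beta>) - \<epsilon> / 2 < dep_cost N k t"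
    using cost_isCont(1)[OF k, of "lim.td k p \<beta>"] \<epsilon>
    by (intro order_tendstoD(1)[of "dep_cost N k" "dep_cost N k (lim.td k p \<beta>)"])
      (auto simp: isCont_def filterlim_at_split)
  moreover have "\<forall>\<^sub>F t in at_right (lim.td k p \<beta>). lim.td k p \<beta> < t"
    by (rule eventually_at_right_less)
  ultimately obtain t1 where t1: "lim.td k p \<beta> < t1"
      "dep_cost N k (lim.td k p \<beta>) - \<epsilon> / 2 < dep_cost N k t1"
    by (metis (mono_tags, lifting) eventually_conj eventually_happens trivial_limit_at_right_real)
  have "\<forall>\<^sub>F t in at_left (lim.ta k p \<beta>). arr_cost N k (lim.ta k p \<beta>) - \<epsilon> / 2 < arr_cost N k t"
    using cost_isCont(2)[OF k, of "lim.ta k p \<beta>"] \<epsilon>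
    by (intro order_tendstoD(1)[of "arr_cost N k" "arr_cost N k (lim.ta k p \<beta>)"])
      (auto simp: isCont_def filterlim_at_split)
  moreover have "\<forall>\<^sub>F t in at_left (lim.ta k p \<beta>). t < lim.ta k p \<beta>"
    by (simp add: eventually_at_filter)
  ultimately obtain t2 where t2: "t2 < lim.ta k p \<beta>"
      "arr_cost N k (lim.ta k p \<beta>) - \<epsilon> / 2 < arr_cost N k t2"
    by (metis (mono_tags, lifting) eventually_conj eventually_happens trivial_limit_at_left_real)
  obtain t1' where t1': "lim.td k p \<beta> < t1'" "t1' < t1" "t1' \<notin> C" using generic_between[OF t1(1)]
    by blast
  \<comment> \<open>By continuity some \<beta>' > \<beta> also departs before t1', so the inequality
    is strict and survives the passage back to Us n.\<close>
  have "\<beta> < U k p t1'"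
  proof -
    have "\<forall>\<^sub>F \<beta>' in at_right \<beta>. lim.td k p \<beta>' < t1'"
      using cont t1'(1) by (intro order_tendstoD(2)[of "lim.td k p" "lim.td k p \<beta>"])
        (auto simp: isCont_def filterlim_at_split)
    moreover have "\<forall>\<^sub>F \<beta>' in at_right \<beta>. \<beta> < \<beta>' \<and> \<beta>' < lim.sz k p"
      using eventually_at_right_field \<beta>(2) by blast
    ultimately obtain \<beta>' where "lim.td k p \<beta>' < t1'" "\<beta> < \<beta>'" "\<beta>' < lim.sz k p"
      by (metis (mono_tags, lifting) eventually_conj eventually_happens trivial_limit_at_right_real)
    then show ?thesis using lim.td_props(3)[OF kp, of \<beta>' t1'] \<beta>(1) by simp
  qed
  then have "\<forall>\<^sub>F n in sequentially. \<beta> < Us n k p t1'"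
    by (rule order_tendstoD(1)[OF U_conv[OF kp t1'(3)]])
  moreover have "Up k p (last (path_arcs p)) t2 < \<beta>"
    using lim.ta_props(1)[OF kp \<beta>, of t2] t2(1) by linarith
  then have "\<forall>\<^sub>F n in sequentially. Ups n k p (last (path_arcs p)) t2 < \<beta>"
    by (rule order_tendstoD(2)[OF Up_conv[OF seq.last_users[OF kp]]])
  moreover have "\<forall>\<^sub>F n in sequentially. \<beta> < seq.sz n k p"
    by (rule order_tendstoD(1)[OF size_conv[OF kp] \<beta>(2)])
  ultimately show ?thesis
  proof eventually_elim
    case (elim n)
    have "seq.td n k p \<beta> \<le> t1" using seq.td_props(1)[OF kp \<beta>(1) elim(3), of t1'] elim(1) t1'(2)
      by simp
    then have "dep_cost N k t1 \<le> dep_cost N k (seq.td n k p \<beta>)" by (rule cost_monotone(1)[OF k])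
    moreover have "t2 \<le> seq.ta n k p \<beta>" using seq.ta_props(2)[OF kp \<beta>(1) elim(3) elim(2)] .
    then have "arr_cost N k t2 \<le> arr_cost N k (seq.ta n k p \<beta>)" by (rule cost_monotone(2)[OF k])
    ultimately show ?case
      using t1(2) t2(2) \<beta>(1) elim(3) by (auto simp: shifted_cost_def intro!: ennreal_leI)
  qed
qed

lemma shifted_total_liminf: "shifted_total U Up \<le> liminf (\<lambda>n. shifted_total (Us n) (Ups n))"
proof -
  have "(\<integral>\<^sup>+\<beta>. shifted_cost U Up k p \<beta> \<partial>lborel)
      \<le> liminf (\<lambda>n. \<integral>\<^sup>+\<beta>. shifted_cost (Us n) (Ups n) k p \<beta> \<partial>lborel)"
    if kp: "(k, p) \<in> subgroups N" for k p
  proof -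
    have "countable {\<beta> \<in> {0<..<lim.sz k p}. \<not> isCont (lim.td k p) \<beta>}"
      by (rule mono_on_ctble_discont_open, simp, rule mono_onI, rule lim.td_mono[OF kp]) simp_all
    then have "AE \<beta> in lborel. \<beta> \<notin> {\<beta> \<in> {0<..<lim.sz k p}. \<not> isCont (lim.td k p) \<beta>}"
      by (intro AE_not_in countable_imp_null_set_lborel)
    then have "AE \<beta> in lborel. shifted_cost U Up k p \<beta> \<le> liminf (\<lambda>n. shifted_cost (Us n) (Ups n) k p \<beta>)"
    proof eventually_elim
      case (elim \<beta>)
      show ?case
      proof (cases "0 < \<beta> \<and> \<beta> < lim.sz k p")
        case True
        then have \<beta>: "0 < \<beta>" "\<beta> < lim.sz k p" "isCont (lim.td k p) \<beta>" using elim by auto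
        have "ennreal (dep_cost N k (lim.td k p \<beta>) + arr_cost N k (lim.ta k p \<beta>) + shift k)
            \<le> liminf (\<lambda>n. shifted_cost (Us n) (Ups n) k p \<beta>)"
          by (rule ennreal_le_of_less) (rule Liminf_bounded, rule driver_cost_liminf[OF kp \<beta>])
        then show ?thesis using True by (simp add: shifted_cost_def)
      qed (auto simp: shifted_cost_def)
    qed
    then have "(\<integral>\<^sup>+\<beta>. shifted_cost U Up k p \<beta> \<partial>lborel)
        \<le> (\<integral>\<^sup>+\<beta>. liminf (\<lambda>n. shifted_cost (Us n) (Ups n) k p \<beta>) \<partial>lborel)"
      by (rule nn_integral_mono_AE)
    also have "\<dots> \<le> liminf (\<lambda>n. \<integral>\<^sup>+\<beta>. shifted_cost (Us n) (Ups n) k p \<beta> \<partial>lborel)"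
      by (rule nn_integral_liminf) (rule seq.shifted_cost_measurable[OF kp])
    finally show ?thesis .
  qed
  then have "shifted_total U Up
      \<le> (\<Sum>x\<in>subgroups N. liminf (\<lambda>n. \<integral>\<^sup>+\<beta>. shifted_cost (Us n) (Ups n) (fst x) (snd x) \<beta> \<partial>lborel))"
    unfolding shifted_total_def by (intro sum_mono) auto
  also have "\<dots> \<le> liminf (\<lambda>n. shifted_total (Us n) (Ups n))"
    unfolding shifted_total_def by (rule sum_liminf_le) simp
  finally show ?thesis .
qed

end

section \<open>Compactness of sequences of bounded cost\<close>

locale flow_sequence = network +
  fixes Us Bs :: "nat \<Rightarrow> nat \<Rightarrow> path \<Rightarrow> real \<Rightarrow> real"
    and Ums Ups :: "nat \<Rightarrow> nat \<Rightarrow> path \<Rightarrow> arc \<Rightarrow> real \<Rightarrow> real" and K :: real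
  assumes sols: "\<And>n. solution N G (Us n) (Bs n) (Ums n) (Ups n)"
    and K: "0 \<le> K" "\<And>n. shifted_total (Us n) (Ups n) \<le> ennreal K"

sublocale flow_sequence \<subseteq> seq: flow N G "Us n" "Bs n" "Ums n" "Ups n" for n
  by unfold_locales (rule sols)

context flow_sequence
begin

lemma size_le: "(k, p) \<in> subgroups N \<Longrightarrow> seq.sz n k p \<le> sum G (groups N)"
  using member_le_sum[of "(k, p)" "subgroups N" "\<lambda>x. seq.sz n (fst x) (snd x)"]
  by (auto simp: seq.sum_subgroups seq.departure_props(7))

lemma rate_nonneg: "0 \<le> rate"
  unfolding rate_def by (intro sum_nonneg) (auto intro: less_imp_le flux_max_pos)

lemma tight_uniform:
  assumes kp: "(k, p) \<in> subgroups N" and \<epsilon>: "0 < \<epsilon>"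
  obtains R where "0 < R" "\<And>n. Us n k p (- R) < \<epsilon>" "\<And>n. seq.sz n k p - Us n k p R < \<epsilon>"
proof -
  \<comment> \<open>Chosen so that y x \<le> K forces x < \<epsilon>. The resulting R depends on y
    and the group alone, hence is the same for all n.\<close>
  define y where "y = (K + 1) / \<epsilon>"
  have y: "0 < y" "K < y * \<epsilon>" using K(1) \<epsilon> by (auto simp: y_def)
  obtain R where R: "0 < R" "\<And>t. R \<le> \<bar>t\<bar> \<Longrightarrow> y \<le> dep_cost N k t + arr_cost N k t"
    using cost_coercive[OF subgroupD(1)[OF kp], of y] by blast
  have less: "x < \<epsilon>" if "y * x \<le> K" for x
  proof -
    have "y * x < y * \<epsilon>" using that y(2) by simp
    then show ?thesis using y(1) by simp
  qed
  show thesis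
    using that[of R] R seq.tight[OF kp K(2) K(1) less_imp_le[OF y(1)] R(2) R(1)] less by blast
qed

lemma limit_exists:
  "\<exists>s U B Um Up C. strict_mono (s :: nat \<Rightarrow> nat) \<and>
    flow_limit N G (\<lambda>n. Us (s n)) (\<lambda>n. Bs (s n)) (\<lambda>n. Ums (s n)) (\<lambda>n. Ups (s n)) U B Um Up C"
proof -
  define M where "M = sum G (groups N)"
  \<comment> \<open>One selection serves five kinds of functions: 0 departures, 1 exits, 2 extended
    priorities, 3 sizes as constant functions, 4 entries. Kinds 0, 2 and 3 do not vary with e; the
    copy at the first arc is read off later.\<close>
  define I where "I = {..<5::nat} \<times> {((k, p), e). (k, p) \<in> users N e}"
  have "finite {((k, p), e). (k, p) \<in> users N e}"
    by (rule finite_subset[of _ "subgroups N \<times> (\<Union>(k, p)\<in>subgroups N. set (path_arcs p))"])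
      (force simp: users_iff)+
  then have finI: "finite I" by (simp add: I_def)
  define f where "f = (\<lambda>(i::nat, (k, p), e) n.
    if i = 0 then Us n k p else if i = 1 then Ups n k p e else if i = 2 then seq.Bx n k p
    else if i = 3 then (\<lambda>_. seq.sz n k p)
    else if (k, p) \<in> in_transit N e then Ums n k p e else Ups n k p e)"
  have cont_left: "continuous (at_left x) g" if "continuous_on UNIV g" for g :: "real \<Rightarrow> real" and x
    using that by (simp add: continuous_on_eq_continuous_at continuous_at_imp_continuous_within)
  have Bx_cont: "continuous_on UNIV (seq.Bx n k p)" if "(k, p) \<in> subgroups N" for n k p
    by (rule continuous_lipschitz_mono[OF seq.Bx_mono[OF that] seq.Bx_lipschitz[OF that]])
  have f_props: "continuous (at_left x) (f i n)" "mono (f i n)" "\<bar>f i n x\<bar> \<le> M" if iI: "i \<in> I" for i n x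
  proof -
    obtain j k p e where i: "i = (j, (k, p), e)" and j: "j < 5" and u: "(k, p) \<in> users N e"
      using iI by (auto simp: I_def)
    have kp: "(k, p) \<in> subgroups N" using u by (simp add: users_iff)
    show "continuous (at_left x) (f i n)"
      using seq.departure_props(2)[OF kp] seq.Up_cont[OF u] seq.Um_cont[of k p e] Bx_cont[OF kp]
      by (auto simp: f_def i intro!: cont_left)
    show "mono (f i n)"
      using seq.departure_props(1)[OF kp] seq.Up_props(1)[OF u] seq.Um_props(1)[OF u] seq.Bx_mono[OF kp]
      by (auto simp: f_def i mono_def)
    have "0 \<le> f i n x \<and> f i n x \<le> seq.sz n k p"
      using seq.departure_props(5,6,7)[OF kp] seq.Up_props(2,3)[OF u] seq.Um_props(2,3)[OF u] seq.Bx_range[OF kp]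
      by (auto simp: f_def i)
    then show "\<bar>f i n x\<bar> \<le> M" using size_le[OF kp, of n] by (simp add: M_def)
  qed
  have "\<exists>s g. strict_mono (s :: nat \<Rightarrow> nat) \<and> (\<forall>i\<in>I. (\<forall>x. continuous (at_left x) (g i)) \<and>
      mono (g i) \<and> (\<forall>x. \<bar>g i x\<bar> \<le> M) \<and> (\<forall>x. isCont (g i) x \<longrightarrow> (\<lambda>n. f i (s n) x) \<longlonglongrightarrow> g i x))"
    by (rule Helly_selection_family[OF finI]) (erule f_props)+
  then obtain s g where s: "strict_mono (s :: nat \<Rightarrow> nat)" and
    gg: "\<forall>i\<in>I. (\<forall>x. continuous (at_left x) (g i)) \<and> mono (g i) \<and> (\<forall>x. \<bar>g i x\<bar> \<le> M) \<and>
      (\<forall>x. isCont (g i) x \<longrightarrow> (\<lambda>n. f i (s n) x) \<longlonglongrightarrow> g i x)"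
    by (elim exE conjE) iprover
  have g: "\<And>i x. i \<in> I \<Longrightarrow> continuous (at_left x) (g i)" "\<And>i. i \<in> I \<Longrightarrow> mono (g i)"
      "\<And>i x. i \<in> I \<Longrightarrow> \<bar>g i x\<bar> \<le> M"
      "\<And>i x. i \<in> I \<Longrightarrow> isCont (g i) x \<Longrightarrow> (\<lambda>n. f i (s n) x) \<longlonglongrightarrow> g i x"
    by (simp_all add: gg)
  define C where "C = (\<Union>i\<in>I. {x. \<not> isCont (g i) x})"
  have C: "countable C"
    unfolding C_def using finI g(2)
      by (intro countable_UN mono_ctble_discont) (auto simp: countable_finite)
  have gC: "(\<lambda>n. f i (s n) x) \<longlonglongrightarrow> g i x" if "i \<in> I" "x \<notin> C" for i x
    using g(4)[OF that(1)] that by (auto simp: C_def)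
  have gen: "\<exists>z. a < z \<and> z < b \<and> z \<notin> C" if "a < b" for a b
    using open_minus_countable[OF C, of "{a<..<b}"] that by auto
  have II: "(j, (k, p), e) \<in> I" if "j < 5" "(k, p) \<in> users N e" for j k p e
    using that by (simp add: I_def)
  have hd: "(k, p) \<in> users N (hd (path_arcs p))" if "(k, p) \<in> subgroups N" for k p
    using departing_hd[OF that] by (rule departing_users)
  define U where "U k p = (if (k, p) \<in> subgroups N then g (0, (k, p), hd (path_arcs p)) else (\<lambda>_. 0))" for k p
  define Up where "Up k p e = g (1, (k, p), e)" for k p e
  define B where "B k p = g (2, (k, p), hd (path_arcs p))" for k p
  define Um where "Um k p e = (if e = hd (path_arcs p) then U k p else g (4, (k, p), e))" for k p e
  have U_conv: "(\<lambda>n. Us (s n) k p t) \<longlonglongrightarrow> U k p t" if "(k, p) \<in> subgroups N" "t \<notin> C" for k p t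
    using gC[OF II[of 0, OF _ hd[OF that(1)]] that(2)] that(1) by (simp add: f_def U_def)
  have U_mono: "mono (U k p)" and U_left: "continuous (at_left t) (U k p)" and U_bdd: "\<bar>U k p t\<bar> \<le> M"
    if "(k, p) \<in> subgroups N" for k p t
    using g(1-3)[OF II[of 0, OF _ hd[OF that]]] that by (auto simp: U_def)
  have U_nonneg: "0 \<le> U k p t" if kp: "(k, p) \<in> subgroups N" for k p t
  proof -
    obtain t' where t': "t - 1 < t'" "t' < t" "t' \<notin> C" using gen[of "t - 1" t] by auto
    have "0 \<le> U k p t'" using seq.departure_props(5)[OF kp]
      by (intro LIMSEQ_le_const[OF U_conv[OF kp t'(3)]]) auto
    also have "\<dots> \<le> U k p t" using t' by (intro monoD[OF U_mono[OF kp]]) simp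
    finally show ?thesis .
  qed
  have U_bot: "(U k p \<longlongrightarrow> 0) at_bot" if kp: "(k, p) \<in> subgroups N" for k p
  proof (rule order_tendstoI)
    fix a :: real assume "a < 0"
    then show "\<forall>\<^sub>F t in at_bot. a < U k p t"
      using U_nonneg[OF kp] by (intro always_eventually allI) (rule less_le_trans)
  next
    fix a :: real assume a: "0 < a"
    obtain R where R: "0 < R" "\<And>n. Us n k p (- R) < a / 2" "\<And>n. seq.sz n k p - Us n k p R < a / 2"
      using tight_uniform[OF kp, of "a / 2"] a by auto
    obtain t0 where t0: "- R - 1 < t0" "t0 < - R" "t0 \<notin> C" using gen[of "- R - 1" "- R"] by auto
    have "U k p t0 \<le> a / 2"
    proof (rule LIMSEQ_le_const2[OF U_conv[OF kp t0(3)]])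
      have "Us (s n) k p t0 \<le> a / 2" for n
        using R(2)[of "s n"] monoD[OF seq.departure_props(1)[OF kp], of t0 "- R" "s n"] t0(2)
          by simp
      then show "\<exists>N. \<forall>n\<ge>N. Us (s n) k p t0 \<le> a / 2" by blast
    qed
    then have "U k p t < a" if "t \<le> t0" for t
      using monoD[OF U_mono[OF kp] that] a by simp
    then show "\<forall>\<^sub>F t in at_bot. U k p t < a" by (auto simp: eventually_at_bot_linorder)
  qed
  have U_dist: "departure_distribution (U k p)" if kp: "(k, p) \<in> subgroups N" for k p
    using U_mono[OF kp] U_left[OF kp] U_bdd[OF kp] U_bot[OF kp]
    by (auto simp: departure_distribution_def bounded_iff)
  have size_conv: "(\<lambda>n. seq.sz (s n) k p) \<longlonglongrightarrow> subgroup_size U k p" if kp: "(k, p) \<in> subgroups N" for k p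
  proof -
    \<comment> \<open>The size functions are constant in x, so any point off C reads off their limit
      S.\<close>
    obtain z where "z \<notin> C" using gen[of 0 1] by auto
    define S where "S = g (3, (k, p), hd (path_arcs p)) z"
    have S: "(\<lambda>n. seq.sz (s n) k p) \<longlonglongrightarrow> S"
      using gC[OF II[of 3, OF _ hd[OF kp]] \<open>z \<notin> C\<close>] by (simp add: f_def S_def)
    \<comment> \<open>That U reaches the full S is where tightness enters: uniformly small tails
      leave no mass to escape to +infinity.\<close>
    have "(U k p \<longlongrightarrow> S) at_top"
    proof (rule order_tendstoI)
      have le: "U k p t \<le> S" for t
      proof -
        obtain t' where t': "t < t'" "t' < t + 1" "t' \<notin> C" using gen[of t "t + 1"] by auto
        have "U k p t \<le> U k p t'" using t' by (intro monoD[OF U_mono[OF kp]]) simp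
        also have "\<dots> \<le> S" using seq.departure_props(6)[OF kp]
          by (intro LIMSEQ_le[OF U_conv[OF kp t'(3)] S]) auto
        finally show ?thesis .
      qed
      fix a assume "S < a"
      then show "\<forall>\<^sub>F t in at_top. U k p t < a"
        using le by (intro always_eventually allI) (rule le_less_trans)
    next
      fix a assume a: "a < S"
      obtain R where R: "0 < R" "\<And>n. Us n k p (- R) < (S - a) / 2"
          "\<And>n. seq.sz n k p - Us n k p R < (S - a) / 2"
        using tight_uniform[OF kp, of "(S - a) / 2"] a by auto
      obtain t0 where t0: "R < t0" "t0 < R + 1" "t0 \<notin> C" using gen[of R "R + 1"] by auto
      have "S - U k p t0 \<le> (S - a) / 2"
      proof (rule LIMSEQ_le_const2[OF tendsto_diff[OF S U_conv[OF kp t0(3)]]])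
        have "seq.sz (s n) k p - Us (s n) k p t0 \<le> (S - a) / 2" for n
          using R(3)[of "s n"] monoD[OF seq.departure_props(1)[OF kp], of R t0 "s n"] t0(1) by simp
        then show "\<exists>N. \<forall>n\<ge>N. seq.sz (s n) k p - Us (s n) k p t0 \<le> (S - a) / 2" by blast
      qed
      then have "a < U k p t" if "t0 \<le> t" for t
        using monoD[OF U_mono[OF kp] that] a by (simp add: field_simps)
      then show "\<forall>\<^sub>F t in at_top. a < U k p t" by (auto simp: eventually_at_top_linorder)
    qed
    then have "subgroup_size U k p = S" by (simp add: subgroup_size_def tendsto_Lim)
    then show ?thesis using S by simp
  qed
  have conv: "(\<lambda>n. f i (s n) x) \<longlonglongrightarrow> g i x"
    if i: "i \<in> I" and lip: "\<And>n x y. x \<le> y \<Longrightarrow> f i n y \<le> f i n x + F * (y - x)" and F: "0 \<le> F" for i F x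
    by (rule lipschitz_limit[OF lip g(2)[OF i] g(1)[OF i] g(4)[OF i] F])
  have Up_conv: "(\<lambda>n. Ups (s n) k p e t) \<longlonglongrightarrow> Up k p e t" if u: "(k, p) \<in> users N e" for k p e t
  proof -
    have f: "f (1, (k, p), e) n = Ups n k p e" for n by (simp add: f_def)
    show ?thesis
      using conv[OF II[of 1, OF _ u], of rate t] seq.Up_rate[OF u] rate_nonneg
      unfolding f Up_def by simp
  qed
  have Um_conv: "(\<lambda>n. Ums (s n) k p e t) \<longlonglongrightarrow> Um k p e t" if tr: "(k, p) \<in> in_transit N e" for k p e t
  proof -
    have f: "f (4, (k, p), e) n = Ums n k p e" for n using tr by (simp add: f_def)
    have "Um k p e = g (4, (k, p), e)" using tr by (simp add: Um_def in_transit_iff)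
    then show ?thesis
      using conv[OF II[of 4, OF _ transit_users[OF tr]], of rate t] seq.Um_rate[OF tr] rate_nonneg
      unfolding f by simp
  qed
  have B_conv: "(\<lambda>n. seq.Bx (s n) k p x) \<longlonglongrightarrow> B k p x" if kp: "(k, p) \<in> subgroups N" for k p x
  proof -
    have f: "f (2, (k, p), hd (path_arcs p)) n = seq.Bx n k p" for n by (simp add: f_def)
    show ?thesis
      using conv[OF II[of 2, OF _ hd[OF kp]], of 1 x] seq.Bx_lipschitz[OF kp]
      unfolding f B_def by simp
  qed
  have "flow_limit N G (\<lambda>n. Us (s n)) (\<lambda>n. Bs (s n)) (\<lambda>n. Ums (s n)) (\<lambda>n. Ups (s n)) U B Um Up C"
  proof unfold_locales
    show "U k p t = 0" if "(k, p) \<notin> subgroups N" for k p t using that by (simp add: U_def)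
    show "Um k p e = U k p" if "(k, p) \<in> departing N e" for k p e
      using that by (simp add: Um_def departing_iff)
  qed (fact sols C U_dist U_conv size_conv Up_conv Um_conv B_conv)+
  then show ?thesis using s by blast
qed

end

section \<open>Existence of a minimizer\<close>

context network
begin

lemma minimizer_exists:
  assumes "solution N G U0 B0 Um0 Up0"
  shows "\<exists>U B Um Up. solution N G U B Um Up \<and>
    (\<forall>U' B' Um' Up'. solution N G U' B' Um' Up' \<longrightarrow> shifted_total U Up \<le> shifted_total U' Up')"
proof -
  define S where "S = {shifted_total U Up | U B Um Up. solution N G U B Um Up}"
  have S: "Inf S \<le> shifted_total U Up" if "solution N G U B Um Up" for U B Um Up
    by (rule Inf_lower) (use that in \<open>auto simp: S_def\<close>)
  show ?thesis
  proof (cases "Inf S = \<infinity>")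
    \<comment> \<open>All solutions tie at infinite cost.\<close>
    case True
    have "shifted_total U0 Up0 \<le> shifted_total U Up" if "solution N G U B Um Up" for U B Um Up
      using S[OF that] True by (simp add: top_unique)
    then show ?thesis using assms by blast
  next
    case False
    have "S \<noteq> {}" using assms by (auto simp: S_def)
    then obtain c where c: "decseq c" "range c \<subseteq> S" "Inf S = (INF i. c i)"
      using ennreal_Inf_countable_INF by blast
    have lim: "c \<longlonglongrightarrow> Inf S" unfolding c(3) by (rule LIMSEQ_INF[OF c(1)])
    have "Inf S < top" using False unfolding infinity_ennreal_def less_top .
    then have "\<forall>\<^sub>F n in sequentially. c n < top" by (rule order_tendstoD(2)[OF lim])
    \<comment> \<open>The sequence decreases, so a finite value c m bounds the tail from m on and
      provides the K that tightness needs.\<close>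
    then obtain m where m: "c m < top" using eventually_happens' sequentially_bot by blast
    have "\<forall>n. \<exists>U B Um Up. solution N G U B Um Up \<and> c (n + m) = shifted_total U Up"
      using c(2) unfolding S_def by blast
    then obtain Us Bs Ums Ups where
      sol: "\<And>n. solution N G (Us n) (Bs n) (Ums n) (Ups n)"
      and val: "\<And>n. c (n + m) = shifted_total (Us n) (Ups n)"
      by metis
    define K where "K = enn2real (c m)"
    interpret fs: flow_sequence N G Us Bs Ums Ups K
    proof unfold_locales
      show "shifted_total (Us n) (Ups n) \<le> ennreal K" for n
        using decseqD[OF c(1), of m "n + m"] m by (simp add: K_def val)
    qed (auto simp: K_def sol)
    obtain s U B Um Up C where s: "strict_mono (s :: nat \<Rightarrow> nat)" and
      fl: "flow_limit N G (\<lambda>n. Us (s n)) (\<lambda>n. Bs (s n)) (\<lambda>n. Ums (s n)) (\<lambda>n. Ups (s n)) U B Um Up C"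
      using fs.limit_exists by blast
    interpret fl: flow_limit N G "\<lambda>n. Us (s n)" "\<lambda>n. Bs (s n)" "\<lambda>n. Ums (s n)" "\<lambda>n. Ups (s n)" U B Um Up C
      by (rule fl)
    have "(\<lambda>n. shifted_total (Us n) (Ups n)) \<longlonglongrightarrow> Inf S"
      using LIMSEQ_ignore_initial_segment[OF lim, of m] by (simp add: val)
    from LIMSEQ_subseq_LIMSEQ[OF this s]
    have "liminf (\<lambda>n. shifted_total (Us (s n)) (Ups (s n))) = Inf S"
      by (intro lim_imp_Liminf) (simp_all add: o_def)
    then have "shifted_total U Up \<le> Inf S" using fl.shifted_total_liminf by simp
    then have "\<forall>U' B' Um' Up'. solution N G U' B' Um' Up' \<longrightarrow> shifted_total U Up \<le> shifted_total U' Up'"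
      using S order_trans by blast
    then show ?thesis using fl.limit_solution by blast
  qed
qed

text \<open>For every solution the shift contributes the same finite sum of shift k * G k, which
  cancels.\<close>

lemma total_cost_le:
  assumes "solution N G U B Um Up" "solution N G U' B' Um' Up'"
    and "shifted_total U Up \<le> shifted_total U' Up'"
  shows "total_cost N U Up \<le> total_cost N U' Up'"
proof -
  interpret f: flow N G U B Um Up by unfold_locales (rule assms)
  interpret f': flow N G U' B' Um' Up' by unfold_locales (rule assms)
  define c where "c = (\<Sum>k\<in>groups N. shift k * G k)"
  have "total_cost N U Up + ereal c \<le> total_cost N U' Up' + ereal c"
    using assms(3) f.total_cost_shifted f'.total_cost_shifted
    by (simp add: c_def less_eq_ennreal.rep_eq)
  then show ?thesis by (cases "total_cost N U Up"; cases "total_cost N U' Up'") auto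
qed

end

section \<open>Existence of a flow\<close>

lemma sum_member_diff_le:
  fixes f :: "'a \<Rightarrow> real \<Rightarrow> real"
  assumes "finite A" "x \<in> A" "\<And>y. y \<in> A \<Longrightarrow> f y s \<le> f y s'"
  shows "f x s' - f x s \<le> (\<Sum>y\<in>A. f y s') - (\<Sum>y\<in>A. f y s)"
  using member_le_sum[of x A "\<lambda>y. f y s' - f y s"] assms by (simp add: sum_subtractf)

lemma zero_until_tendsto: "(\<And>t. t \<le> 0 \<Longrightarrow> f t = 0) \<Longrightarrow> (f \<longlongrightarrow> (0::real)) at_bot" for f :: "real \<Rightarrow> real"
  by (rule tendsto_eventually, rule eventually_at_bot_linorderI[of 0])

context network
begin

section \<open>Departures along a common ramp\<close>

definition chosen_path :: "nat \<Rightarrow> path" where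
  "chosen_path k = (SOME p. p \<in> group_paths N k)"

definition weight :: "nat \<Rightarrow> path \<Rightarrow> real" where
  "weight k p = (if k \<in> groups N \<and> p = chosen_path k then G k else 0)"

text \<open>With departures proportional to one ramp, \<open>U\<^sup>+\<close> is \<open>U\<^sup>-\<close> at the enter time for the departing
  subgroups as well, so that no distinction is needed in the iteration below.\<close>

definition ramp :: "real \<Rightarrow> real" where
  "ramp t = max 0 (min 1 t)"

definition ramp_departure :: "nat \<Rightarrow> path \<Rightarrow> real \<Rightarrow> real" where
  "ramp_departure k p t = weight k p * ramp t"

definition arc_weight :: "arc \<Rightarrow> real" where
  "arc_weight e = (\<Sum>x\<in>departing N e. weight (fst x) (snd x))"

text \<open>When the arc has weight 0, division by 0 yields 0, the only value the range {0..0} then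
  allows.\<close>

definition ramp_prio :: "nat \<Rightarrow> path \<Rightarrow> real \<Rightarrow> real" where
  "ramp_prio k p \<beta> = weight k p / arc_weight (hd (path_arcs p)) * \<beta>"

lemma chosen_path: "k \<in> groups N \<Longrightarrow> chosen_path k \<in> group_paths N k"
  unfolding chosen_path_def using wf by (auto simp: well_formed_def some_in_eq)

lemma weight_nonneg: "0 \<le> weight k p"
  using group_size_nonneg by (simp add: weight_def)

lemma ramp_props: "0 \<le> ramp t" "ramp t \<le> 1" "mono ramp" "continuous_on UNIV ramp" "t \<le> 0 \<Longrightarrow> ramp t = 0"
  "1 \<le> t \<Longrightarrow> ramp t = 1"
  unfolding ramp_def by (auto simp: mono_def intro!: continuous_intros)

lemma ramp_departure_props:
  "0 \<le> ramp_departure k p t" "ramp_departure k p t \<le> weight k p" "mono (ramp_departure k p)"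
  "continuous_on UNIV (ramp_departure k p)" "t \<le> 0 \<Longrightarrow> ramp_departure k p t = 0"
  using ramp_props weight_nonneg[of k p] mult_left_le[of "ramp t" "weight k p"]
  unfolding ramp_departure_def[abs_def]
  by (auto simp: mono_def intro!: continuous_intros mult_left_mono)

lemma ramp_departure_size: "subgroup_size ramp_departure k p = weight k p"
proof -
  have "(ramp_departure k p \<longlongrightarrow> weight k p) at_top"
    by (rule tendsto_eventually, rule eventually_at_top_linorderI[of 1])
      (simp add: ramp_departure_def ramp_props)
  then show ?thesis by (simp add: subgroup_size_def tendsto_Lim)
qed

lemma ramp_admissible: "admissible N G ramp_departure"
  unfolding admissible_def
proof (intro ballI conjI allI)
  fix k assume k: "k \<in> groups N"
  have cp: "chosen_path k \<in> group_paths N k" using chosen_path[OF k] .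
  show "departure_distribution (ramp_departure k p)" for p
  proof -
    have "bounded (range (ramp_departure k p))"
      using ramp_departure_props(1,2)[where k = k and p = p]
        by (auto simp: bounded_iff intro!: exI[of _ "weight k p"])
    moreover have "continuous (at_left t) (ramp_departure k p)" for t
      using ramp_departure_props(4)[where k = k and p = p]
      by (simp add: continuous_on_eq_continuous_at continuous_at_imp_continuous_within)
    ultimately show ?thesis
      using ramp_departure_props(3,5)[where k = k and p = p] zero_until_tendsto[of "ramp_departure k p"]
      by (simp add: departure_distribution_def)
  qed
  show "ramp_departure k p t = 0" if "p \<in> viable_paths N - group_paths N k" for p t
    using that cp by (auto simp: ramp_departure_def weight_def)
  have "(\<Sum>p\<in>viable_paths N. weight k p) = (\<Sum>p\<in>viable_paths N. if p = chosen_path k then G k else 0)"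
    using k by (intro sum.cong) (auto simp: weight_def)
  also have "\<dots> = G k" using cp by (simp add: finite_viable_paths sum.delta group_paths_def)
  finally show "(\<Sum>p\<in>viable_paths N. subgroup_size ramp_departure k p) = G k"
    by (simp add: ramp_departure_size)
qed

lemma arc_size_ramp: "arc_size N ramp_departure e = arc_weight e"
  by (simp add: arc_size_def arc_weight_def ramp_departure_size split_def)

lemma sum_ramp: "(\<Sum>x\<in>departing N e. ramp_departure (fst x) (snd x) t) = arc_weight e * ramp t"
  by (simp add: ramp_departure_def arc_weight_def sum_distrib_right)

lemma weight_le: "(k, p) \<in> departing N e \<Longrightarrow> weight k p \<le> arc_weight e"
  unfolding arc_weight_def
  using member_le_sum[of "(k, p)" "departing N e" "\<lambda>x. weight (fst x) (snd x)"]
  by (simp add: weight_nonneg)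

lemma arc_weight_nonneg: "0 \<le> arc_weight e"
  unfolding arc_weight_def by (intro sum_nonneg weight_nonneg)

lemma ramp_prio_ramp:
  assumes "(k, p) \<in> departing N e"
  shows "ramp_prio k p (arc_weight e * ramp t) = ramp_departure k p t"
  using weight_le[OF assms] weight_nonneg[of k p] assms
  by (cases "arc_weight e = 0") (auto simp: ramp_prio_def ramp_departure_def departing_iff)

lemma ramp_prioritizing: "prioritizing N ramp_departure ramp_prio"
  unfolding prioritizing_def arc_size_ramp ramp_departure_size
proof (intro allI impI conjI ballI)
  fix e y assume y: "y \<in> departing N e"
  obtain k p where kp: "y = (k, p)" by (cases y)
  have d: "(k, p) \<in> departing N e" and hd: "hd (path_arcs p) = e" using y kp
    by (auto simp: departing_iff)
  define c where "c = weight k p / arc_weight e"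
  have c: "0 \<le> c" using weight_nonneg arc_weight_nonneg by (simp add: c_def)
  have B: "ramp_prio k p = (\<lambda>\<beta>. c * \<beta>)" by (simp add: ramp_prio_def[abs_def] hd c_def)
  have "c * arc_weight e \<le> weight k p" using weight_nonneg[of k p] by (simp add: c_def)
  then have "c * \<beta> \<le> weight k p" if "\<beta> \<le> arc_weight e" for \<beta>
    using mult_left_mono[OF that c] by simp
  then have "ramp_prio k p \<in> {0..arc_weight e} \<rightarrow> {0..weight k p}" using c by (auto simp: B)
  moreover have "mono_on {0..arc_weight e} (ramp_prio k p)"
    using c by (auto simp: B intro!: mono_onI mult_left_mono)
  moreover have "AE t in lborel. ramp_prio k p (arc_depart N ramp_departure e t) = ramp_departure k p t"
    using ramp_prio_ramp[OF d] by (simp add: arc_depart_def split_def sum_ramp)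
  ultimately show "case y of (k, p) \<Rightarrow> ramp_prio k p \<in> {0..arc_weight e} \<rightarrow> {0..weight k p} \<and>
      mono_on {0..arc_weight e} (ramp_prio k p) \<and>
      (AE t in lborel. ramp_prio k p (arc_depart N ramp_departure e t) = ramp_departure k p t)"
    by (simp add: kp)
next
  fix e \<beta> assume \<beta>: "\<beta> \<in> {0..arc_weight e}"
  have "(\<Sum>(k, p)\<in>departing N e. ramp_prio k p \<beta>)
      = (\<Sum>x\<in>departing N e. weight (fst x) (snd x) * (\<beta> / arc_weight e))"
    unfolding split_def by (rule sum.cong) (auto simp: ramp_prio_def departing_iff)
  also have "\<dots> = arc_weight e * (\<beta> / arc_weight e)"
    unfolding arc_weight_def by (rule sum_distrib_right[symmetric])
  also have "\<dots> = \<beta>" using \<beta> by auto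
  finally show "(\<Sum>(k, p)\<in>departing N e. ramp_prio k p \<beta>) = \<beta>" .
qed

section \<open>Causal iteration towards a fixed point\<close>

definition regular_state :: "(nat \<Rightarrow> path \<Rightarrow> arc \<Rightarrow> real \<Rightarrow> real) \<Rightarrow> bool" where
  "regular_state V \<longleftrightarrow> (\<forall>k p e. (k, p) \<in> users N e \<longrightarrow> mono (V k p e) \<and> continuous_on UNIV (V k p e) \<and>
    (\<forall>t\<le>0. V k p e t = 0) \<and> (\<forall>t. V k p e t \<le> weight k p))"

text \<open>Entered totals of a regular state are continuous, so the equation has an exact solution;
  by \<open>user_eq\<close> the counts at any two solutions agree, whatever \<open>SOME\<close>
  picks.\<close>

definition enter_time :: "(nat \<Rightarrow> path \<Rightarrow> arc \<Rightarrow> real \<Rightarrow> real) \<Rightarrow> arc \<Rightarrow> real \<Rightarrow> real" where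
  "enter_time V e t = (SOME \<tau>. total_entered N V e \<tau> = total_exited N V e t)"

definition transfer :: "(nat \<Rightarrow> path \<Rightarrow> arc \<Rightarrow> real \<Rightarrow> real) \<Rightarrow> nat \<Rightarrow> path \<Rightarrow> arc \<Rightarrow> real \<Rightarrow> real" where
  "transfer V k p e t = V k p e (enter_time V e t)"

text \<open>The position of e in the path, minus one. On the first arc the truncated subtraction
  gives a junk value, which \<open>advance\<close> does not consult.\<close>

definition prev_arc :: "path \<Rightarrow> arc \<Rightarrow> arc" where
  "prev_arc p e = path_arcs p ! ((LEAST q. path_arcs p ! q = e) - 1)"

text \<open>Exits computed from V become the entries of the next arc; a flow with ramp departures is
  a fixed point of this map.\<close>

definition advance :: "(nat \<Rightarrow> path \<Rightarrow> arc \<Rightarrow> real \<Rightarrow> real) \<Rightarrow> nat \<Rightarrow> path \<Rightarrow> arc \<Rightarrow> real \<Rightarrow> real" where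
  "advance V k p e = (if e = hd (path_arcs p) then ramp_departure k p else transfer V k p (prev_arc p e))"

lemma prev_arc:
  assumes "(k, p) \<in> subgroups N" "Suc q < length (path_arcs p)"
  shows "prev_arc p (path_arcs p ! Suc q) = path_arcs p ! q"
proof -
  have "(LEAST r. path_arcs p ! r = path_arcs p ! Suc q) = Suc q"
  proof (rule Least_equality)
    fix r assume r: "path_arcs p ! r = path_arcs p ! Suc q"
    show "Suc q \<le> r"
    proof (rule ccontr)
      assume "\<not> Suc q \<le> r"
      then show False
        using r nth_eq_iff_index_eq[OF distinct_path_arcs[OF subgroupD(4)[OF assms(1)]], of r "Suc q"]
          assms(2) by simp
    qed
  qed simp
  then show ?thesis by (simp add: prev_arc_def)
qed

lemma regular_stateD:
  assumes "regular_state V" "(k, p) \<in> users N e"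
  shows "mono (V k p e)" "continuous_on UNIV (V k p e)" "t \<le> 0 \<Longrightarrow> V k p e t = 0"
    "V k p e t \<le> weight k p" "0 \<le> V k p e t"
proof -
  have "mono (V k p e) \<and> continuous_on UNIV (V k p e) \<and>
    (\<forall>t\<le>0. V k p e t = 0) \<and> (\<forall>t. V k p e t \<le> weight k p)"
    using assms unfolding regular_state_def by blast
  then have *: "mono (V k p e)" "continuous_on UNIV (V k p e)" "V k p e t \<le> weight k p"
    and zero: "\<And>t. t \<le> 0 \<Longrightarrow> V k p e t = 0"
    by auto
  then show "mono (V k p e)" "continuous_on UNIV (V k p e)" "t \<le> 0 \<Longrightarrow> V k p e t = 0"
    "V k p e t \<le> weight k p"
    by auto
  show "0 \<le> V k p e t"
    using zero[of "min 0 t"] monoD[OF *(1), of "min 0 t" t] by simp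
qed

lemma entered_alt: "total_entered N V e t = (\<Sum>x\<in>users N e. V (fst x) (snd x) e t)"
  by (simp add: total_entered_def split_def)

lemma entered_props:
  assumes "regular_state V"
  shows "mono (total_entered N V e)" "continuous_on UNIV (total_entered N V e)"
    "t \<le> 0 \<Longrightarrow> total_entered N V e t = 0" "0 \<le> total_entered N V e t"
proof -
  have ab: "total_entered N V e = (\<lambda>t. \<Sum>x\<in>users N e. V (fst x) (snd x) e t)"
    by (rule ext) (rule entered_alt)
  show "mono (total_entered N V e)"
    unfolding mono_def ab using regular_stateD(1)[OF assms]
      by (intro allI impI sum_mono) (simp add: monoD)
  show "continuous_on UNIV (total_entered N V e)"
    unfolding ab using regular_stateD(2)[OF assms] by (intro continuous_on_sum) simp
  show "total_entered N V e t = 0" if "t \<le> 0"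
    unfolding ab using regular_stateD(3)[OF assms _ that] by (intro sum.neutral) simp
  show "0 \<le> total_entered N V e t"
    unfolding ab using regular_stateD(5)[OF assms] by (intro sum_nonneg) simp
qed

lemma user_diff_le:
  assumes V: "regular_state V" and u: "(k, p) \<in> users N e" and "s \<le> s'"
  shows "V k p e s' - V k p e s \<le> total_entered N V e s' - total_entered N V e s"
proof -
  have "V (fst x) (snd x) e s \<le> V (fst x) (snd x) e s'" if "x \<in> users N e" for x
    using that by (intro monoD[OF regular_stateD(1)[OF V] assms(3)]) simp
  from sum_member_diff_le[of _ _ "\<lambda>x. V (fst x) (snd x) e", OF finite_users u this] show ?thesis
    by (simp add: entered_alt)
qed

text \<open>All summands are nondecreasing, so equal totals leave no room for change in any one of
  them.\<close>

lemma user_eq: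
  assumes V: "regular_state V" and u: "(k, p) \<in> users N e"
    and "total_entered N V e s = total_entered N V e s'"
  shows "V k p e s = V k p e s'"
  using user_diff_le[OF V u, of s s'] user_diff_le[OF V u, of s' s] assms(3)
    monoD[OF regular_stateD(1)[OF V u], of s s'] monoD[OF regular_stateD(1)[OF V u], of s' s]
  by linarith

lemma exited_props:
  assumes V: "regular_state V" and e: "viable_arc N e"
  shows "0 \<le> total_exited N V e t" "total_exited N V e t \<le> total_entered N V e (t - delay e)"
    "t \<le> t' \<Longrightarrow> total_exited N V e t \<le> total_exited N V e t'"
    "t \<le> t' \<Longrightarrow> total_exited N V e t' \<le> total_exited N V e t + flux_max N e * (t' - t)"
proof -
  interpret delay_kernel "kernel e" "delay e" "flux_max N e" "len N e * crit_density N e"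
    by (rule kernel_locale[OF e])
  note nonneg = entered_props(4)[OF V]
  show "0 \<le> total_exited N V e t" "total_exited N V e t \<le> total_entered N V e (t - delay e)"
    unfolding total_exited_eq by (rule outflow_nonneg outflow_le_delayed, rule nonneg)+
  show "t \<le> t' \<Longrightarrow> total_exited N V e t \<le> total_exited N V e t'"
    "t \<le> t' \<Longrightarrow> total_exited N V e t' \<le> total_exited N V e t + flux_max N e * (t' - t)"
    unfolding total_exited_eq by (rule outflow_mono outflow_lipschitz, rule nonneg, assumption)+
qed

text \<open>Intermediate values between a time when nobody has entered and t - delay. The bound on
  \<tau> is what makes \<open>transfer\<close> causal; the time picked by \<open>enter_time\<close>
  itself may be later.\<close>

lemma enter_time_ex:
  assumes V: "regular_state V" and e: "viable_arc N e"
  obtains \<tau> where "\<tau> \<le> t - delay e" "total_entered N V e \<tau> = total_exited N V e t"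
proof -
  have "\<exists>\<tau>. min 0 (t - delay e) \<le> \<tau> \<and> \<tau> \<le> t - delay e \<and> total_entered N V e \<tau> = total_exited N V e t"
  proof (rule IVT')
    show "total_entered N V e (min 0 (t - delay e)) \<le> total_exited N V e t"
      using entered_props(3)[OF V, of "min 0 (t - delay e)" e] exited_props(1)[OF V e, of t] by simp
    show "continuous_on {min 0 (t - delay e)..t - delay e} (total_entered N V e)"
      using entered_props(2)[OF V] by (rule continuous_on_subset) simp
  qed (use exited_props(2)[OF V e] in auto)
  then show ?thesis using that by blast
qed

lemma enter_time:
  assumes "regular_state V" "viable_arc N e"
  shows "total_entered N V e (enter_time V e t) = total_exited N V e t"
proof -
  obtain \<tau> where "total_entered N V e \<tau> = total_exited N V e t" using enter_time_ex[OF assms, of t]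
    by blast
  then show ?thesis unfolding enter_time_def by (rule someI)
qed

lemma transfer_eq:
  assumes "regular_state V" "(k, p) \<in> users N e" "total_entered N V e \<tau> = total_exited N V e t"
  shows "transfer V k p e t = V k p e \<tau>"
  unfolding transfer_def using enter_time[OF assms(1) viable_users[OF assms(2)]] assms(3)
  by (intro user_eq[OF assms(1,2)]) simp

lemma transfer_props:
  assumes V: "regular_state V" and u: "(k, p) \<in> users N e"
  shows "mono (transfer V k p e)" "continuous_on UNIV (transfer V k p e)"
    "t \<le> 0 \<Longrightarrow> transfer V k p e t = 0" "transfer V k p e t \<le> weight k p"
proof -
  note e = viable_users[OF u]
  have *: "transfer V k p e t \<le> transfer V k p e t' \<and>
      transfer V k p e t' \<le> transfer V k p e t + flux_max N e * (t' - t)" if t: "t \<le> t'" for t t'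
  proof -
    define a b where "a = enter_time V e t" and "b = enter_time V e t'"
    have a: "total_entered N V e a = total_exited N V e t"
      and b: "total_entered N V e b = total_exited N V e t'"
      using enter_time[OF V e] by (auto simp: a_def b_def)
    have "V k p e a \<le> V k p e b \<and> V k p e b - V k p e a \<le> flux_max N e * (t' - t)"
    proof (cases "a \<le> b")
      case True
      then show ?thesis
        using monoD[OF regular_stateD(1)[OF V u] True] user_diff_le[OF V u True]
          exited_props(4)[OF V e t] by (simp add: a b)
    next
      \<comment> \<open>The chosen times need not increase with t; when they are out of order the
        totals coincide, and so do the counts.\<close>
      case False
      then have "total_entered N V e b \<le> total_entered N V e a"
        by (intro monoD[OF entered_props(1)[OF V]]) simp
      then have "V k p e a = V k p e b"
        using exited_props(3)[OF V e t] by (intro user_eq[OF V u]) (simp add: a b)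
      then show ?thesis using t flux_max_pos[OF e] by simp
    qed
    then show ?thesis by (simp add: transfer_def a_def b_def)
  qed
  show "mono (transfer V k p e)" using * by (simp add: mono_def)
  then show "continuous_on UNIV (transfer V k p e)"
    using * by (intro continuous_lipschitz_mono[of _ "flux_max N e"]) auto
  show "transfer V k p e t \<le> weight k p" unfolding transfer_def by (rule regular_stateD(4)[OF V u])
  show "transfer V k p e t = 0" if "t \<le> 0"
  proof -
    obtain \<tau> where \<tau>: "\<tau> \<le> t - delay e" "total_entered N V e \<tau> = total_exited N V e t"
      by (rule enter_time_ex[OF V e])
    have "0 < delay e" by (rule delay_kernel.delay_pos[OF kernel_locale[OF e]])
    then have "\<tau> \<le> 0" using \<tau>(1) that by simp
    then show ?thesis using transfer_eq[OF V u \<tau>(2)] regular_stateD(3)[OF V u] by simp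
  qed
qed

lemma user_cases:
  assumes "(k, p) \<in> users N e"
  obtains "e = hd (path_arcs p)"
  | q where "e \<noteq> hd (path_arcs p)" "prev_arc p e = path_arcs p ! q"
    "(k, p) \<in> users N (path_arcs p ! q)"
  using assms
proof (rule user_or)
  assume "(k, p) \<in> departing N e"
  then show thesis using that(1) by (simp add: departing_iff)
next
  assume tr: "(k, p) \<in> in_transit N e"
  then obtain q where q: "Suc q < length (path_arcs p)" "e = path_arcs p ! Suc q"
    "(k, p) \<in> users N (path_arcs p ! q)" "(k, p) \<in> subgroups N"
    by (rule user_prev)
  then show thesis using that(2)[of q] prev_arc[OF q(4,1)] tr by (simp add: in_transit_iff)
qed

lemma regular_advance:
  assumes V: "regular_state V"
  shows "regular_state (advance V)"
  unfolding regular_state_def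
proof (intro allI impI)
  fix k p e assume u: "(k, p) \<in> users N e"
  show "mono (advance V k p e) \<and> continuous_on UNIV (advance V k p e) \<and>
    (\<forall>t\<le>0. advance V k p e t = 0) \<and> (\<forall>t. advance V k p e t \<le> weight k p)"
    using u
  proof (cases rule: user_cases)
    case 1
    then show ?thesis using ramp_departure_props[where k = k and p = p] by (simp add: advance_def)
  next
    case (2 q)
    then show ?thesis using transfer_props[OF V 2(3)] by (simp add: advance_def)
  qed
qed

definition agree :: "real \<Rightarrow> (nat \<Rightarrow> path \<Rightarrow> arc \<Rightarrow> real \<Rightarrow> real) \<Rightarrow>
    (nat \<Rightarrow> path \<Rightarrow> arc \<Rightarrow> real \<Rightarrow> real) \<Rightarrow> bool" where
  "agree s V V' \<longleftrightarrow> (\<forall>k p e t. (k, p) \<in> users N e \<longrightarrow> t \<le> s \<longrightarrow> V k p e t = V' k p e t)"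

lemma agreeD: "agree s V V' \<Longrightarrow> (k, p) \<in> users N e \<Longrightarrow> t \<le> s \<Longrightarrow> V k p e t = V' k p e t"
  unfolding agree_def by blast

text \<open>The 1 keeps \<open>Min\<close> meaningful when there are no viable arcs.\<close>

definition min_delay :: real where
  "min_delay = Min (insert 1 (delay ` {e. viable_arc N e}))"

lemma min_delay: "0 < min_delay" "viable_arc N e \<Longrightarrow> min_delay \<le> delay e"
proof -
  have "0 < delay e" if "viable_arc N e" for e
    by (rule delay_kernel.delay_pos[OF kernel_locale[OF that]])
  then show "0 < min_delay" using finite_viable_arcs
    by (auto simp: min_delay_def simp del: split_paired_All)
  show "viable_arc N e \<Longrightarrow> min_delay \<le> delay e"
    unfolding min_delay_def using finite_viable_arcs by (intro Min_le) auto
qed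

text \<open>The exit total at t depends only on entries up to t - delay \<le> s, so an enter time
  below that bound found for V is one for V' as well.\<close>

lemma transfer_causal:
  assumes V: "regular_state V" and V': "regular_state V'" and ag: "agree s V V'"
    and u: "(k, p) \<in> users N e" and t: "t \<le> s + min_delay"
  shows "transfer V k p e t = transfer V' k p e t"
proof -
  note e = viable_users[OF u]
  have E: "total_entered N V e r = total_entered N V' e r" if "r \<le> s" for r
    unfolding entered_alt using ag that by (intro sum.cong) (auto dest: agreeD)
  have le: "t - delay e \<le> s" using t min_delay(2)[OF e] by simp
  have X: "total_exited N V e t = total_exited N V' e t"
    unfolding total_exited_eq
    by (rule delay_kernel.outflow_cong[OF kernel_locale[OF e]])
      (use entered_props[OF V] entered_props[OF V'] E le in auto)
  obtain \<tau> where \<tau>: "\<tau> \<le> t - delay e" "total_entered N V e \<tau> = total_exited N V e t"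
    by (rule enter_time_ex[OF V e])
  have "transfer V k p e t = V k p e \<tau>" by (rule transfer_eq[OF V u \<tau>(2)])
  also have "\<dots> = V' k p e \<tau>" using agreeD[OF ag u] \<tau>(1) le by simp
  also have "\<dots> = transfer V' k p e t"
    using E[of \<tau>] \<tau> le X by (intro transfer_eq[OF V' u, symmetric]) simp
  finally show ?thesis .
qed

lemma agree_advance:
  assumes "regular_state V" "regular_state V'" "agree s V V'"
  shows "agree (s + min_delay) (advance V) (advance V')"
  unfolding agree_def
proof (intro allI impI)
  fix k p e t assume u: "(k, p) \<in> users N e" and t: "t \<le> s + min_delay"
  show "advance V k p e t = advance V' k p e t"
    using u
  proof (cases rule: user_cases)
    case (2 q)
    then show ?thesis using transfer_causal[OF assms 2(3) t] by (simp add: advance_def)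
  qed (simp add: advance_def)
qed

definition iterate :: "nat \<Rightarrow> nat \<Rightarrow> path \<Rightarrow> arc \<Rightarrow> real \<Rightarrow> real" where
  "iterate n = (advance ^^ n) (\<lambda>k p e. if e = hd (path_arcs p) then ramp_departure k p else (\<lambda>_. 0))"

lemma iterate_Suc: "iterate (Suc n) = advance (iterate n)"
  by (simp add: iterate_def)

lemma regular_iterate: "regular_state (iterate n)"
proof (induction n)
  case 0
  show ?case
    unfolding regular_state_def iterate_def
    using ramp_departure_props weight_nonneg by (auto simp: mono_def)
next
  case (Suc n)
  then show ?case by (simp add: iterate_Suc regular_advance)
qed

lemma agree_iterate_Suc: "agree (real n * min_delay) (iterate n) (iterate (Suc n))"
proof (induction n)
  case 0
  \<comment> \<open>Regular states vanish up to time 0, which starts the induction.\<close>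
  show ?case using regular_stateD(3)[OF regular_iterate] by (auto simp: agree_def)
next
  case (Suc n)
  have "agree (real n * min_delay + min_delay) (advance (iterate n)) (advance (iterate (Suc n)))"
    by (intro agree_advance regular_iterate Suc)
  then show ?case by (simp add: iterate_Suc algebra_simps)
qed

lemma agree_iterate:
  assumes "n \<le> m"
  shows "agree (real n * min_delay) (iterate n) (iterate m)"
  using assms
proof (induction m rule: dec_induct)
  case base
  show ?case by (simp add: agree_def)
next
  case (step m)
  have "real n * min_delay \<le> real m * min_delay" using step(1) min_delay(1) by simp
  then show ?case
    using step(3) agree_iterate_Suc[of m] unfolding agree_def by (metis order_trans)
qed

text \<open>Time t is read from an iterate n with t \<le> n * min_delay, which further iteration no
  longer changes at t; for t \<le> 0 this is n = 0.\<close>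

definition fixed_flow :: "nat \<Rightarrow> path \<Rightarrow> arc \<Rightarrow> real \<Rightarrow> real" where
  "fixed_flow k p e t = iterate (nat \<lceil>t / min_delay\<rceil>) k p e t"

lemma fixed_flow_eq:
  assumes u: "(k, p) \<in> users N e" and t: "t \<le> real m * min_delay"
  shows "fixed_flow k p e t = iterate m k p e t"
proof -
  define n where "n = nat \<lceil>t / min_delay\<rceil>"
  have "t / min_delay \<le> real n" unfolding n_def by linarith
  then have "t \<le> real n * min_delay" using min_delay(1) by (simp add: field_simps)
  then have "iterate n k p e t = iterate m k p e t"
    using agreeD[OF agree_iterate u t] agreeD[OF agree_iterate u] by (metis nat_le_linear)
  then show ?thesis by (simp add: fixed_flow_def n_def)
qed

lemma agree_fixed_flow: "agree (real m * min_delay) fixed_flow (iterate m)"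
  unfolding agree_def using fixed_flow_eq by blast

lemma time_bound:
  obtains m where "t \<le> real m * min_delay"
proof -
  obtain m where "t / min_delay \<le> real m" using real_arch_simple by blast
  then show ?thesis using that[of m] min_delay(1) by (simp add: field_simps)
qed

lemma regular_fixed_flow: "regular_state fixed_flow"
  unfolding regular_state_def
proof (intro allI impI conjI)
  fix k p e assume u: "(k, p) \<in> users N e"
  show "mono (fixed_flow k p e)"
  proof (rule monoI)
    fix s t :: real assume st: "s \<le> t"
    obtain m where m: "t \<le> real m * min_delay" by (rule time_bound)
    show "fixed_flow k p e s \<le> fixed_flow k p e t"
      using fixed_flow_eq[OF u m] fixed_flow_eq[OF u order_trans[OF st m]]
        monoD[OF regular_stateD(1)[OF regular_iterate u] st] by simp
  qed
  have "isCont (fixed_flow k p e) t" for t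
  proof -
    \<comment> \<open>The margin 1 puts a whole neighbourhood of t under one iterate.\<close>
    obtain m where m: "t + 1 \<le> real m * min_delay" by (rule time_bound)
    have "\<forall>\<^sub>F s in nhds t. s < t + 1" using eventually_nhds_in_open[of "{..<t + 1}" t] by simp
    then have "\<forall>\<^sub>F s in nhds t. fixed_flow k p e s = iterate m k p e s"
      by eventually_elim (use m in \<open>auto intro!: fixed_flow_eq[OF u]\<close>)
    moreover have "isCont (iterate m k p e) t"
      using regular_stateD(2)[OF regular_iterate u] by (simp add: continuous_on_eq_continuous_at)
    ultimately show ?thesis using isCont_cong by blast
  qed
  then show "continuous_on UNIV (fixed_flow k p e)" by (simp add: continuous_on_eq_continuous_at)
  show "fixed_flow k p e t \<le> weight k p" for t
    unfolding fixed_flow_def by (rule regular_stateD(4)[OF regular_iterate u])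
  show "fixed_flow k p e t = 0" if "t \<le> 0" for t
    unfolding fixed_flow_def by (rule regular_stateD(3)[OF regular_iterate u that])
qed

lemma fixed_flow_fixed:
  assumes u: "(k, p) \<in> users N e"
  shows "fixed_flow k p e = advance fixed_flow k p e"
proof
  fix t
  obtain m where m: "t \<le> real m * min_delay" by (rule time_bound)
  have m': "t \<le> real m * min_delay + min_delay" using m min_delay(1) by simp
  have "advance fixed_flow k p e t = advance (iterate m) k p e t"
    using agreeD[OF agree_advance[OF regular_fixed_flow regular_iterate agree_fixed_flow] u m'] .
  also have "\<dots> = iterate (Suc m) k p e t" by (simp add: iterate_Suc)
  also have "\<dots> = fixed_flow k p e t"
    using fixed_flow_eq[OF u, of t "Suc m"] m' by (simp add: algebra_simps)
  finally show "fixed_flow k p e t = advance fixed_flow k p e t" by simp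
qed

lemma fixed_flow_first: "(k, p) \<in> departing N e \<Longrightarrow> fixed_flow k p e = ramp_departure k p"
  using fixed_flow_fixed[of k p e] subgroupD(6)[of k p]
  by (auto simp: advance_def departing_iff users_iff)

text \<open>X - T(\<tau>) is the number of departures entered by \<tau>, the weight of the arc times
  the ramp; the linear priorities return to each subgroup its own share.\<close>

lemma fixed_flow_enter_time:
  assumes e: "viable_arc N e"
  defines "\<tau> \<equiv> \<lambda>t. enter_time fixed_flow e t"
  shows "is_enter_time N fixed_flow e t (\<tau> t) \<and>
        (\<forall>(k, p)\<in>in_transit N e. transfer fixed_flow k p e t = fixed_flow k p e (\<tau> t)) \<and>
        (\<forall>(k, p)\<in>departing N e.
           (let \<beta> = total_exited N fixed_flow e t - transit_entered N fixed_flow e (\<tau> t)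
            in \<beta> \<in> {0..arc_size N ramp_departure e} \<and>
              transfer fixed_flow k p e t = ramp_prio k p \<beta>))"
proof -
  note V = regular_fixed_flow
  have E: "total_entered N fixed_flow e (\<tau> t) = total_exited N fixed_flow e t"
    unfolding \<tau>_def by (rule enter_time[OF V e])
  have "is_enter_time N fixed_flow e t (\<tau> t)"
    unfolding is_enter_time_def Lim_at_left_le_iff[OF entered_props(1)[OF V]]
      le_Lim_at_right_iff[OF entered_props(1)[OF V]] E[symmetric]
    using monoD[OF entered_props(1)[OF V]] by auto
  moreover have "total_exited N fixed_flow e t - transit_entered N fixed_flow e (\<tau> t)
      = arc_weight e * ramp (\<tau> t)"
  proof -
    have "(\<Sum>x\<in>departing N e. fixed_flow (fst x) (snd x) e (\<tau> t)) = arc_weight e * ramp (\<tau> t)"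
      unfolding sum_ramp[symmetric] by (rule sum.cong) (auto simp: fixed_flow_first)
    then show ?thesis
      unfolding E[symmetric] entered_alt transit_entered_def split_def sum_users by simp
  qed
  moreover have "arc_weight e * ramp (\<tau> t) \<in> {0..arc_size N ramp_departure e}"
    unfolding arc_size_ramp
    using arc_weight_nonneg[of e] ramp_props(1,2)[of "\<tau> t"] mult_left_le[of "ramp (\<tau> t)" "arc_weight e"]
    by simp
  ultimately show ?thesis
    using ramp_prio_ramp[of _ _ e] fixed_flow_first[of _ _ e] by (auto simp: transfer_def \<tau>_def)
qed

lemma solution_exists: "\<exists>U B Um Up. solution N G U B Um Up"
proof -
  note V = regular_fixed_flow
  have count: "cumulative_count (weight k p) (fixed_flow k p e)"
      "cumulative_count (weight k p) (transfer fixed_flow k p e)" if u: "(k, p) \<in> users N e" for k p e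
    using regular_stateD[OF V u] transfer_props[OF V u]
    by (auto simp: cumulative_count_def intro: zero_until_tendsto)
  have next_eq: "fixed_flow k p (path_arcs p ! Suc q) = transfer fixed_flow k p (path_arcs p ! q)"
    if kp: "(k, p) \<in> subgroups N" and q: "Suc q < length (path_arcs p)" for k p q
  proof -
    have "path_arcs p ! Suc q \<noteq> hd (path_arcs p)"
      using Suc_in_transit[OF kp q] by (simp add: in_transit_iff)
    moreover have "(k, p) \<in> users N (path_arcs p ! Suc q)" using kp q by (simp add: users_iff)
    ultimately show ?thesis
      using fixed_flow_fixed[of k p "path_arcs p ! Suc q"] prev_arc[OF kp q]
        by (simp add: advance_def)
  qed
  have "(\<forall>e\<in>set (path_arcs p).
           cumulative_count (weight k p) (fixed_flow k p e) \<and>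
           cumulative_count (weight k p) (transfer fixed_flow k p e)) \<and>
        fixed_flow k p (hd (path_arcs p)) = ramp_departure k p \<and>
        (\<forall>q. Suc q < length (path_arcs p) \<longrightarrow>
           fixed_flow k p (path_arcs p ! Suc q) = transfer fixed_flow k p (path_arcs p ! q))"
    if kp: "(k, p) \<in> subgroups N" for k p
  proof -
    have "(k, p) \<in> departing N (hd (path_arcs p))" using kp by (simp add: departing_iff)
    from fixed_flow_first[OF this] show ?thesis
      using count kp next_eq[OF kp] unfolding users_iff by blast
  qed
  then have "traffic_flow N ramp_departure ramp_prio fixed_flow (transfer fixed_flow)"
    unfolding traffic_flow_def ramp_departure_size
    by (intro conjI exI[of _ "\<lambda>e t. enter_time fixed_flow e t"] allI impI fixed_flow_enter_time) blast+
  then show ?thesis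
    unfolding solution_def using ramp_admissible ramp_prioritizing by blast
qed

end

theorem theorem3p1:
  fixes N :: traffic_network and G :: "nat \<Rightarrow> real"
  assumes "well_formed N"
    and "flux_assumption N"
    and "cost_assumption N"
    and "\<forall>k\<in>groups N. 0 \<le> G k"
  shows "\<exists>U B Um Up. solution N G U B Um Up \<and>
           (\<forall>U' B' Um' Up'. solution N G U' B' Um' Up' \<longrightarrow>
              total_cost N U Up \<le> total_cost N U' Up')"
proof -
  interpret network N G by unfold_locales fact+
  obtain U0 B0 Um0 Up0 where "solution N G U0 B0 Um0 Up0" using solution_exists by blast
  then obtain U B Um Up where "solution N G U B Um Up"
    "\<forall>U' B' Um' Up'. solution N G U' B' Um' Up' \<longrightarrow> shifted_total U Up \<le> shifted_total U' Up'"
    using minimizer_exists by blast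
  then show ?thesis using total_cost_le by blast
qed

end
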